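(* Let $k\in\{1,3\}$. With $W_i(z)$, $\mathcal T(\xi;z)$ and $f(\xi;z)$ as defined in the context, for either choice of sign (upper signs throughout or lower signs throughout), $$q_k^{\pm1}f\Big(q_k^{\pm1};\frac wz\Big)W_1(z)\mathcal T(q_k^{\pm1};w)-f\Big(q_k^{\mp1};\frac zw\Big)\mathcal T(q_k^{\pm1};w)W_1(z)=\pm q^{\pm1}(q_k-q_k^{-1})\,\delta\bigg(\frac{q_k^{\pm1}w}{q_2^{\pm1}z}\bigg)W_2(w),$$ $$q_k^{\mp1}f\Big(q_k^{\mp1};\frac{q_k^{\pm1}w}{z}\Big)W_2(z)\mathcal T(q_k^{\pm1};w)-f\Big(q_k^{\pm1};\frac{z}{q_k^{\pm1}w}\Big)\mathcal T(q_k^{\pm1};w)W_2(z)=\mp q^{\mp1}(q_k-q_k^{-1})\,\delta\Big(\frac{q_2^{\pm1}w}{z}\Big)W_1(q_k^{\pm1}w).$$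
   Context: Parameters: $q,d\in\mathbb C$ with $q^nd^m\ne1$ for all integers $(n,m)\neq(0,0)$; $q_1=q^{-1}d$, $q_2=q^2$, $q_3=q^{-1}d^{-1}$ (so $q_1q_2q_3=1$); $\beta=-\log q_3/\log q_1$, so $q_3=q_1^{-\beta}$. Formal delta function: $\delta(z)=\sum_{n\in\mathbb Z}z^n$. Heisenberg algebra: generators $h^\perp_{i,n},Q_i^\perp$ ($i=1,2$, $n\in\mathbb Z$), $\mathsf a_0^\perp,\mathsf Q^\perp$ with $[h^\perp_{i,n},h^\perp_{i,m}]=n\delta_{n+m,0}$; $[h^\perp_{i,n},h^\perp_{j,m}]=-n\frac{q_1^n+q_3^n}{1+q_2^{-n}}\delta_{n+m,0}$ for $i\ne j$; $[h^\perp_{i,0},Q_i^\perp]=1$, $[h^\perp_{i,0},Q^\perp_j]=-1$ for $i\ne j$; $[\mathsf a_0^\perp,\mathsf Q^\perp]=\beta/2$; $h^\perp_{1,0}=-h^\perp_{2,0}$, $Q_1^\perp=-Q_2^\perp$; other commutators vanish. $:\ast:$ is the normal ordering (modes with $n<0$ and $Q_i^\perp,\mathsf Q^\perp$ to the left; modes with $n\ge 0$ and $\mathsf a_0^\perp$ to the right). $W_i(z)=\Lambda_i^+(z)+\Lambda_i^-(z)$ ($i=1,2$) with $$\Lambda_i^+(z)=:\exp\Big(-\sum_{n\ne0}\frac{q^n}{n}h^\perp_{i,n}z^{-n}\Big):e^{Q_i^\perp}(q^{-1}z)^{h^\perp_{i,0}}q_1^{\mathsf a_0^\perp},\qquad \Lambda_i^-(z)=:\exp\Big(\sum_{n\ne0}\frac{q^{-n}}{n}h^\perp_{i,n}z^{-n}\Big):e^{-Q_i^\perp}(qz)^{-h^\perp_{i,0}}q_1^{-\mathsf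 a_0^\perp}.$$ For $\xi\in\mathbb C\setminus\{0\}$, $$\mathcal T(\xi;z)=q:\Lambda_1^+(\xi z)\Lambda_2^+(z):+q^{-1}:\Lambda_1^-(\xi z)\Lambda_2^-(z):+z^2q(1-q_1\xi)(1-q_3\xi):\Lambda_1^+(\xi z)\Lambda_2^-(z):+z^2q^{-1}(1-q_1^{-1}\xi)(1-q_3^{-1}\xi):\Lambda_1^-(\xi z)\Lambda_2^+(z):.$$ Structure function: $f(\xi;z)=\exp\Big\{\sum_{n\ge1}\Big(\xi^n-\frac{q_1^n+q_3^n}{1+q_2^{-n}}\Big)\frac{z^n}{n}\Big\}$. Identities are between formal series in $z,w$; structure functions of (a multiple of) $w/z$ (resp. $z/w$) are power series in $w/z$ (resp. $z/w$). *)

theory Defs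
  imports
    Complex_Main
    "HOL-Library.Groups_Big_Fun"
    "HOL-Computational_Algebra.Formal_Power_Series"
begin

section \<open>Parameters\<close>

definition generic :: "complex \<Rightarrow> complex \<Rightarrow> bool" where
  "generic q d \<longleftrightarrow> q \<noteq> 0 \<and> d \<noteq> 0 \<and>
     (\<forall>n m :: int. (n, m) \<noteq> (0, 0) \<longrightarrow> q powi n * d powi m \<noteq> 1)"

definition q1 :: "complex \<Rightarrow> complex \<Rightarrow> complex" where
  "q1 q d = inverse q * d"

definition q2 :: "complex \<Rightarrow> complex" where
  "q2 q = q ^ 2"

definition q3 :: "complex \<Rightarrow> complex \<Rightarrow> complex" where
  "q3 q d = inverse q * inverse d"

section \<open>Modules over the Heisenberg algebra\<close>

text \<open>
  The currents are formal series whose coefficients lie in a completion of the Heisenberg algebra.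
  They are rendered as operators on an arbitrary module \<open>'v\<close> to which this completion applies.
  The logarithmic generators \<open>Q\<^sub>i\<^sup>\<bottom>\<close>, \<open>Q\<^sup>\<bottom>\<close> enter only through
  their exponentials: the relations \<open>[X, Q] = c\<close> with \<open>c\<close> a number become
  \<open>[X, exp Q] = c exp Q\<close>. (No operator \<open>Q\<close> with \<open>[h, Q] = 1\<close> can exist
  on a nonzero space on which \<open>h\<close> is diagonalizable, which is needed for \<open>z\<^sup>h\<close>.)

  Fields: scalar multiplication, \<open>h\<^sup>\<bottom>\<^sub>i\<^sub>,\<^sub>n\<close> (for \<open>i = 1, 2\<close>),
  \<open>exp Q\<^sup>\<bottom>\<^sub>i\<close>, \<open>a\<^sub>0\<^sup>\<bottom>\<close> and \<open>exp Q\<^sup>\<bottom>\<close>.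
\<close>

record 'v heis =
  smul :: "complex \<Rightarrow> 'v \<Rightarrow> 'v"
  hmode :: "nat \<Rightarrow> int \<Rightarrow> 'v \<Rightarrow> 'v"
  expQi :: "nat \<Rightarrow> 'v \<Rightarrow> 'v"
  azero :: "'v \<Rightarrow> 'v"
  expQ :: "'v \<Rightarrow> 'v"

text \<open>\<open>g x\<close> is the component of \<open>v\<close> in the \<open>x\<close>-eigenspace of \<open>X\<close>.\<close>

definition eigdecomp ::
  "('v::ab_group_add) heis \<Rightarrow> ('v \<Rightarrow> 'v) \<Rightarrow> 'v \<Rightarrow> (complex \<Rightarrow> 'v) \<Rightarrow> bool" where
  "eigdecomp R X v g \<longleftrightarrow>
     finite {x. g x \<noteq> 0} \<and> (\<forall>x. X (g x) = smul R x (g x)) \<and> v = Sum_any g"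

definition eigcomp ::
  "('v::ab_group_add) heis \<Rightarrow> ('v \<Rightarrow> 'v) \<Rightarrow> 'v \<Rightarrow> complex \<Rightarrow> 'v" where
  "eigcomp R X v = (THE g. eigdecomp R X v g)"

text \<open>
  \<open>l1\<close>, \<open>l3\<close> are the chosen values of \<open>log q\<^sub>1\<close>, \<open>log q\<^sub>3\<close>, so that
  \<open>\<beta> = - l3 / l1\<close> and \<open>q\<^sub>1\<^sup>x = exp (l1 x)\<close>.

  The last three assumptions say that the completed algebra acts: \<open>z\<^sup>h\<close> (for \<open>h = h\<^sub>1\<^sub>,\<^sub>0\<close>) is a
  Laurent series in \<open>z\<close>, \<open>q\<^sub>1\<^sup>a\<close> (for \<open>a = a\<^sub>0\<close>) is defined, and every vector is
  annihilated by all products of positive modes of sufficiently large total degree.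
\<close>

locale heisenberg_module = vector_space "smul R"
  for R :: "('v::ab_group_add) heis" +
  fixes q d l1 l3 :: complex
  assumes generic: "generic q d"
    and log_q1: "exp l1 = q1 q d"
    and log_q3: "exp l3 = q3 q d"
    and linear_h: "i \<in> {1, 2} \<Longrightarrow> Vector_Spaces.linear (smul R) (smul R) (hmode R i n)"
    and linear_expQi: "i \<in> {1, 2} \<Longrightarrow> Vector_Spaces.linear (smul R) (smul R) (expQi R i)"
    and linear_a0: "Vector_Spaces.linear (smul R) (smul R) (azero R)"
    and linear_expQ: "Vector_Spaces.linear (smul R) (smul R) (expQ R)"
    and bij_expQi: "i \<in> {1, 2} \<Longrightarrow> bij (expQi R i)"
    and bij_expQ: "bij (expQ R)"
    and h_h_same: "i \<in> {1, 2} \<Longrightarrow>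
      hmode R i n (hmode R i m v) - hmode R i m (hmode R i n v) =
        smul R (if n + m = 0 then of_int n else 0) v"
    and h_h_diff: "\<lbrakk>i \<in> {1, 2}; j \<in> {1, 2}; i \<noteq> j\<rbrakk> \<Longrightarrow>
      hmode R i n (hmode R j m v) - hmode R j m (hmode R i n v) =
        smul R (if n + m = 0
                then - of_int n * ((q1 q d powi n + q3 q d powi n) / (1 + q2 q powi (- n)))
                else 0) v"
    and h_expQi_same: "i \<in> {1, 2} \<Longrightarrow>
      hmode R i n (expQi R i v) - expQi R i (hmode R i n v) =
        smul R (if n = 0 then 1 else 0) (expQi R i v)"
    and h_expQi_diff: "\<lbrakk>i \<in> {1, 2}; j \<in> {1, 2}; i \<noteq> j\<rbrakk> \<Longrightarrow>
      hmode R i n (expQi R j v) - expQi R j (hmode R i n v) =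
        smul R (if n = 0 then -1 else 0) (expQi R j v)"
    and a0_expQ: "azero R (expQ R v) - expQ R (azero R v) = smul R ((- l3 / l1) / 2) (expQ R v)"
    and h10_h20: "hmode R 1 0 v = - hmode R 2 0 v"
    and expQ1_expQ2: "expQi R 1 (expQi R 2 v) = v"
    and a0_h: "i \<in> {1, 2} \<Longrightarrow> azero R (hmode R i n v) = hmode R i n (azero R v)"
    and a0_expQi: "i \<in> {1, 2} \<Longrightarrow> azero R (expQi R i v) = expQi R i (azero R v)"
    and expQ_h: "i \<in> {1, 2} \<Longrightarrow> expQ R (hmode R i n v) = hmode R i n (expQ R v)"
    and expQ_expQi: "i \<in> {1, 2} \<Longrightarrow> expQ R (expQi R i v) = expQi R i (expQ R v)"
    and h10_integral: "\<exists>g. eigdecomp R (hmode R 1 0) v g \<and> (\<forall>x. g x \<noteq> 0 \<longrightarrow> x \<in> \<int>)"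
    and a0_diagonal: "\<exists>g. eigdecomp R (azero R) v g"
    and smooth: "\<exists>N. \<forall>ws :: (nat \<times> int) list.
      (\<forall>(i, n) \<in> set ws. i \<in> {1, 2} \<and> n > 0) \<longrightarrow> (\<Sum>(i, n)\<leftarrow>ws. n) > N \<longrightarrow>
        foldr (\<lambda>(i, n). hmode R i n) ws v = 0"

section \<open>Formal series of operators\<close>

text \<open>\<open>A n\<close> is the coefficient of \<open>z\<^sup>n\<close> in \<open>A(z)\<close>.\<close>

type_synonym 'v opser = "int \<Rightarrow> 'v \<Rightarrow> 'v"

definition opser_const :: "('v::ab_group_add \<Rightarrow> 'v) \<Rightarrow> 'v opser" where
  "opser_const X = (\<lambda>n v. if n = 0 then X v else 0)"

text \<open>The product of two series in the same variable. \<open>Sum_any\<close> is a sum with finitely many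
  nonzero terms; see the lemmas below for the finiteness in all uses.\<close>

definition opser_mult :: "('v::ab_group_add) opser \<Rightarrow> 'v opser \<Rightarrow> 'v opser" where
  "opser_mult A B = (\<lambda>n v. Sum_any (\<lambda>k. A (n - k) (B k v)))"

text \<open>
  \<open>op_pow A r m\<close> is the coefficient of \<open>t\<^sup>m\<close> in the \<open>r\<close>-th power of
  \<open>\<Sum>k\<ge>1. A\<^sub>k t\<^sup>k\<close>, and \<open>op_exp R A m\<close> that in its exponential, to which only
  the powers with \<open>r \<le> m\<close> contribute.
\<close>

primrec op_pow :: "(nat \<Rightarrow> 'v \<Rightarrow> 'v::ab_group_add) \<Rightarrow> nat \<Rightarrow> nat \<Rightarrow> 'v \<Rightarrow> 'v" where
  "op_pow A 0 m v = (if m = 0 then v else 0)"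
| "op_pow A (Suc r) m v = (\<Sum>k = 1..m. A k (op_pow A r (m - k) v))"

definition op_exp ::
  "('v::ab_group_add) heis \<Rightarrow> (nat \<Rightarrow> 'v \<Rightarrow> 'v) \<Rightarrow> nat \<Rightarrow> 'v \<Rightarrow> 'v" where
  "op_exp R A m v = (\<Sum>r\<le>m. smul R (1 / fact r) (op_pow A r m v))"

text \<open>The series \<open>(c z)\<^sup>X\<close> for \<open>X\<close> diagonalizable with integral eigenvalues, and the
  operator \<open>exp (t X)\<close> for \<open>X\<close> diagonalizable.\<close>

definition zpower ::
  "('v::ab_group_add) heis \<Rightarrow> complex \<Rightarrow> ('v \<Rightarrow> 'v) \<Rightarrow> 'v opser" where
  "zpower R c X = (\<lambda>m v. smul R (c powi m) (eigcomp R X v (of_int m)))"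

definition exp_diag ::
  "('v::ab_group_add) heis \<Rightarrow> complex \<Rightarrow> ('v \<Rightarrow> 'v) \<Rightarrow> 'v \<Rightarrow> 'v" where
  "exp_diag R t X v = Sum_any (\<lambda>x. smul R (exp (t * x)) (eigcomp R X v x))"

section \<open>Normally ordered products\<close>

text \<open>
  A triple \<open>(s, i, \<xi>)\<close> with \<open>s = 1\<close> or \<open>s = -1\<close> stands for the factor
  \<open>\<Lambda>\<^sub>i\<^sup>+(\<xi> z)\<close> or \<open>\<Lambda>\<^sub>i\<^sup>-(\<xi> z)\<close>, that is, for
  \<open>:exp (- s \<Sum>n\<noteq>0. q\<^sup>s\<^sup>n / n h\<^sub>i\<^sub>,\<^sub>n (\<xi> z)\<^sup>-\<^sup>n): e\<^sup>s\<^sup>Q (q\<^sup>-\<^sup>s \<xi> z)\<^sup>s\<^sup>h q\<^sub>1\<^sup>s\<^sup>a\<close> with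
  \<open>Q = Q\<^sub>i\<close>, \<open>h = h\<^sub>i\<^sub>,\<^sub>0\<close>, \<open>a = a\<^sub>0\<close>. A list of triples
  stands for the normally ordered product of its factors.
\<close>

type_synonym factor = "int \<times> nat \<times> complex"

text \<open>The coefficient of \<open>z\<^sup>-\<^sup>n\<close> (\<open>n \<noteq> 0\<close>) in the sum of the exponents of the
  factors.\<close>

definition no_exponent ::
  "('v::ab_group_add) heis \<Rightarrow> complex \<Rightarrow> factor list \<Rightarrow> int \<Rightarrow> 'v \<Rightarrow> 'v" where
  "no_exponent R q fs n v =
     (\<Sum>(s, i, \<xi>)\<leftarrow>fs.
        smul R (- of_int s * (q powi (s * n) / of_int n) * \<xi> powi (- n)) (hmode R i n v))"

definition no_creation ::
  "('v::ab_group_add) heis \<Rightarrow> complex \<Rightarrow> factor list \<Rightarrow> 'v opser" where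
  "no_creation R q fs =
     (\<lambda>m. if m \<ge> 0 then op_exp R (\<lambda>n. no_exponent R q fs (- int n)) (nat m) else (\<lambda>v. 0))"

definition no_annihilation ::
  "('v::ab_group_add) heis \<Rightarrow> complex \<Rightarrow> factor list \<Rightarrow> 'v opser" where
  "no_annihilation R q fs =
     (\<lambda>m. if m \<le> 0 then op_exp R (\<lambda>n. no_exponent R q fs (int n)) (nat (- m)) else (\<lambda>v. 0))"

definition no_expQ :: "('v::ab_group_add) heis \<Rightarrow> factor list \<Rightarrow> 'v \<Rightarrow> 'v" where
  "no_expQ R fs = foldr (\<lambda>(s, i, \<xi>). if s = 1 then expQi R i else inv (expQi R i)) fs"

definition no_zmode ::
  "('v::ab_group_add) heis \<Rightarrow> complex \<Rightarrow> factor list \<Rightarrow> 'v opser" where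
  "no_zmode R q fs =
     foldr (\<lambda>(s, i, \<xi>). opser_mult
        (zpower R (q powi (- s) * \<xi>) (\<lambda>v. smul R (of_int s) (hmode R i 0 v))))
       fs (opser_const (\<lambda>v. v))"

definition no_azero ::
  "('v::ab_group_add) heis \<Rightarrow> complex \<Rightarrow> factor list \<Rightarrow> 'v \<Rightarrow> 'v" where
  "no_azero R l1 fs = foldr (\<lambda>(s, i, \<xi>). exp_diag R (of_int s * l1) (azero R)) fs"

definition nord ::
  "('v::ab_group_add) heis \<Rightarrow> complex \<Rightarrow> complex \<Rightarrow> factor list \<Rightarrow> 'v opser" where
  "nord R q l1 fs =
     opser_mult (no_creation R q fs)
       (opser_mult (opser_const (no_expQ R fs))
         (opser_mult (no_zmode R q fs)
           (opser_mult (opser_const (no_azero R l1 fs)) (no_annihilation R q fs))))"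

section \<open>The currents\<close>

definition Lambda_plus ::
  "('v::ab_group_add) heis \<Rightarrow> complex \<Rightarrow> complex \<Rightarrow> nat \<Rightarrow> 'v opser" where
  "Lambda_plus R q l1 i = nord R q l1 [(1, i, 1)]"

definition Lambda_minus ::
  "('v::ab_group_add) heis \<Rightarrow> complex \<Rightarrow> complex \<Rightarrow> nat \<Rightarrow> 'v opser" where
  "Lambda_minus R q l1 i = nord R q l1 [(-1, i, 1)]"

definition W_current ::
  "('v::ab_group_add) heis \<Rightarrow> complex \<Rightarrow> complex \<Rightarrow> nat \<Rightarrow> 'v opser" where
  "W_current R q l1 i n v = Lambda_plus R q l1 i n v + Lambda_minus R q l1 i n v"

definition T_current ::
  "('v::ab_group_add) heis \<Rightarrow> complex \<Rightarrow> complex \<Rightarrow> complex \<Rightarrow> complex \<Rightarrow> 'v opser" where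
  "T_current R q d l1 \<xi> n v =
     smul R q (nord R q l1 [(1, 1, \<xi>), (1, 2, 1)] n v)
   + smul R (inverse q) (nord R q l1 [(-1, 1, \<xi>), (-1, 2, 1)] n v)
   + smul R (q * (1 - q1 q d * \<xi>) * (1 - q3 q d * \<xi>))
       (nord R q l1 [(1, 1, \<xi>), (-1, 2, 1)] (n - 2) v)
   + smul R (inverse q * (1 - inverse (q1 q d) * \<xi>) * (1 - inverse (q3 q d) * \<xi>))
       (nord R q l1 [(-1, 1, \<xi>), (1, 2, 1)] (n - 2) v)"

definition struct_fun :: "complex \<Rightarrow> complex \<Rightarrow> complex \<Rightarrow> complex fps" where
  "struct_fun q d \<xi> = fps_exp 1 oo
     Abs_fps (\<lambda>n. if n = 0 then 0
       else (\<xi> ^ n - (q1 q d ^ n + q3 q d ^ n) / (1 + q2 q powi (- int n))) / of_nat n)"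

section \<open>Series in two variables\<close>

text \<open>Each of the following is the coefficient of \<open>z\<^sup>a w\<^sup>b\<close>, applied to \<open>v\<close>, in
  \<open>F(w/z) A(z) B(w)\<close>, \<open>F(z/w) B(w) A(z)\<close> and \<open>\<delta>(c w/z) B(w)\<close>, respectively.\<close>

definition zw_product ::
  "('v::ab_group_add) heis \<Rightarrow> complex fps \<Rightarrow> 'v opser \<Rightarrow> 'v opser \<Rightarrow> int \<Rightarrow> int \<Rightarrow> 'v \<Rightarrow> 'v" where
  "zw_product R F A B a b v =
     Sum_any (\<lambda>n::nat. smul R (fps_nth F n) (A (a + int n) (B (b - int n) v)))"

definition wz_product ::
  "('v::ab_group_add) heis \<Rightarrow> complex fps \<Rightarrow> 'v opser \<Rightarrow> 'v opser \<Rightarrow> int \<Rightarrow> int \<Rightarrow> 'v \<Rightarrow> 'v" where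
  "wz_product R F B A a b v =
     Sum_any (\<lambda>n::nat. smul R (fps_nth F n) (B (b + int n) (A (a - int n) v)))"

definition delta_product ::
  "('v::ab_group_add) heis \<Rightarrow> complex \<Rightarrow> 'v opser \<Rightarrow> int \<Rightarrow> int \<Rightarrow> 'v \<Rightarrow> 'v" where
  "delta_product R c B a b v =
     Sum_any (\<lambda>n::int. if a = - n then smul R (c powi n) (B (b - n) v) else 0)"

definition fps_rescale :: "complex \<Rightarrow> complex fps \<Rightarrow> complex fps" where
  "fps_rescale c F = F oo (fps_const c * fps_X)"

definition opser_rescale :: "('v::ab_group_add) heis \<Rightarrow> complex \<Rightarrow> 'v opser \<Rightarrow> 'v opser" where
  "opser_rescale R c A = (\<lambda>n v. smul R (c powi n) (A n v))"

section \<open>Finiteness of the sums\<close>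

text \<open>\<open>Sum_any\<close> is \<open>0\<close> on families with infinite support. On a Heisenberg module all the
  families above have finite support.\<close>

definition locally_finite :: "('v::ab_group_add) opser \<Rightarrow> bool" where
  "locally_finite A \<longleftrightarrow> (\<forall>n. A n 0 = 0) \<and> (\<forall>v. finite {n. A n v \<noteq> 0})"

definition lower_truncated :: "('v::ab_group_add) opser \<Rightarrow> bool" where
  "lower_truncated A \<longleftrightarrow> (\<forall>n. A n 0 = 0) \<and> (\<forall>v. \<exists>L. \<forall>n<L. A n v = 0)"

definition valid_factors :: "factor list \<Rightarrow> bool" where
  "valid_factors fs \<longleftrightarrow> (\<forall>(s, i, \<xi>) \<in> set fs. s \<in> {1, -1} \<and> i \<in> {1, 2})"

lemma opser_mult_finite_terms:
  assumes "\<And>n. A n 0 = 0" "locally_finite B"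
  shows "finite {k. A (n - k) (B k v) \<noteq> 0}"
  by (rule finite_subset[of _ "{k. B k v \<noteq> 0}"]) (use assms in \<open>auto simp: locally_finite_def\<close>)

lemma locally_finite_mult:
  assumes A: "locally_finite A" and B: "locally_finite B"
  shows "locally_finite (opser_mult A B)"
  unfolding locally_finite_def
proof (intro conjI allI)
  show "opser_mult A B n 0 = 0" for n
    using A B by (simp add: opser_mult_def locally_finite_def)
next
  fix v
  let ?K = "{k. B k v \<noteq> 0}"
  have "{n. opser_mult A B n v \<noteq> 0} \<subseteq> (\<Union>k\<in>?K. (\<lambda>m. m + k) ` {m. A m (B k v) \<noteq> 0})"
  proof
    fix n assume "n \<in> {n. opser_mult A B n v \<noteq> 0}"
    then obtain k where k: "A (n - k) (B k v) \<noteq> 0"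
      unfolding opser_mult_def mem_Collect_eq by (rule Sum_any.not_neutral_obtains_not_neutral)
    then have "B k v \<noteq> 0" using A by (auto simp: locally_finite_def)
    with k show "n \<in> (\<Union>k\<in>?K. (\<lambda>m. m + k) ` {m. A m (B k v) \<noteq> 0})"
      by (force intro: image_eqI[of _ _ "n - k"])
  qed
  then show "finite {n. opser_mult A B n v \<noteq> 0}"
    by (rule finite_subset) (use A B in \<open>auto simp: locally_finite_def\<close>)
qed

lemma lower_truncated_mult:
  assumes A: "\<And>n. A n 0 = 0" "\<And>n v. n < 0 \<Longrightarrow> A n v = 0" and B: "locally_finite B"
  shows "lower_truncated (opser_mult A B)"
  unfolding lower_truncated_def
proof (intro conjI allI)
  show "opser_mult A B n 0 = 0" for n
    using A B by (simp add: opser_mult_def locally_finite_def)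
next
  fix v
  have fin: "finite {k. B k v \<noteq> 0}" using B by (simp add: locally_finite_def)
  then obtain L where "\<forall>k\<in>{k. B k v \<noteq> 0}. L \<le> k"
    by (meson bdd_below_finite bdd_below_def bdd_below.unfold)
  then have "A (n - k) (B k v) = 0" if "n < L" for n k
    using A that by (cases "B k v = 0") auto
  then have "\<forall>n<L. opser_mult A B n v = 0" by (simp add: opser_mult_def)
  then show "\<exists>L. \<forall>n<L. opser_mult A B n v = 0" by blast
qed

lemma locally_finite_const: "X 0 = 0 \<Longrightarrow> locally_finite (opser_const X)"
  unfolding locally_finite_def opser_const_def
  by (auto intro: finite_subset[of _ "{0}"])

lemma (in vector_space) eigen_sum_zero:
  assumes "Vector_Spaces.linear scale scale X" "finite S"
    and "\<And>x. x \<in> S \<Longrightarrow> X (g x) = scale x (g x)" "sum g S = 0" "x \<in> S"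
  shows "g x = 0"
  using assms(2-)
proof (induction S arbitrary: g x rule: finite_induct)
  case (insert y S)
  interpret X: Vector_Spaces.linear scale scale X by fact
  have s: "g y + sum g S = 0" using insert by simp
  have "X (g y + sum g S) = 0" using s by (simp add: X.zero)
  moreover have "X (g y + sum g S) = scale y (g y) + (\<Sum>x\<in>S. scale x (g x))"
    using insert.prems by (simp add: X.add X.sum)
  ultimately have "(\<Sum>x\<in>S. scale x (g x)) - scale y (sum g S) = 0"
    using s by (metis add_eq_0_iff eq_iff_diff_eq_0 scale_minus_right)
  then have "(\<Sum>x\<in>S. scale (x - y) (g x)) = 0"
    by (simp add: scale_left_diff_distrib sum_subtractf scale_sum_right)
  moreover have "X (scale (x - y) (g x)) = scale x (scale (x - y) (g x))" if "x \<in> S" for x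
    using that insert.prems by (simp add: X.scale mult.commute)
  ultimately have "\<forall>x\<in>S. scale (x - y) (g x) = 0"
    using insert.IH[of "\<lambda>x. scale (x - y) (g x)"] by blast
  then have S: "\<forall>x\<in>S. g x = 0" using insert.hyps by auto
  then have "sum g S = 0" by simp
  with s S insert.prems show ?case by auto
qed simp

context heisenberg_module
begin

lemma eigdecomp_unique:
  assumes "Vector_Spaces.linear (smul R) (smul R) X" "eigdecomp R X v g" "eigdecomp R X v g'"
  shows "g = g'"
proof
  fix x
  interpret X: Vector_Spaces.linear "smul R" "smul R" X by fact
  define S where "S = insert x ({x. g x \<noteq> 0} \<union> {x. g' x \<noteq> 0})"
  have fin: "finite S" using assms by (auto simp: S_def eigdecomp_def)
  have "sum g S = v"
    using assms(2) fin by (auto simp: eigdecomp_def S_def intro!: Sum_any.expand_superset[symmetric])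
  moreover have "sum g' S = v"
    using assms(3) fin by (auto simp: eigdecomp_def S_def intro!: Sum_any.expand_superset[symmetric])
  ultimately have "(\<Sum>x\<in>S. g x - g' x) = 0" by (simp add: sum_subtractf)
  then have "g x - g' x = 0"
    using assms(2,3)
    by (intro eigen_sum_zero[OF assms(1) fin, of "\<lambda>x. g x - g' x"])
      (auto simp: eigdecomp_def X.diff scale_right_diff_distrib S_def)
  then show "g x = g' x" by simp
qed

lemma eigcomp_eq:
  assumes "Vector_Spaces.linear (smul R) (smul R) X" "eigdecomp R X v g"
  shows "eigcomp R X v = g"
  unfolding eigcomp_def using assms eigdecomp_unique by blast

lemma eigdecomp_zero:
  assumes "Vector_Spaces.linear (smul R) (smul R) X"
  shows "eigdecomp R X 0 (\<lambda>_. 0)"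
proof -
  interpret X: Vector_Spaces.linear "smul R" "smul R" X by fact
  show ?thesis by (simp add: eigdecomp_def X.zero)
qed

lemma h0_eigdecomp:
  assumes "i \<in> {1, 2}" "s \<in> {1, - 1}"
  obtains g where "eigdecomp R (\<lambda>v. smul R (of_int s) (hmode R i 0 v)) v g"
    "\<And>x. g x \<noteq> 0 \<Longrightarrow> x \<in> \<int>"
proof -
  obtain g where g: "eigdecomp R (hmode R 1 0) v g" "\<forall>x. g x \<noteq> 0 \<longrightarrow> x \<in> \<int>"
    using h10_integral by blast
  have h2: "hmode R 2 0 v = - hmode R 1 0 v" for v using h10_h20[of v] by simp
  define t :: complex where "t = of_int s * (if i = 1 then 1 else -1)"
  have t: "t = 1 \<or> t = - 1" using assms by (auto simp: t_def)
  have eq: "(\<lambda>v. smul R (of_int s) (hmode R i 0 v)) = (\<lambda>v. smul R t (hmode R 1 0 v))"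
    using assms h2 by (auto simp: t_def)
  have inv: "t * (t * x) = x" for x using t by auto
  define g' where "g' = (\<lambda>x. g (t * x))"
  have bij: "bij (\<lambda>x. t * x)" by (rule o_bij[of "\<lambda>x. t * x"]) (auto simp: inv)
  have "{x. g' x \<noteq> 0} = (\<lambda>x. t * x) ` {x. g x \<noteq> 0}"
    by (auto simp: g'_def inv intro: image_eqI[of _ _ "t * _"])
  then have "finite {x. g' x \<noteq> 0}" using g by (simp add: eigdecomp_def)
  moreover have "Sum_any g' = Sum_any g"
    unfolding g'_def using Sum_any.reindex_cong[OF bij, of g] by (simp add: comp_def)
  moreover have "smul R t (hmode R 1 0 (g' x)) = smul R x (g' x)" for x
    using g(1) by (simp add: g'_def eigdecomp_def inv)
  ultimately have "eigdecomp R (\<lambda>v. smul R (of_int s) (hmode R i 0 v)) v g'"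
    using g unfolding eq by (simp add: eigdecomp_def)
  moreover have "x \<in> \<int>" if "g' x \<noteq> 0" for x
  proof -
    have "t * x \<in> \<int>" using g(2) that by (auto simp: g'_def)
    then show ?thesis using t by auto
  qed
  ultimately show ?thesis using that by blast
qed

lemma linear_h0:
  assumes "i \<in> {1, 2}"
  shows "Vector_Spaces.linear (smul R) (smul R) (\<lambda>v. smul R c (hmode R i 0 v))"
proof -
  interpret H: Vector_Spaces.linear "smul R" "smul R" "hmode R i 0" using assms by (rule linear_h)
  show ?thesis
    by unfold_locales (simp_all add: H.add H.scale scale_right_distrib mult.commute)
qed

lemma locally_finite_zpower:
  assumes "i \<in> {1, 2}" "s \<in> {1, - 1}"
  shows "locally_finite (zpower R c (\<lambda>v. smul R (of_int s) (hmode R i 0 v)))"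
    (is "locally_finite (zpower R c ?X)")
  unfolding locally_finite_def
proof (intro conjI allI)
  have lin: "Vector_Spaces.linear (smul R) (smul R) ?X" using assms(1) by (rule linear_h0)
  show "zpower R c ?X n 0 = 0" for n
    by (simp add: zpower_def eigcomp_eq[OF lin eigdecomp_zero[OF lin]])
  fix v
  obtain g where g: "eigdecomp R ?X v g" using h0_eigdecomp[OF assms] by blast
  have "finite {m::int. g (of_int m) \<noteq> 0}"
    using finite_vimageI[of "{x. g x \<noteq> 0}" "of_int :: int \<Rightarrow> complex"] g
    by (simp add: eigdecomp_def vimage_def inj_on_def)
  then show "finite {n. zpower R c ?X n v \<noteq> 0}"
    by (rule rev_finite_subset) (auto simp: zpower_def eigcomp_eq[OF lin g])
qed

lemma locally_finite_zmode:
  "valid_factors fs \<Longrightarrow> locally_finite (no_zmode R q fs)"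
proof (induction fs)
  case Nil
  then show ?case by (simp add: no_zmode_def locally_finite_const)
next
  case (Cons f fs)
  then show ?case
    unfolding no_zmode_def
    by (auto simp: valid_factors_def split: prod.splits intro!: locally_finite_mult
        locally_finite_zpower simp del: scale_minus_left scale_one)
qed

lemma exp_diag_finite_terms: "finite {x. smul R (exp (t * x)) (eigcomp R (azero R) v x) \<noteq> 0}"
proof -
  obtain g where g: "eigdecomp R (azero R) v g" using a0_diagonal by blast
  then have "finite {x. g x \<noteq> 0}" by (simp add: eigdecomp_def)
  then show ?thesis unfolding eigcomp_eq[OF linear_a0 g] by simp
qed

lemma no_azero_zero: "no_azero R l1 fs 0 = 0"
proof (induction fs)
  case (Cons f fs)
  then show ?case
    by (auto simp: no_azero_def exp_diag_def eigcomp_eq[OF linear_a0 eigdecomp_zero[OF linear_a0]]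
        split: prod.splits)
qed (simp add: no_azero_def)

lemma no_expQ_zero: "valid_factors fs \<Longrightarrow> no_expQ R fs 0 = 0"
proof (induction fs)
  case (Cons f fs)
  obtain s i \<xi> where f: "f = (s, i, \<xi>)" by (cases f)
  have i: "i \<in> {1, 2}" using Cons.prems by (auto simp: valid_factors_def f)
  interpret E: Vector_Spaces.linear "smul R" "smul R" "expQi R i" using i by (rule linear_expQi)
  have "inv (expQi R i) 0 = 0" using bij_expQi[OF i] E.zero by (metis bij_inv_eq_iff)
  then show ?case using Cons E.zero by (auto simp: no_expQ_def f valid_factors_def)
qed (simp add: no_expQ_def)

lemma no_exponent_zero: "valid_factors fs \<Longrightarrow> no_exponent R q fs n 0 = 0"
proof -
  assume "valid_factors fs"
  then have "hmode R i n 0 = 0" if "(s, i, \<xi>) \<in> set fs" for s i \<xi>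
    using that linear_h[of i n] module_hom.zero[of "smul R" "smul R" "hmode R i n"]
    by (auto simp: valid_factors_def linear_iff_module_hom)
  then have "\<forall>x\<in>set fs. (case x of (s, i, \<xi>) \<Rightarrow> smul R (- of_int s * (q powi (s * n) / of_int n) * \<xi> powi (- n)) (hmode R i n 0)) = 0"
    by auto
  then show ?thesis unfolding no_exponent_def by (metis (mono_tags, lifting) map_eq_conv map_replicate_const sum_list_0 sum_list_replicate)
qed

lemma op_exp_zero: "(\<And>n. A n 0 = 0) \<Longrightarrow> op_exp R A m 0 = 0"
proof -
  assume A: "\<And>n. A n 0 = 0"
  have "op_pow A r m 0 = 0" for r m
    by (induction r arbitrary: m) (auto simp: A)
  then show ?thesis by (simp add: op_exp_def)
qed

definition words :: "'v \<Rightarrow> int \<Rightarrow> 'v set" where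
  "words v m = {foldr (\<lambda>(i, n). hmode R i n) ws v | ws :: (nat \<times> int) list.
     (\<forall>(i, n) \<in> set ws. i \<in> {1, 2} \<and> n > 0) \<and> (\<Sum>(i, n)\<leftarrow>ws. n) = m}"

lemma h_words: "i \<in> {1, 2} \<Longrightarrow> n > 0 \<Longrightarrow> u \<in> words v m \<Longrightarrow> hmode R i n u \<in> words v (n + m)"
proof -
  assume i: "i \<in> {1, 2}" "n > 0" and "u \<in> words v m"
  then obtain ws where "u = foldr (\<lambda>(i, n). hmode R i n) ws v"
    "\<forall>(i, n) \<in> set ws. i \<in> {1, 2} \<and> n > 0" "(\<Sum>(i, n)\<leftarrow>ws. n) = m"
    by (auto simp: words_def)
  with i show ?thesis unfolding words_def
    by (intro CollectI exI[of _ "(i, n) # ws"]) auto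
qed

lemma h_span_words:
  assumes "i \<in> {1, 2}" "n > 0" "u \<in> span (words v m)"
  shows "hmode R i n u \<in> span (words v (n + m))"
proof -
  interpret H: Vector_Spaces.linear "smul R" "smul R" "hmode R i n" using assms(1) by (rule linear_h)
  have "hmode R i n u \<in> span (hmode R i n ` words v m)"
    using assms(3) H.span_image by blast
  also have "\<dots> \<subseteq> span (words v (n + m))"
    by (intro span_mono) (use h_words assms in blast)
  finally show ?thesis .
qed

lemma no_exponent_span_words:
  assumes "valid_factors fs" "n > 0" "u \<in> span (words v m)"
  shows "no_exponent R q fs n u \<in> span (words v (n + m))"
  using assms(1) unfolding no_exponent_def
proof (induction fs)
  case (Cons f fs)
  then show ?case
    using assms(2,3)
    by (auto simp: valid_factors_def split: prod.splits
        intro!: span_add span_scale h_span_words simp del: scale_minus_left)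
qed (simp add: span_zero)

lemma op_pow_span_words:
  assumes "valid_factors fs"
  shows "op_pow (\<lambda>n. no_exponent R q fs (int n)) r m v \<in> span (words v (int m))"
proof (induction r arbitrary: m)
  case 0
  have "v \<in> words v 0" unfolding words_def by (intro CollectI exI[of _ "[]"]) auto
  then show ?case by (auto simp: span_base span_zero)
next
  case (Suc r)
  have "no_exponent R q fs (int k) (op_pow (\<lambda>n. no_exponent R q fs (int n)) r (m - k) v)
      \<in> span (words v (int m))" if "k \<in> {1..m}" for k
    using no_exponent_span_words[OF assms _ Suc[of "m - k"], of "int k"] that by simp
  then show ?case by (auto intro!: span_sum)
qed

lemma locally_finite_annihilation:
  assumes "valid_factors fs"
  shows "locally_finite (no_annihilation R q fs)"
  unfolding locally_finite_def
proof (intro conjI allI)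
  show "no_annihilation R q fs n 0 = 0" for n
    using assms by (simp add: no_annihilation_def op_exp_zero no_exponent_zero)
  fix v
  obtain N where N: "\<And>ws. (\<forall>(i, n) \<in> set ws. i \<in> {1, 2} \<and> n > 0) \<Longrightarrow> (\<Sum>(i, n)\<leftarrow>ws. n) > N
      \<Longrightarrow> foldr (\<lambda>(i, n). hmode R i n) ws v = 0"
    using smooth[of v] by blast
  have "no_annihilation R q fs m v = 0" if "m < - N" for m
  proof (cases "m \<le> 0")
    case True
    have "words v (int (nat (- m))) \<subseteq> {0}" using N True that by (auto simp: words_def)
    then have "span (words v (int (nat (- m)))) \<subseteq> {0}"
      by (metis span_mono span_empty span_insert_0)
    then have "op_pow (\<lambda>n. no_exponent R q fs (int n)) r (nat (- m)) v = 0" for r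
      using op_pow_span_words[OF assms] by blast
    then show ?thesis by (simp add: no_annihilation_def op_exp_def)
  qed (simp add: no_annihilation_def)
  moreover have "no_annihilation R q fs m v = 0" if "m > 0" for m
    using that by (simp add: no_annihilation_def)
  ultimately have "{n. no_annihilation R q fs n v \<noteq> 0} \<subseteq> {- N..0}"
    unfolding subset_iff mem_Collect_eq atLeastAtMost_iff by (meson not_less)
  then show "finite {n. no_annihilation R q fs n v \<noteq> 0}"
    by (rule finite_subset) simp
qed

lemma nord_inner_locally_finite:
  assumes "valid_factors fs"
  shows "locally_finite (opser_mult (opser_const (no_azero R l1 fs)) (no_annihilation R q fs))"
    and "locally_finite (opser_mult (no_zmode R q fs)
           (opser_mult (opser_const (no_azero R l1 fs)) (no_annihilation R q fs)))"
    and "locally_finite (opser_mult (opser_const (no_expQ R fs)) (opser_mult (no_zmode R q fs)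
           (opser_mult (opser_const (no_azero R l1 fs)) (no_annihilation R q fs))))"
  using assms
  by (auto intro!: locally_finite_mult locally_finite_const locally_finite_zmode
      locally_finite_annihilation no_azero_zero no_expQ_zero)

lemma nord_lower_truncated:
  assumes "valid_factors fs"
  shows "lower_truncated (nord R q l1 fs)"
  unfolding nord_def
  using assms nord_inner_locally_finite(3)[OF assms]
  by (intro lower_truncated_mult) (auto simp: no_creation_def op_exp_zero no_exponent_zero)

lemma W_current_lower_truncated:
  assumes "i \<in> {1, 2}"
  shows "lower_truncated (W_current R q l1 i)"
proof -
  have "lower_truncated (nord R q l1 [(1, i, 1)])" "lower_truncated (nord R q l1 [(-1, i, 1)])"
    by (rule nord_lower_truncated, use assms in \<open>simp add: valid_factors_def\<close>)+
  then show ?thesis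
    unfolding lower_truncated_def W_current_def Lambda_plus_def Lambda_minus_def
    by (metis (no_types, opaque_lifting) add.right_neutral min_less_iff_conj)
qed

lemma T_current_lower_truncated: "lower_truncated (T_current R q d l1 \<xi>)"
proof -
  have t: "lower_truncated (nord R q l1 [(s, 1, \<xi>), (t, 2, 1)])"
    if "s \<in> {1, -1}" "t \<in> {1, -1}" for s t
    by (rule nord_lower_truncated) (use that in \<open>auto simp: valid_factors_def\<close>)
  have z: "nord R q l1 [(s, 1, \<xi>), (t, 2, 1)] n 0 = 0"
    if "s \<in> {1, -1}" "t \<in> {1, -1}" for s t n
    using t[OF that] by (simp add: lower_truncated_def)
  have e: "\<exists>L. \<forall>n<L. nord R q l1 [(s, 1, \<xi>), (t, 2, 1)] n v = 0"
    if "s \<in> {1, -1}" "t \<in> {1, -1}" for s t v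
    using t[OF that] by (simp add: lower_truncated_def)
  show ?thesis
    unfolding lower_truncated_def
  proof (intro conjI allI)
    show "T_current R q d l1 \<xi> n 0 = 0" for n 
      unfolding T_current_def by (simp only: z insert_iff simp_thms) simp
    fix v
    obtain L1 L2 L3 L4 where
      "\<forall>n<L1. nord R q l1 [(1, 1, \<xi>), (1, 2, 1)] n v = 0"
      "\<forall>n<L2. nord R q l1 [(-1, 1, \<xi>), (-1, 2, 1)] n v = 0"
      "\<forall>n<L3. nord R q l1 [(1, 1, \<xi>), (-1, 2, 1)] n v = 0"
      "\<forall>n<L4. nord R q l1 [(-1, 1, \<xi>), (1, 2, 1)] n v = 0"
      using e by (metis insertCI)
    then show "\<exists>L. \<forall>n<L. T_current R q d l1 \<xi> n v = 0"
      by (intro exI[of _ "min (min L1 L2) (min L3 L4)"]) (simp add: T_current_def)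
  qed
qed

lemma two_variable_finite_terms:
  assumes "lower_truncated A" "lower_truncated B"
  shows "finite {n::nat. smul R (fps_nth F n) (A (a + int n) (B (b - int n) v)) \<noteq> 0}"
proof -
  obtain L where L: "\<forall>n<L. B n v = 0" using assms(2) unfolding lower_truncated_def by blast
  have A: "A n 0 = 0" for n using assms by (auto simp: lower_truncated_def)
  have "n \<le> nat (b - L)" if "smul R (fps_nth F n) (A (a + int n) (B (b - int n) v)) \<noteq> 0" for n
  proof (rule ccontr)
    assume "\<not> n \<le> nat (b - L)"
    then have "B (b - int n) v = 0" using L by auto
    with that show False by (simp add: A)
  qed
  then show ?thesis by (auto intro: finite_subset[of _ "{..nat (b - L)}"])
qed

end

end

theory Submission
  imports Defs
begin

text \<open>
  Fix a vector \<open>v\<close> on which \<open>h\<^sub>1\<^sub>,\<^sub>0\<close> acts by an integer; by linearity these suffice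
  (\<open>weight_ext\<close>). The exponentials of the Heisenberg modes commute up to a scalar power series
  (\<open>op_exp_cross\<close>), and on \<open>v\<close> the zero modes are powers of the variable. Hence a product of two
  normally ordered products \<open>:fs(z): :gs(w):\<close> is a monomial times a scalar series in \<open>w/z\<close>, the
  contraction, times the two-variable product \<open>:fs(z) gs(w):\<close> (\<open>nord_nord_weight\<close>); the opposite
  order gives a series in \<open>z/w\<close> times the same product. The coefficients of
  \<open>:fs(z) gs(w): v\<close> of a fixed total degree form a Laurent polynomial in \<open>w/z\<close>
  (\<open>nord_pair_finite\<close>), so that series in \<open>w/z\<close> and in \<open>z/w\<close> can both multiply it and
  be compared.

  Write \<open>c\<^sub>n = (q\<^sub>1\<^sup>n + q\<^sub>3\<^sup>n) / (1 + q\<^sub>2\<^sup>-\<^sup>n)\<close>. The logarithms of the structure function and of the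
  contractions of unequal indices contain the coefficients \<open>c\<^sub>n\<close>, but in each product
  \<open>f \<Lambda>\<^sub>1 :\<Lambda>\<^sub>1 \<Lambda>\<^sub>2:\<close> these either cancel or occur as
  \<open>c\<^sub>n + q\<^sub>2\<^sup>\<minusplus>\<^sup>n c\<^sub>n\<close>, which is a sum of two \<open>n\<close>-th powers. So with the structure function each
  product becomes a rational function of \<open>x = w/z\<close> times a normally ordered product, and the
  two orders give the expansions of one rational function at \<open>x = 0\<close> and at
  \<open>x = \<infinity>\<close> (\<open>zw_exponent_eqs\<close>, \<open>wz_exponent_eqs\<close>). All poles are simple, and the
  difference of the two expansions of \<open>1 / (1 - c x)\<close> is \<open>\<delta>(c x)\<close>, which evaluates the
  normally ordered product at \<open>z = c w\<close> (\<open>act_delta\<close>, \<open>nord_pair_fusion\<close>).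

  Let \<open>\<xi> = q\<^sub>k\<^sup>\<plusminus>\<^sup>1\<close>. One of the two mixed terms of \<open>\<T>(\<xi>; w)\<close> has the coefficient \<open>0\<close>,
  so there are six products, labelled below by signs relative to the sign of the exponent of
  \<open>q\<^sub>k\<close>. Three of them, \<open>(+; + +)\<close>, \<open>(-; - -)\<close> and \<open>(+; + -)\<close>, have no pole. The product
  \<open>(-; + +)\<close> has a pole at \<open>z = t w\<close> with \<open>t = \<xi> q\<^sub>2\<^sup>\<minusplus>\<^sup>1\<close>, where the two factors of index 1
  cancel and \<open>\<Lambda>\<^sub>2(w)\<close> remains. The product \<open>(+; - -)\<close> has a pole at \<open>z = \<xi> w\<close>, and
  \<open>(-; + -)\<close> has both poles: its residue at \<open>\<xi> w\<close> cancels that of \<open>(+; - -)\<close>, and its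
  residue at \<open>t w\<close> is the other summand of \<open>W\<^sub>2(w)\<close> (\<open>W_T_relation\<close>).

  The two relations of the theorem are instances of this one: \<open>\<T>(\<xi>; w)\<close> keeps its form if the
  indices 1 and 2 are exchanged, \<open>\<xi>\<close> is replaced by \<open>\<xi>\<^sup>-\<^sup>1\<close> and \<open>w\<close> by \<open>\<xi> w\<close>
  (\<open>T_current_exchange\<close>).
\<close>

unbundle fps_syntax

section \<open>Convolutions and exponentials of scalar power series\<close>

lemma convolution_assoc:
  fixes f :: "nat \<Rightarrow> nat \<Rightarrow> nat \<Rightarrow> 'a::comm_monoid_add"
  shows "(\<Sum>j=0..k. \<Sum>i=0..j. f i (j - i) (k - j)) = (\<Sum>j=0..k. \<Sum>i=0..k - j. f j i (k - j - i))"
  by (rule fps_mult_assoc_lemma)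

lemma convolution_commute:
  fixes f :: "nat \<Rightarrow> nat \<Rightarrow> 'a::comm_monoid_add"
  shows "(\<Sum>i=0..k. f i (k - i)) = (\<Sum>i=0..k. f (k - i) i)"
  by (rule sum.reindex_bij_witness[of _ "\<lambda>i. k - i" "\<lambda>i. k - i"]) auto

lemma convolution_left_commute:
  fixes f :: "nat \<Rightarrow> nat \<Rightarrow> nat \<Rightarrow> 'a::comm_monoid_add"
  shows "(\<Sum>j=0..k. \<Sum>i=0..k - j. f j i (k - j - i)) = (\<Sum>j=0..k. \<Sum>i=0..k - j. f i j (k - j - i))"
proof -
  have "(\<Sum>j=0..k. \<Sum>i=0..k - j. f j i (k - j - i)) = (\<Sum>j=0..k. \<Sum>i=0..j. f i (j - i) (k - j))"
    by (rule convolution_assoc[symmetric])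
  also have "\<dots> = (\<Sum>j=0..k. \<Sum>i=0..j. f (j - i) i (k - j))"
    by (intro sum.cong refl convolution_commute)
  also have "\<dots> = (\<Sum>j=0..k. \<Sum>i=0..k - j. f i j (k - j - i))"
    using convolution_assoc[of "\<lambda>a b c. f b a c" k] by simp
  finally show ?thesis .
qed

abbreviation fps_Exp :: "complex fps \<Rightarrow> complex fps" where
  "fps_Exp G \<equiv> fps_exp 1 oo G"

text \<open>
  Comparing coefficients in \<open>(exp G)' = G' exp G\<close>. Exponentials of operators satisfy the same recursion
  (\<open>op_exp_rec\<close>), and all identities between exponentials are derived from it.
\<close>

lemma fps_Exp_rec:
  assumes "G $ 0 = 0"
  shows "of_nat m * fps_Exp G $ m = (\<Sum>k=0..m. of_nat k * G $ k * fps_Exp G $ (m - k))"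
proof (cases m)
  case (Suc n)
  have "fps_deriv (fps_Exp G) = fps_deriv G * fps_Exp G"
    using fps_compose_deriv[OF assms, of "fps_exp 1"] by (simp add: mult.commute)
  then have "fps_deriv (fps_Exp G) $ n = (fps_deriv G * fps_Exp G) $ n" by simp
  then have "of_nat m * fps_Exp G $ m = (\<Sum>k=0..n. of_nat (Suc k) * G $ Suc k * fps_Exp G $ (n - k))"
    by (simp add: Suc fps_mult_nth)
  also have "\<dots> = (\<Sum>k=0..m. of_nat k * G $ k * fps_Exp G $ (m - k))"
    unfolding Suc by (simp add: sum.atLeast0_atMost_Suc_shift del: of_nat_Suc sum.cl_ivl_Suc)
  finally show ?thesis .
qed simp

lemma fps_Exp_unique:
  assumes "G $ 0 = 0" "H $ 0 = 1" and "fps_deriv H = fps_deriv G * H"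
  shows "H = fps_Exp G"
proof -
  have d: "fps_deriv (fps_Exp G) = fps_deriv G * fps_Exp G"
    using fps_compose_deriv[OF assms(1), of "fps_exp 1"] by (simp add: mult.commute)
  have nz: "fps_Exp G $ 0 \<noteq> 0" by simp
  have "H $ n = fps_Exp G $ n" for n
  proof (induction n rule: less_induct)
    case (less n)
    show ?case
    proof (cases n)
      case 0
      then show ?thesis using assms(2) by simp
    next
      case (Suc m)
      have "of_nat (Suc m) * H $ Suc m = (fps_deriv G * H) $ m" using assms(3) by (metis fps_deriv_nth Suc_eq_plus1)
      also have "\<dots> = (fps_deriv G * fps_Exp G) $ m"
        unfolding fps_mult_nth using less Suc by (intro sum.cong) auto
      also have "\<dots> = of_nat (Suc m) * fps_Exp G $ Suc m" using d by (metis fps_deriv_nth Suc_eq_plus1)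
      finally show ?thesis using Suc by (simp del: of_nat_Suc)
    qed
  qed
  then show ?thesis by (simp add: fps_eq_iff)
qed

lemma fps_Exp_add:
  assumes "G $ 0 = 0" "H $ 0 = 0"
  shows "fps_Exp (G + H) = fps_Exp G * fps_Exp H"
  using assms fps_compose_deriv[of G "fps_exp 1"] fps_compose_deriv[of H "fps_exp 1"]
  by (intro fps_Exp_unique[symmetric]) (auto simp: algebra_simps)

context heisenberg_module
begin

abbreviation lin :: "('v \<Rightarrow> 'v) \<Rightarrow> bool" where
  "lin X \<equiv> Vector_Spaces.linear (smul R) (smul R) X"

lemma linI:
  assumes "\<And>u v. X (u + v) = X u + X v" "\<And>c v. X (smul R c v) = smul R c (X v)"
  shows "lin X"
  by unfold_locales (simp_all add: assms)

lemma
  assumes "lin X"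
  shows lin_add: "X (u + v) = X u + X v"
    and lin_scale: "X (smul R c v) = smul R c (X v)"
    and lin_zero: "X 0 = 0"
    and lin_diff: "X (u - v) = X u - X v"
    and lin_sum: "X (sum f S) = (\<Sum>x\<in>S. X (f x))"
proof -
  interpret X: Vector_Spaces.linear "smul R" "smul R" X by fact
  show "X (u + v) = X u + X v" "X (smul R c v) = smul R c (X v)" "X 0 = 0"
    "X (u - v) = X u - X v" "X (sum f S) = (\<Sum>x\<in>S. X (f x))"
    by (simp_all add: X.add X.scale X.zero X.diff X.sum)
qed

lemma lin_Sum_any:
  assumes "lin X" "finite {x. f x \<noteq> 0}"
  shows "X (Sum_any f) = Sum_any (\<lambda>x. X (f x))"
proof -
  have "{x. X (f x) \<noteq> 0} \<subseteq> {x. f x \<noteq> 0}" using lin_zero[OF assms(1)] by auto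
  from Sum_any.expand_superset[OF assms(2) this] show ?thesis
    by (simp add: Sum_any.expand_set[of f] lin_sum[OF assms(1)])
qed

lemma lin_smul: "lin X \<Longrightarrow> lin (\<lambda>v. smul R c (X v))"
  by (rule linI) (simp_all add: lin_add lin_scale scale_right_distrib mult.commute)

lemma lin_plus: "lin X \<Longrightarrow> lin Y \<Longrightarrow> lin (\<lambda>v. X v + Y v)"
  by (rule linI) (simp_all add: lin_add lin_scale scale_right_distrib algebra_simps)

lemma lin_minus: "lin X \<Longrightarrow> lin Y \<Longrightarrow> lin (\<lambda>v. X v - Y v)"
  by (rule linI) (simp_all add: lin_add lin_scale scale_right_diff_distrib)

lemma lin_id: "lin (\<lambda>v. v)"
  by (rule linI) simp_all

lemma lin_0: "lin (\<lambda>v. 0)"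
  by (rule linI) simp_all

lemma lin_compose: "lin X \<Longrightarrow> lin Y \<Longrightarrow> lin (\<lambda>v. X (Y v))"
  by (rule linI) (simp_all add: lin_add lin_scale)

lemma lin_sum_fun: "(\<And>x. x \<in> S \<Longrightarrow> lin (X x)) \<Longrightarrow> lin (\<lambda>v. \<Sum>x\<in>S. X x v)"
proof (induction S rule: infinite_finite_induct)
  case (insert x F)
  then show ?case using lin_plus[of "X x" "\<lambda>v. \<Sum>x\<in>F. X x v"] by simp
qed (simp_all add: lin_0)

lemma lin_Sum_any_fun:
  assumes "\<And>x. lin (X x)" "\<And>v. finite {x. X x v \<noteq> 0}"
  shows "lin (\<lambda>v. Sum_any (\<lambda>x. X x v))"
proof (rule linI)
  fix u v
  show "Sum_any (\<lambda>x. X x (u + v)) = Sum_any (\<lambda>x. X x u) + Sum_any (\<lambda>x. X x v)"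
    by (simp add: lin_add[OF assms(1)] Sum_any.distrib[OF assms(2) assms(2)])
next
  fix c v
  show "Sum_any (\<lambda>x. X x (smul R c v)) = smul R c (Sum_any (\<lambda>x. X x v))"
    using lin_Sum_any[OF lin_smul[OF lin_id] assms(2)] by (simp add: lin_scale[OF assms(1)])
qed

section \<open>Exponentials of commuting families\<close>

lemma lin_op_pow: "(\<And>k. lin (A k)) \<Longrightarrow> lin (op_pow A r m)"
proof (induction r arbitrary: m)
  case 0
  then show ?case by (cases "m = 0") (simp_all add: lin_id lin_0)
next
  case (Suc r)
  then show ?case by (auto intro!: lin_sum_fun lin_compose[of "A _" "op_pow A r _"])
qed

lemma lin_op_exp: "(\<And>k. lin (A k)) \<Longrightarrow> lin (op_exp R A m)"
  unfolding op_exp_def by (intro lin_sum_fun lin_smul lin_op_pow)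

lemma op_pow_commute:
  assumes "lin X" "\<And>k v. 0 < k \<Longrightarrow> X (A k v) = A k (X v)"
  shows "X (op_pow A r m v) = op_pow A r m (X v)"
  by (induction r arbitrary: m) (auto simp: lin_zero[OF assms(1)] lin_sum[OF assms(1)] assms(2))

lemma op_exp_commute:
  assumes "lin X" "\<And>k v. 0 < k \<Longrightarrow> X (A k v) = A k (X v)"
  shows "X (op_exp R A m v) = op_exp R A m (X v)"
  unfolding op_exp_def
  by (simp add: lin_sum[OF assms(1)] lin_scale[OF assms(1)]
      op_pow_commute[where X = X and A = A, OF assms])

lemma op_pow_eq_0: "r > m \<Longrightarrow> (\<And>k. lin (A k)) \<Longrightarrow> op_pow A r m v = 0"
  by (induction r arbitrary: m) (auto intro!: sum.neutral simp: lin_zero)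

lemma op_exp_0: "op_exp R A 0 v = v"
  by (simp add: op_exp_def)

text \<open>
  The derivation \<open>t d/dt\<close> of \<open>A(t)\<^sup>r\<^sup>+\<^sup>1\<close>: since the coefficients commute, the derivative of one factor can
  be moved to the front.
\<close>

lemma op_pow_derivation:
  assumes lin: "\<And>k. lin (A k)"
    and comm: "\<And>k l v. 0 < k \<Longrightarrow> 0 < l \<Longrightarrow> A k (A l v) = A l (A k v)"
  shows "smul R (of_nat m) (op_pow A (Suc r) m v)
    = smul R (of_nat (Suc r)) (\<Sum>k=1..m. smul R (of_nat k) (A k (op_pow A r (m - k) v)))"
proof (induction r arbitrary: m)
  case 0
  have A: "A k (op_pow A 0 (m - k) v) = (if k = m then A m v else 0)" if "k \<in> {1..m}" for k
    using that by (auto simp: lin_zero[OF lin])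
  have "(\<Sum>k=1..m. A k (op_pow A 0 (m - k) v)) = (\<Sum>k=1..m. if k = m then A m v else 0)"
    using A by (auto intro!: sum.cong simp del: op_pow.simps)
  moreover have "(\<Sum>k=1..m. smul R (of_nat k) (A k (op_pow A 0 (m - k) v))) =
     (\<Sum>k=1..m. if k = m then smul R (of_nat m) (A m v) else 0)"
    using A by (intro sum.cong) (auto simp del: op_pow.simps)
  ultimately show ?case by auto
next
  case (Suc r)
  let ?P = "\<lambda>r m. op_pow A r m v"
  (* the convolution lemmas run over indices from 0, where the weights below vanish *)
  define A' where "A' k u = (if k = 0 then 0 else A k u)" for k u
  have A'0 [simp]: "A' k 0 = 0" for k by (simp add: A'_def lin_zero[OF lin])
  have shift: "(\<Sum>k=1..m. g k (A k (f k))) = (\<Sum>k=0..m. g k (A' k (f k)))"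
    if "\<And>k. g k 0 = 0" for g :: "nat \<Rightarrow> 'v \<Rightarrow> 'v" and f m
    by (rule sum.mono_neutral_cong_left) (auto simp: A'_def that)
  have P: "?P (Suc r) m = (\<Sum>k=0..m. A' k (?P r (m - k)))" for r m
    using shift[of "\<lambda>k u. u" "\<lambda>k. ?P r (m - k)" m] by simp
  have D: "(\<Sum>k=1..m. smul R (of_nat k) (A k (?P r (m - k)))) =
     (\<Sum>k=0..m. smul R (of_nat k) (A' k (?P r (m - k))))" for r m
    by (rule shift) simp
  have lin': "lin (A' k)" for k
    by (cases "k = 0") (simp_all add: A'_def[abs_def] lin lin_0)
  have comm': "A' k (A' l u) = A' l (A' k u)" for k l u
    by (auto simp: A'_def comm lin_zero[OF lin])
  have IH: "smul R (of_nat m) (?P (Suc r) m) =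
     smul R (of_nat (Suc r)) (\<Sum>k=0..m. smul R (of_nat k) (A' k (?P r (m - k))))" for m
    using Suc[of m] unfolding D .
  have "smul R (of_nat m) (?P (Suc (Suc r)) m) =
     (\<Sum>k=0..m. smul R (of_nat k) (A' k (?P (Suc r) (m - k)))
        + A' k (smul R (of_nat (m - k)) (?P (Suc r) (m - k))))"
    unfolding P[of "Suc r"]
    by (auto simp: scale_sum_right lin_scale[OF lin'] of_nat_diff simp flip: scale_left_distrib
        simp del: op_pow.simps intro!: sum.cong)
  also have "\<dots> = (\<Sum>k=0..m. smul R (of_nat k) (A' k (?P (Suc r) (m - k)))) +
     smul R (of_nat (Suc r)) (\<Sum>k=0..m. \<Sum>l=0..m-k. smul R (of_nat l) (A' k (A' l (?P r (m - k - l)))))"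
    unfolding IH by (simp add: sum.distrib lin_scale[OF lin'] lin_sum[OF lin'] scale_sum_right)
  also have "(\<Sum>k=0..m. \<Sum>l=0..m-k. smul R (of_nat l) (A' k (A' l (?P r (m - k - l)))))
     = (\<Sum>l=0..m. \<Sum>k=0..m-l. smul R (of_nat l) (A' l (A' k (?P r (m - l - k)))))"
    using convolution_left_commute[of "\<lambda>k l n. smul R (of_nat l) (A' k (A' l (?P r n)))" m]
    by (simp add: comm')
  also have "\<dots> = (\<Sum>l=0..m. smul R (of_nat l) (A' l (?P (Suc r) (m - l))))"
    unfolding P by (simp add: lin_sum[OF lin'] scale_sum_right)
  finally show ?case
    by (simp only: D of_nat_Suc[of "Suc r"] scale_left_distrib scale_one)
qed

lemma op_exp_rec:
  assumes lin: "\<And>k. lin (A k)"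
    and comm: "\<And>k l v. 0 < k \<Longrightarrow> 0 < l \<Longrightarrow> A k (A l v) = A l (A k v)"
  shows "smul R (of_nat m) (op_exp R A m v)
    = (\<Sum>k=0..m. smul R (of_nat k) (A k (op_exp R A (m - k) v)))"
proof -
  let ?P = "\<lambda>r m. op_pow A r m v"
  have ext: "op_exp R A n v = (\<Sum>r<m. smul R (1 / fact r) (?P r n))" if "n < m" for n m
    unfolding op_exp_def using that op_pow_eq_0[OF _ lin]
    by (intro sum.mono_neutral_left) auto
  have "smul R (of_nat m) (op_exp R A m v) = (\<Sum>r\<le>m. smul R (1 / fact r) (smul R (of_nat m) (?P r m)))"
    by (simp add: op_exp_def scale_sum_right mult.commute)
  also have "\<dots> = (\<Sum>r<m. smul R (1 / fact (Suc r)) (smul R (of_nat m) (?P (Suc r) m)))"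
    by (subst sum.atMost_shift) auto
  also have "\<dots> = (\<Sum>r<m. \<Sum>k=1..m. smul R (of_nat k) (A k (smul R (1 / fact r) (?P r (m - k)))))"
  proof (rule sum.cong)
    fix r
    have "smul R (1 / fact (Suc r)) (smul R (of_nat m) (?P (Suc r) m)) = smul R (1 / fact (Suc r))
       (smul R (of_nat (Suc r)) (\<Sum>k=1..m. smul R (of_nat k) (A k (?P r (m - k)))))"
      by (simp only: op_pow_derivation[OF lin comm])
    also have "\<dots> = smul R (1 / fact r) (\<Sum>k=1..m. smul R (of_nat k) (A k (?P r (m - k))))"
      by (simp del: of_nat_Suc)
    finally have "smul R (1 / fact (Suc r)) (smul R (of_nat m) (?P (Suc r) m)) =
       smul R (1 / fact r) (\<Sum>k=1..m. smul R (of_nat k) (A k (?P r (m - k))))" .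
    then show "smul R (1 / fact (Suc r)) (smul R (of_nat m) (?P (Suc r) m)) =
       (\<Sum>k=1..m. smul R (of_nat k) (A k (smul R (1 / fact r) (?P r (m - k)))))"
      by (simp add: scale_sum_right lin_scale[OF lin] mult.commute del: of_nat_Suc op_pow.simps)
  qed simp
  also have "\<dots> = (\<Sum>k=1..m. smul R (of_nat k) (A k (op_exp R A (m - k) v)))"
    by (subst sum.swap, intro sum.cong refl, subst ext[of _ m])
      (simp_all add: scale_sum_right lin_sum[OF lin])
  also have "\<dots> = (\<Sum>k=0..m. smul R (of_nat k) (A k (op_exp R A (m - k) v)))"
    by (rule sum.mono_neutral_left) auto
  finally show ?thesis .
qed

lemma op_exp_add:
  assumes linA: "\<And>k. lin (A k)" and linB: "\<And>k. lin (B k)"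
    and commA: "\<And>k l v. 0 < k \<Longrightarrow> 0 < l \<Longrightarrow> A k (A l v) = A l (A k v)"
    and commB: "\<And>k l v. 0 < k \<Longrightarrow> 0 < l \<Longrightarrow> B k (B l v) = B l (B k v)"
    and commAB: "\<And>k l v. 0 < k \<Longrightarrow> 0 < l \<Longrightarrow> A k (B l v) = B l (A k v)"
  shows "op_exp R (\<lambda>k v. A k v + B k v) m v = (\<Sum>k=0..m. op_exp R A k (op_exp R B (m - k) v))"
proof (induction m rule: less_induct)
  case (less m)
  let ?EA = "op_exp R A" and ?EB = "op_exp R B" and ?E = "op_exp R (\<lambda>k v. A k v + B k v)"
  have linEA: "lin (?EA k)" for k using linA by (rule lin_op_exp)
  show ?case
  proof (cases "m = 0")
    case True
    then show ?thesis by (simp add: op_exp_0)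
  next
    case False
    have BA: "smul R (of_nat l) (B l (?EA k u)) = ?EA k (smul R (of_nat l) (B l u))" for k l u
    proof (cases "l = 0")
      case False
      then have "B l (?EA k u) = ?EA k (B l u)" by (intro op_exp_commute) (auto simp: linB commAB)
      then show ?thesis by (simp add: lin_scale[OF linEA])
    qed (simp add: lin_zero[OF linEA])
    have "smul R (of_nat m) (?E m v) = (\<Sum>k=0..m. smul R (of_nat k) (A k (?E (m - k) v) + B k (?E (m - k) v)))"
      by (rule op_exp_rec) (auto intro!: lin_plus simp: lin_add[OF linA] lin_add[OF linB] linA linB
          commA commB commAB algebra_simps)
    also have "\<dots> = (\<Sum>k=0..m. \<Sum>i=0..m-k. smul R (of_nat k) (A k (?EA i (?EB (m - k - i) v)))
       + smul R (of_nat k) (B k (?EA i (?EB (m - k - i) v))))"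
    proof (rule sum.cong)
      fix k assume "k \<in> {0..m}"
      show "smul R (of_nat k) (A k (?E (m - k) v) + B k (?E (m - k) v)) =
        (\<Sum>i=0..m-k. smul R (of_nat k) (A k (?EA i (?EB (m - k - i) v)))
       + smul R (of_nat k) (B k (?EA i (?EB (m - k - i) v))))"
      proof (cases "k = 0")
        case False
        then show ?thesis using \<open>m \<noteq> 0\<close> less[of "m - k"]
          by (simp add: scale_right_distrib sum.distrib lin_sum[OF linA] lin_sum[OF linB] scale_sum_right)
      qed simp
    qed simp
    also have "\<dots> = (\<Sum>k=0..m. \<Sum>i=0..m-k. smul R (of_nat k) (A k (?EA i (?EB (m - k - i) v)))) +
       (\<Sum>k=0..m. \<Sum>i=0..m-k. ?EA i (smul R (of_nat k) (B k (?EB (m - k - i) v))))"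
      by (simp add: sum.distrib BA)
    also have "(\<Sum>k=0..m. \<Sum>i=0..m-k. smul R (of_nat k) (A k (?EA i (?EB (m - k - i) v)))) =
        (\<Sum>j=0..m. \<Sum>k=0..j. smul R (of_nat k) (A k (?EA (j - k) (?EB (m - j) v))))"
      by (rule convolution_assoc[symmetric])
    also have "\<dots> = (\<Sum>j=0..m. smul R (of_nat j) (?EA j (?EB (m - j) v)))"
      by (intro sum.cong refl op_exp_rec[symmetric] linA commA)
    also have "(\<Sum>k=0..m. \<Sum>i=0..m-k. ?EA i (smul R (of_nat k) (B k (?EB (m - k - i) v)))) =
      (\<Sum>i=0..m. \<Sum>k=0..m-i. ?EA i (smul R (of_nat k) (B k (?EB (m - i - k) v))))"
      by (rule convolution_left_commute)
    also have "\<dots> = (\<Sum>i=0..m. ?EA i (smul R (of_nat (m - i)) (?EB (m - i) v)))"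
      by (simp only: op_exp_rec[OF linB commB] lin_sum[OF linEA])
    also have "(\<Sum>j=0..m. smul R (of_nat j) (?EA j (?EB (m - j) v))) + \<dots> =
      smul R (of_nat m) (\<Sum>j=0..m. ?EA j (?EB (m - j) v))"
      by (auto simp: scale_sum_right lin_scale[OF linEA] of_nat_diff simp flip: sum.distrib scale_left_distrib
          intro!: sum.cong)
    finally show ?thesis using False by simp
  qed
qed

text \<open>
  An operator whose commutator with the exponent is the scalar monomial \<open>c t\<^sup>n\<close> acts on the exponential
  by a derivation.
\<close>

lemma op_exp_commutator:
  assumes lin: "\<And>k. lin (A k)" and linX: "lin X"
    and comm: "\<And>k l v. 0 < k \<Longrightarrow> 0 < l \<Longrightarrow> A k (A l v) = A l (A k v)"
    and XA: "\<And>k v. 0 < k \<Longrightarrow> X (A k v) = A k (X v) + smul R (if k = n then c else 0) v"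
    and n: "n > 0"
  shows "X (op_exp R A m v) = op_exp R A m (X v) + (if n \<le> m then smul R c (op_exp R A (m - n) v) else 0)"
proof (induction m rule: less_induct)
  case (less m)
  let ?E = "op_exp R A"
  define E' where "E' k = (if n \<le> k then smul R c (?E (k - n) v) else 0)" for k
  show ?case
  proof (cases "m = 0")
    case True
    with n show ?thesis by (simp add: op_exp_0)
  next
    case False
    have "smul R (of_nat m) (X (?E m v)) = (\<Sum>k=0..m. smul R (of_nat k) (X (A k (?E (m - k) v))))"
      by (simp add: op_exp_rec[OF lin comm] lin_sum[OF linX] lin_scale[OF linX] flip: lin_scale[OF linX])
    also have "\<dots> = (\<Sum>k=0..m. smul R (of_nat k) (A k (?E (m - k) (X v))) + smul R (of_nat k) (A k (E' (m - k)))
        + (if k = n then smul R (of_nat n) (smul R c (?E (m - n) v)) else 0))"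
    proof (rule sum.cong)
      fix k assume "k \<in> {0..m}"
      show "smul R (of_nat k) (X (A k (?E (m - k) v))) =
        smul R (of_nat k) (A k (?E (m - k) (X v))) + smul R (of_nat k) (A k (E' (m - k)))
        + (if k = n then smul R (of_nat n) (smul R c (?E (m - n) v)) else 0)"
      proof (cases "k = 0")
        case True
        with n show ?thesis by simp
      next
        case k: False
        then have "X (?E (m - k) v) = ?E (m - k) (X v) + E' (m - k)"
          using less[of "m - k"] False by (simp add: E'_def)
        with k show ?thesis
          by (simp add: XA lin_add[OF lin] scale_right_distrib algebra_simps)
      qed
    qed simp
    also have "\<dots> = smul R (of_nat m) (?E m (X v)) + (\<Sum>k=0..m. smul R (of_nat k) (A k (E' (m - k))))
       + smul R (of_nat n) (E' m)"
      by (simp add: sum.distrib op_exp_rec[OF lin comm] E'_def)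
    also have "(\<Sum>k=0..m. smul R (of_nat k) (A k (E' (m - k)))) = smul R (of_nat (m - n)) (E' m)"
    proof (cases "n \<le> m")
      case True
      have "(\<Sum>k=0..m. smul R (of_nat k) (A k (E' (m - k)))) =
        (\<Sum>k=0..m-n. smul R (of_nat k) (A k (smul R c (?E (m - n - k) v))))"
        using True by (intro sum.mono_neutral_cong_right)
          (auto simp: E'_def lin_zero[OF lin] add.commute intro!: sum.cong)
      also have "\<dots> = smul R c (smul R (of_nat (m - n)) (?E (m - n) v))"
        by (simp add: op_exp_rec[OF lin comm] scale_sum_right lin_scale[OF lin] mult.commute)
      finally show ?thesis using True by (simp add: E'_def mult.commute)
    qed (auto simp: E'_def lin_zero[OF lin] intro!: sum.neutral)
    finally have "smul R (of_nat m) (X (?E m v)) = smul R (of_nat m) (?E m (X v) + E' m)"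
      by (cases "n \<le> m") (auto simp: E'_def of_nat_diff algebra_simps)
    then show ?thesis using False by (simp add: E'_def)
  qed
qed

text \<open>
  The identity \<open>exp A(x) exp B(y) = exp [A(x), B(y)] exp B(y) exp A(x)\<close> for a scalar commutator, which is
  a power series \<open>G\<close> in \<open>x y\<close>. It is proved by induction on the degree in \<open>x\<close>, where the recursions of the
  two exponentials in \<open>x\<close> combine by the Leibniz rule.
\<close>

lemma op_exp_cross:
  assumes linA: "\<And>k. lin (A k)" and linB: "\<And>k. lin (B k)"
    and commA: "\<And>k l v. 0 < k \<Longrightarrow> 0 < l \<Longrightarrow> A k (A l v) = A l (A k v)"
    and commB: "\<And>k l v. 0 < k \<Longrightarrow> 0 < l \<Longrightarrow> B k (B l v) = B l (B k v)"
    and AB: "\<And>k l v. 0 < k \<Longrightarrow> 0 < l \<Longrightarrow> A k (B l v) = B l (A k v) + smul R (if l = k then G $ k else 0) v"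
    and G0: "G $ 0 = 0"
  shows "op_exp R A m (op_exp R B n v) =
    (\<Sum>j=0..m. if j \<le> n then smul R (fps_Exp G $ j) (op_exp R B (n - j) (op_exp R A (m - j) v)) else 0)"
proof -
  let ?EA = "op_exp R A"
  let ?K = "fps_Exp G"
  define EB where "EB j u = (if j \<le> n then op_exp R B (n - j) u else 0)" for j u
  have linEB: "lin (EB j)" for j
    by (cases "j \<le> n") (simp_all add: EB_def[abs_def] lin_op_exp[OF linB] lin_0)
  have A_EB: "smul R (of_nat k) (A k (EB j u)) =
     smul R (of_nat k) (EB j (A k u) + smul R (G $ k) (EB (j + k) u))" for k j u
  proof (cases "k = 0 \<or> \<not> j \<le> n")
    case False
    then have "A k (EB j u) = EB j (A k u) + (if k \<le> n - j then smul R (G $ k) (op_exp R B (n - j - k) u) else 0)"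
      unfolding EB_def using op_exp_commutator[OF linB linA commB AB, of k "n - j" u] by auto
    then show ?thesis using False by (auto simp: EB_def)
  qed (auto simp: EB_def lin_zero[OF linA])
  have "?EA m (EB 0 v) = (\<Sum>j=0..m. smul R (?K $ j) (EB j (?EA (m - j) v)))"
  proof (induction m rule: less_induct)
    case (less m)
    show ?case
    proof (cases "m = 0")
      case True
      then show ?thesis by (simp add: op_exp_0)
    next
      case False
      have "smul R (of_nat m) (?EA m (EB 0 v)) = (\<Sum>k=0..m. smul R (of_nat k) (A k (?EA (m - k) (EB 0 v))))"
        by (rule op_exp_rec[OF linA commA])
      also have "\<dots> = (\<Sum>k=0..m. \<Sum>j=0..m-k. smul R (?K $ j) (EB j (smul R (of_nat k) (A k (?EA (m - k - j) v))))
         + smul R (of_nat k * G $ k * ?K $ j) (EB (j + k) (?EA (m - k - j) v)))"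
      proof (rule sum.cong)
        fix k assume "k \<in> {0..m}"
        have *: "smul R (of_nat k) (A k (?EA (m - k) (EB 0 v))) =
          (\<Sum>j=0..m-k. smul R (?K $ j) (smul R (of_nat k) (A k (EB j (?EA (m - k - j) v)))))"
        proof (cases "k = 0")
          case False
          with \<open>m \<noteq> 0\<close> show ?thesis
            by (subst less) (simp_all add: lin_sum[OF linA] lin_scale[OF linA] scale_sum_right mult.commute)
        qed simp
        show "smul R (of_nat k) (A k (?EA (m - k) (EB 0 v))) =
          (\<Sum>j=0..m-k. smul R (?K $ j) (EB j (smul R (of_nat k) (A k (?EA (m - k - j) v))))
         + smul R (of_nat k * G $ k * ?K $ j) (EB (j + k) (?EA (m - k - j) v)))"
          unfolding * A_EB by (simp add: scale_right_distrib lin_scale[OF linEB] mult_ac)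
      qed simp
      also have "\<dots> = (\<Sum>k=0..m. \<Sum>j=0..m-k. smul R (?K $ j) (EB j (smul R (of_nat k) (A k (?EA (m - k - j) v)))))
         + (\<Sum>k=0..m. \<Sum>j=0..m-k. smul R (of_nat k * G $ k * ?K $ j) (EB (k + j) (?EA (m - k - j) v)))"
        by (simp add: sum.distrib add.commute)
      also have "(\<Sum>k=0..m. \<Sum>j=0..m-k. smul R (?K $ j) (EB j (smul R (of_nat k) (A k (?EA (m - k - j) v))))) =
        (\<Sum>j=0..m. \<Sum>k=0..m-j. smul R (?K $ j) (EB j (smul R (of_nat k) (A k (?EA (m - j - k) v)))))"
        by (rule convolution_left_commute)
      also have "\<dots> = (\<Sum>j=0..m. smul R (?K $ j) (EB j (smul R (of_nat (m - j)) (?EA (m - j) v))))"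
        by (simp only: op_exp_rec[OF linA commA] lin_sum[OF linEB] scale_sum_right)
      also have "(\<Sum>k=0..m. \<Sum>j=0..m-k. smul R (of_nat k * G $ k * ?K $ j) (EB (k + j) (?EA (m - k - j) v))) =
        (\<Sum>l=0..m. \<Sum>k=0..l. smul R (of_nat k * G $ k * ?K $ (l - k)) (EB (k + (l - k)) (?EA (m - l) v)))"
        by (rule convolution_assoc[symmetric])
      also have "\<dots> = (\<Sum>l=0..m. smul R (of_nat l * ?K $ l) (EB l (?EA (m - l) v)))"
        by (simp add: fps_Exp_rec[OF G0] scale_sum_left)
      also have "(\<Sum>j=0..m. smul R (?K $ j) (EB j (smul R (of_nat (m - j)) (?EA (m - j) v)))) + \<dots>
        = smul R (of_nat m) (\<Sum>j=0..m. smul R (?K $ j) (EB j (?EA (m - j) v)))"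
        by (auto simp: scale_sum_right lin_scale[OF linEB] lin_diff[OF linEB] of_nat_diff algebra_simps
            simp flip: sum.distrib intro!: sum.cong)
      finally show ?thesis using False by simp
    qed
  qed
  then show ?thesis by (simp add: EB_def if_distrib[of "smul R _"] cong: if_cong)
qed

end

section \<open>Creation and annihilation series\<close>

lemma Sum_any_nested:
  fixes g :: "'a \<Rightarrow> 'b \<Rightarrow> 'c::comm_monoid_add"
  assumes "finite {(a, b). g a b \<noteq> 0}"
  shows "Sum_any (\<lambda>a. Sum_any (g a)) = Sum_any (\<lambda>(a, b). g a b)"
proof (rule Sum_any.cartesian_product)
  let ?S = "{(a, b). g a b \<noteq> 0}"
  show "finite (fst ` ?S \<times> snd ` ?S)" using assms by simp
  show "{a. \<exists>b. g a b \<noteq> 0} \<times> {b. \<exists>a. g a b \<noteq> 0} \<subseteq> fst ` ?S \<times> snd ` ?S" by force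
qed

lemma Sum_any_nested3:
  fixes g :: "'a \<Rightarrow> 'b \<Rightarrow> 'c \<Rightarrow> 'd::comm_monoid_add"
  assumes "finite {(a, b, c). g a b c \<noteq> 0}"
  shows "Sum_any (\<lambda>a. Sum_any (\<lambda>b. Sum_any (g a b))) = Sum_any (\<lambda>(a, b, c). g a b c)"
proof -
  have "Sum_any (\<lambda>b. Sum_any (g a b)) = Sum_any (\<lambda>(b, c). g a b c)" for a
  proof (rule Sum_any_nested)
    have "{(b, c). g a b c \<noteq> 0} \<subseteq> snd ` {(a, b, c). g a b c \<noteq> 0}" by force
    then show "finite {(b, c). g a b c \<noteq> 0}" using assms finite_subset by blast
  qed
  moreover have "Sum_any (\<lambda>a. Sum_any (\<lambda>(b, c). g a b c)) = Sum_any (\<lambda>(a, b, c). g a b c)"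
    using Sum_any_nested[of "\<lambda>a (b, c). g a b c"] assms by (simp add: case_prod_beta')
  ultimately show ?thesis by simp
qed

text \<open>
  Since \<open>h\<^sub>2\<^sub>,\<^sub>0 = - h\<^sub>1\<^sub>,\<^sub>0\<close> and \<open>Q\<^sub>2 = - Q\<^sub>1\<close>, the zero modes of both indices are expressed by those of
  index 1 and this sign. The charge of a list of factors is the amount by which the normally ordered
  product raises the eigenvalue of \<open>h\<^sub>1\<^sub>,\<^sub>0\<close>; on the eigenvalue \<open>\<mu>\<close> its zero modes give
  \<open>zmode_coeff q fs \<mu>\<close> times the power \<open>charge fs * \<mu>\<close> of the variable.
\<close>

definition index_sign :: "nat \<Rightarrow> int" where
  "index_sign i = (if i = 1 then 1 else - 1)"

definition charge :: "factor list \<Rightarrow> int" where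
  "charge fs = (\<Sum>(s, i, \<xi>)\<leftarrow>fs. s * index_sign i)"

definition zmode_coeff :: "complex \<Rightarrow> factor list \<Rightarrow> int \<Rightarrow> complex" where
  "zmode_coeff q fs \<mu> = (\<Prod>(s, i, \<xi>)\<leftarrow>fs. (q powi (- s) * \<xi>) powi (s * index_sign i * \<mu>))"

definition rescale_factors :: "complex \<Rightarrow> factor list \<Rightarrow> factor list" where
  "rescale_factors c = map (\<lambda>(s, i, \<xi>). (s, i, c * \<xi>))"

lemma charge_append: "charge (fs @ gs) = charge fs + charge gs"
  by (simp add: charge_def)

lemma valid_rescale: "valid_factors (rescale_factors c fs) = valid_factors fs"
  by (auto simp: valid_factors_def rescale_factors_def)

lemma valid_append: "valid_factors (fs @ gs) \<longleftrightarrow> valid_factors fs \<and> valid_factors gs"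
  by (simp add: valid_factors_def ball_Un)

lemma valid_Cons: "valid_factors ((s, i, \<xi>) # fs) \<longleftrightarrow> s \<in> {1, - 1} \<and> i \<in> {1, 2} \<and> valid_factors fs"
  by (auto simp: valid_factors_def)

lemma charge_rescale: "charge (rescale_factors c fs) = charge fs"
  by (induction fs) (auto simp: charge_def rescale_factors_def)

context heisenberg_module
begin

text \<open>
  The series \<open>creation fs\<close> and \<open>annihilation fs\<close> are indexed by the power of the variable and not by the
  mode, so that the former lives in degrees at least \<open>0\<close> and the latter in degrees at most \<open>0\<close>.
\<close>

abbreviation "exponent \<equiv> no_exponent R q"
abbreviation "creation \<equiv> no_creation R q"
abbreviation "annihilation \<equiv> no_annihilation R q"
abbreviation "expQ_part \<equiv> no_expQ R"
abbreviation "a0_part \<equiv> no_azero R l1"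

lemma q_nonzero: "q \<noteq> 0"
  using generic by (simp add: generic_def)

abbreviation findex :: "factor \<Rightarrow> nat" where
  "findex f \<equiv> fst (snd f)"

definition fcoeff :: "factor \<Rightarrow> int \<Rightarrow> complex" where
  "fcoeff f n = - of_int (fst f) * (q powi (fst f * n) / of_int n) * snd (snd f) powi (- n)"

lemma exponent_Nil: "exponent [] n v = 0"
  by (simp add: no_exponent_def)

lemma exponent_Cons: "exponent (f # fs) n v = smul R (fcoeff f n) (hmode R (findex f) n v) + exponent fs n v"
  by (simp add: no_exponent_def fcoeff_def case_prod_beta)

lemma valid_Cons': "valid_factors (f # fs) \<longleftrightarrow> fst f \<in> {1, - 1} \<and> findex f \<in> {1, 2} \<and> valid_factors fs"
  by (cases f) (simp only: valid_Cons fst_conv snd_conv)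

lemma lin_exponent: "valid_factors fs \<Longrightarrow> lin (exponent fs n)"
proof (induction fs)
  case (Cons f fs)
  then have "lin (hmode R (findex f) n)" "lin (exponent fs n)"
    using linear_h valid_Cons' by blast+
  then show ?case
    unfolding exponent_Cons by (intro lin_plus lin_smul)
qed (simp add: exponent_Nil[abs_def] lin_0)

lemma exponent_append: "exponent (fs @ gs) n v = exponent fs n v + exponent gs n v"
  by (simp add: no_exponent_def)

definition hcomm :: "nat \<Rightarrow> nat \<Rightarrow> int \<Rightarrow> complex" where
  "hcomm i j n = (if i = j then of_int n
     else - of_int n * ((q1 q d powi n + q3 q d powi n) / (1 + q2 q powi (- n))))"

lemma h_h:
  assumes "i \<in> {1, 2}" "j \<in> {1, 2}"
  shows "hmode R i n (hmode R j m v) = hmode R j m (hmode R i n v) + smul R (if m = - n then hcomm i j n else 0) v"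
proof (cases "i = j")
  case True
  have "hmode R i n (hmode R i m v) - hmode R i m (hmode R i n v) = smul R (if n + m = 0 then of_int n else 0) v"
    using assms by (intro h_h_same) auto
  moreover have "n + m = 0 \<longleftrightarrow> m = - n" by arith
  ultimately show ?thesis using True by (simp add: hcomm_def algebra_simps)
next
  case False
  have "hmode R i n (hmode R j m v) - hmode R j m (hmode R i n v) = smul R (if n + m = 0 then hcomm i j n else 0) v"
    using h_h_diff[OF assms False, of n m v] False by (simp add: hcomm_def)
  moreover have "n + m = 0 \<longleftrightarrow> m = - n" by arith
  ultimately show ?thesis by (simp add: algebra_simps)
qed

text \<open>
  The commutator of the annihilating exponent of \<open>fs\<close> in \<open>z\<close> with the creating exponent of \<open>gs\<close> in \<open>w\<close>
  is a power series in \<open>w/z\<close>; this is its coefficient of \<open>(w/z)\<^sup>n\<close>.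
\<close>

definition contraction :: "factor list \<Rightarrow> factor list \<Rightarrow> int \<Rightarrow> complex" where
  "contraction fs gs n =
     (\<Sum>f\<leftarrow>fs. \<Sum>g\<leftarrow>gs. fcoeff f n * (fcoeff g (- n) * hcomm (findex f) (findex g) n))"

lemma h_exponent:
  assumes i: "i \<in> {1, 2}"
  shows "valid_factors gs \<Longrightarrow> hmode R i n (exponent gs m v) = exponent gs m (hmode R i n v) +
    smul R (if m = - n then (\<Sum>g\<leftarrow>gs. fcoeff g (- n) * hcomm i (findex g) n) else 0) v"
proof (induction gs)
  case (Cons g gs)
  from Cons.prems have j: "findex g \<in> {1, 2}" and gs: "valid_factors gs" by (simp_all only: valid_Cons')
  have lin: "lin (hmode R i n)" using linear_h i by blast
  have e: "smul R (fcoeff g m) (smul R (if m = - n then hcomm i (findex g) n else 0) v) =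
      smul R (if m = - n then fcoeff g (- n) * hcomm i (findex g) n else 0) v"
    by simp
  show ?case
    unfolding exponent_Cons lin_add[OF lin] lin_scale[OF lin] Cons.IH[OF gs] h_h[OF i j] scale_right_distrib e
    by (simp add: scale_left_distrib add_ac)
qed (simp add: exponent_Nil lin_zero[OF linear_h[OF i]])

lemma exponent_exponent:
  assumes gs: "valid_factors gs"
  shows "valid_factors fs \<Longrightarrow> exponent fs n (exponent gs m v) =
    exponent gs m (exponent fs n v) + smul R (if m = - n then contraction fs gs n else 0) v"
proof (induction fs)
  case Nil
  then show ?case by (simp add: exponent_Nil lin_zero[OF lin_exponent[OF gs]] contraction_def)
next
  case (Cons f fs)
  then have i: "findex f \<in> {1, 2}" and fs: "valid_factors fs" by (simp_all only: valid_Cons')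
  show ?case
    unfolding exponent_Cons Cons.IH[OF fs] h_exponent[OF i gs] lin_add[OF lin_exponent[OF gs]] lin_scale[OF lin_exponent[OF gs]]
    by (simp add: scale_right_distrib scale_left_distrib add_ac contraction_def sum_list_const_mult)
qed

lemma exponent_comm: "valid_factors fs \<Longrightarrow> valid_factors gs \<Longrightarrow> m \<noteq> - n \<Longrightarrow> exponent fs n (exponent gs m v) = exponent gs m (exponent fs n v)"
  by (subst exponent_exponent) simp_all

lemma lin_creation: "valid_factors fs \<Longrightarrow> lin (creation fs k)"
  by (auto simp: no_creation_def lin_0 intro!: lin_op_exp lin_exponent)

lemma lin_annihilation: "valid_factors fs \<Longrightarrow> lin (annihilation fs k)"
  by (auto simp: no_annihilation_def lin_0 intro!: lin_op_exp lin_exponent)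

lemma creation_commute:
  assumes "lin X" "\<And>n v. n < 0 \<Longrightarrow> X (exponent fs n v) = exponent fs n (X v)"
  shows "X (creation fs k v) = creation fs k (X v)"
  unfolding no_creation_def using assms
  by (auto simp: lin_zero intro!: op_exp_commute[where X = X])

lemma annihilation_commute:
  assumes "lin X" "\<And>n v. n > 0 \<Longrightarrow> X (exponent fs n v) = exponent fs n (X v)"
  shows "X (annihilation fs k v) = annihilation fs k (X v)"
  unfolding no_annihilation_def using assms
  by (auto simp: lin_zero intro!: op_exp_commute[where X = X])

lemma creation_creation:
  assumes "valid_factors fs" "valid_factors gs"
  shows "creation fs k (creation gs l v) = creation gs l (creation fs k v)"
proof (rule creation_commute[where X = "creation fs k"])
  fix n v assume "n < (0::int)"
  have "exponent gs n (creation fs k v) = creation fs k (exponent gs n v)"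
    by (rule creation_commute[where X = "exponent gs n"]) (use assms \<open>n < 0\<close> in \<open>auto simp: lin_exponent intro!: exponent_comm\<close>)
  then show "creation fs k (exponent gs n v) = exponent gs n (creation fs k v)" ..
qed (rule lin_creation assms)+

lemma annihilation_annihilation:
  assumes "valid_factors fs" "valid_factors gs"
  shows "annihilation fs k (annihilation gs l v) = annihilation gs l (annihilation fs k v)"
proof (rule annihilation_commute[where X = "annihilation fs k"])
  fix n v assume "n > (0::int)"
  have "exponent gs n (annihilation fs k v) = annihilation fs k (exponent gs n v)"
    by (rule annihilation_commute[where X = "exponent gs n"]) (use assms \<open>n > 0\<close> in \<open>auto simp: lin_exponent intro!: exponent_comm\<close>)
  then show "annihilation fs k (exponent gs n v) = exponent gs n (annihilation fs k v)" ..
qed (rule lin_annihilation assms)+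

lemma creation_append:
  assumes "valid_factors fs" "valid_factors gs"
  shows "creation (fs @ gs) m v = Sum_any (\<lambda>k. creation fs k (creation gs (m - k) v))"
proof (cases "m \<ge> 0")
  case True
  have "Sum_any (\<lambda>k. creation fs k (creation gs (m - k) v)) = (\<Sum>k\<in>{0..m}. creation fs k (creation gs (m - k) v))"
    by (rule Sum_any.expand_superset) (auto simp: no_creation_def op_exp_zero no_exponent_zero assms)
  also have "\<dots> = (\<Sum>k=0..nat m. creation fs (int k) (creation gs (m - int k) v))"
    by (rule sum.reindex_bij_witness[of _ int nat]) (use True in auto)
  also have "\<dots> = (\<Sum>k=0..nat m. op_exp R (\<lambda>n. exponent fs (- int n)) k (op_exp R (\<lambda>n. exponent gs (- int n)) (nat m - k) v))"
    by (intro sum.cong) (use True in \<open>auto simp: no_creation_def nat_diff_distrib\<close>)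
  also have "\<dots> = creation (fs @ gs) m v"
    using True assms unfolding no_creation_def
    by (auto simp: lin_exponent exponent_append[abs_def] intro!: op_exp_add[symmetric] exponent_comm)
  finally show ?thesis ..
next
  case False
  then have "creation fs k (creation gs (m - k) v) = 0" for k
    by (auto simp: no_creation_def op_exp_zero no_exponent_zero assms)
  with False show ?thesis by (simp add: no_creation_def)
qed

lemma annihilation_append:
  assumes "valid_factors fs" "valid_factors gs"
  shows "annihilation (fs @ gs) m v = Sum_any (\<lambda>k. annihilation fs k (annihilation gs (m - k) v))"
proof (cases "m \<le> 0")
  case True
  have "Sum_any (\<lambda>k. annihilation fs k (annihilation gs (m - k) v)) = (\<Sum>k\<in>{m..0}. annihilation fs k (annihilation gs (m - k) v))"
    by (rule Sum_any.expand_superset) (auto simp: no_annihilation_def op_exp_zero no_exponent_zero assms)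
  also have "\<dots> = (\<Sum>k=0..nat (- m). annihilation fs (- int k) (annihilation gs (m + int k) v))"
    by (rule sum.reindex_bij_witness[of _ "\<lambda>k. - int k" "\<lambda>k. nat (- k)"]) (use True in auto)
  also have "\<dots> = (\<Sum>k=0..nat (- m). op_exp R (\<lambda>n. exponent fs (int n)) k (op_exp R (\<lambda>n. exponent gs (int n)) (nat (- m) - k) v))"
  proof (intro sum.cong refl)
    fix k assume k: "k \<in> {0..nat (- m)}"
    then have "nat (- (m + int k)) = nat (- m) - k" "m + int k \<le> 0" using True by auto
    then show "annihilation fs (- int k) (annihilation gs (m + int k) v) =
       op_exp R (\<lambda>n. exponent fs (int n)) k (op_exp R (\<lambda>n. exponent gs (int n)) (nat (- m) - k) v)"
      by (simp add: no_annihilation_def)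
  qed
  also have "\<dots> = annihilation (fs @ gs) m v"
    using True assms unfolding no_annihilation_def
    by (auto simp: lin_exponent exponent_append[abs_def] intro!: op_exp_add[symmetric] exponent_comm)
  finally show ?thesis ..
next
  case False
  then have "annihilation fs k (annihilation gs (m - k) v) = 0" for k
    by (auto simp: no_annihilation_def op_exp_zero no_exponent_zero assms)
  with False show ?thesis by (simp add: no_annihilation_def)
qed

definition contraction_fps :: "factor list \<Rightarrow> factor list \<Rightarrow> complex fps" where
  "contraction_fps fs gs = Abs_fps (\<lambda>k. contraction fs gs (int k))"

lemma contraction_fps_0: "contraction_fps fs gs $ 0 = 0"
proof -
  have "contraction fs gs 0 = 0" by (simp add: contraction_def fcoeff_def)
  then show ?thesis by (simp add: contraction_fps_def)
qed

text \<open>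
  \<open>op_exp_cross\<close> in terms of the integer degrees; the terms whose degrees have the wrong sign vanish.
\<close>

lemma annihilation_creation:
  assumes "valid_factors fs" "valid_factors gs"
  shows "annihilation fs m (creation gs n v) =
    Sum_any (\<lambda>j. smul R (fps_Exp (contraction_fps fs gs) $ j) (creation gs (n - int j) (annihilation fs (m + int j) v)))"
    (is "_ = Sum_any ?f")
proof -
  have *: "Sum_any ?f = (\<Sum>j=0..nat (- m). ?f j)"
  proof (rule Sum_any.expand_superset)
    have "annihilation fs (m + int j) v = 0" if "j > nat (- m)" for j
    proof -
      from that have "\<not> m + int j \<le> 0" by linarith
      then show ?thesis by (simp add: no_annihilation_def)
    qed
    then show "{j. ?f j \<noteq> 0} \<subseteq> {0..nat (- m)}"
      using lin_zero[OF lin_creation[OF assms(2)]] by (auto simp: linorder_not_less[symmetric])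
  qed simp
  show ?thesis
  proof (cases "m \<le> 0 \<and> n \<ge> 0")
    case True
    have "annihilation fs m (creation gs n v) = op_exp R (\<lambda>n. exponent fs (int n)) (nat (- m)) (op_exp R (\<lambda>n. exponent gs (- int n)) (nat n) v)"
      using True by (simp add: no_annihilation_def no_creation_def)
    also have "\<dots> = (\<Sum>j=0..nat (- m). if j \<le> nat n then smul R (fps_Exp (contraction_fps fs gs) $ j)
       (op_exp R (\<lambda>n. exponent gs (- int n)) (nat n - j) (op_exp R (\<lambda>n. exponent fs (int n)) (nat (- m) - j) v)) else 0)"
    proof (rule op_exp_cross[OF _ _ _ _ _ contraction_fps_0])
      fix k l :: nat and u
      show "exponent fs (int k) (exponent gs (- int l) u) = exponent gs (- int l) (exponent fs (int k) u) +
          smul R (if l = k then contraction_fps fs gs $ k else 0) u"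
        by (subst exponent_exponent) (auto simp: assms contraction_fps_def)
    qed (use assms in \<open>auto simp: lin_exponent intro!: exponent_comm\<close>)
    also have "\<dots> = (\<Sum>j=0..nat (- m). ?f j)"
    proof (intro sum.cong refl)
      fix j assume "j \<in> {0..nat (- m)}"
      then have "nat (- (m + int j)) = nat (- m) - j" "m + int j \<le> 0" "nat (n - int j) = nat n - j"
        "j \<le> nat n \<longleftrightarrow> n - int j \<ge> 0"
        using True by auto
      then show "(if j \<le> nat n then smul R (fps_Exp (contraction_fps fs gs) $ j)
       (op_exp R (\<lambda>n. exponent gs (- int n)) (nat n - j) (op_exp R (\<lambda>n. exponent fs (int n)) (nat (- m) - j) v)) else 0) = ?f j"
        by (simp add: no_annihilation_def no_creation_def)
    qed
    finally show ?thesis using * by simp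
  next
    case False
    then have "annihilation fs m (creation gs n v) = 0"
      by (auto simp: no_annihilation_def no_creation_def op_exp_zero no_exponent_zero assms)
    moreover have f: "?f j = 0" for j
      using False by (auto simp: no_annihilation_def no_creation_def op_exp_zero no_exponent_zero assms)
    have "Sum_any ?f = 0" by (simp only: f Sum_any.neutral)
    ultimately show ?thesis by simp
  qed
qed

lemma lin_inv:
  assumes "lin X" "bij X"
  shows "lin (inv X)"
proof (rule linI)
  note inv = bij_inv_eq_iff[OF assms(2)] surj_f_inv_f[OF bij_is_surj[OF assms(2)]]
  show "inv X (u + v) = inv X u + inv X v" for u v
    by (metis inv lin_add[OF assms(1)])
  show "inv X (smul R c v) = smul R c (inv X v)" for c v
    by (metis inv lin_scale[OF assms(1)])
qed

abbreviation expQs :: "int \<Rightarrow> nat \<Rightarrow> 'v \<Rightarrow> 'v" where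
  "expQs s i \<equiv> (if s = 1 then expQi R i else inv (expQi R i))"

lemma lin_expQs: "i \<in> {1, 2} \<Longrightarrow> lin (expQs s i)"
  using linear_expQi lin_inv bij_expQi by simp

lemma inv_expQi: "i \<in> {1, 2} \<Longrightarrow> expQi R i (inv (expQi R i) v) = v"
  "i \<in> {1, 2} \<Longrightarrow> inv (expQi R i) (expQi R i v) = v"
  using bij_expQi by (auto simp: bij_is_surj surj_f_inv_f bij_is_inj)

lemma commute_expQs:
  assumes "i \<in> {1, 2}" "\<And>v. X (expQi R i v) = expQi R i (X v)"
  shows "X (expQs s i v) = expQs s i (X v)"
  using assms inv_expQi[OF assms(1)] by (simp, metis)

lemma expQ_part_Cons: "expQ_part ((s, i, \<xi>) # fs) v = expQs s i (expQ_part fs v)"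
  by (simp add: no_expQ_def)

lemma expQ_part_append: "expQ_part (fs @ gs) v = expQ_part fs (expQ_part gs v)"
  by (simp add: no_expQ_def)

lemma lin_expQ_part: "valid_factors fs \<Longrightarrow> lin (expQ_part fs)"
proof (induction fs)
  case (Cons f fs)
  obtain s i \<xi> where f: "f = (s, i, \<xi>)" by (cases f)
  then show ?case
    using Cons lin_compose[OF lin_expQs, of i "expQ_part fs" s] by (simp add: valid_Cons expQ_part_Cons[abs_def])
qed (simp add: no_expQ_def id_def lin_id)

lemma commute_expQ_part:
  assumes "\<And>i v. i \<in> {1, 2} \<Longrightarrow> X (expQi R i v) = expQi R i (X v)"
  shows "valid_factors fs \<Longrightarrow> X (expQ_part fs v) = expQ_part fs (X v)"
proof (induction fs)
  case (Cons f fs)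
  obtain s i \<xi> where f: "f = (s, i, \<xi>)" by (cases f)
  with Cons have i: "i \<in> {1, 2}" and fs: "valid_factors fs" by (auto simp: valid_Cons)
  show ?case
    unfolding f expQ_part_Cons commute_expQs[where X = X, OF i assms[OF i]] Cons.IH[OF fs] ..
qed (simp add: no_expQ_def)

text \<open>
  The two operators are inverse to each other.
\<close>

lemma expQi_expQi:
  assumes "i \<in> {1, 2}" "j \<in> {1, 2}"
  shows "expQi R i (expQi R j v) = expQi R j (expQi R i v)"
proof -
  have "expQi R 2 (expQi R 1 v) = v" for v
    using expQ1_expQ2[of "expQi R 1 v"] bij_expQi[of 1] by (simp add: bij_def inj_def)
  then show ?thesis using assms expQ1_expQ2 by auto
qed

lemma expQ_part_expQ_part:
  assumes "valid_factors fs" "valid_factors gs"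
  shows "expQ_part fs (expQ_part gs v) = expQ_part gs (expQ_part fs v)"
  by (rule commute_expQ_part[OF _ assms(2)], rule sym, rule commute_expQ_part) (use expQi_expQi assms in auto)

lemma h_expQi:
  assumes "i \<in> {1, 2}" "j \<in> {1, 2}"
  shows "hmode R i n (expQi R j v) = expQi R j (hmode R i n v) +
    smul R (if n = 0 then of_int (index_sign i * index_sign j) else 0) (expQi R j v)"
proof (cases "i = j")
  case True
  then show ?thesis using assms h_expQi_same[of i n v] by (auto simp: index_sign_def algebra_simps)
next
  case False
  then show ?thesis using assms h_expQi_diff[of i j n v] by (auto simp: index_sign_def algebra_simps)
qed

lemma commute_exponent:
  assumes "lin X" "\<And>i v. i \<in> {1, 2} \<Longrightarrow> X (hmode R i n v) = hmode R i n (X v)"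
  shows "valid_factors fs \<Longrightarrow> X (exponent fs n v) = exponent fs n (X v)"
proof (induction fs)
  case (Cons f fs)
  then have "findex f \<in> {1, 2}" "valid_factors fs" by (simp_all only: valid_Cons')
  with Cons.IH show ?case
    by (simp only: exponent_Cons lin_add[OF assms(1)] lin_scale[OF assms(1)] assms(2))
qed (simp add: exponent_Nil lin_zero[OF assms(1)])

lemma exponent_expQ_part:
  assumes "valid_factors gs" "n \<noteq> 0" "valid_factors fs"
  shows "expQ_part gs (exponent fs n v) = exponent fs n (expQ_part gs v)"
proof (rule commute_exponent[OF lin_expQ_part[OF assms(1)] _ assms(3)])
  show "expQ_part gs (hmode R i n v) = hmode R i n (expQ_part gs v)" if "i \<in> {1, 2}" for i v
    by (rule commute_expQ_part[symmetric, OF _ assms(1)]) (use h_expQi[OF that] assms(2) in simp)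
qed

lemma creation_expQ_part: "valid_factors fs \<Longrightarrow> valid_factors gs \<Longrightarrow> expQ_part gs (creation fs k v) = creation fs k (expQ_part gs v)"
  by (rule creation_commute[where X = "expQ_part gs"]) (auto simp: lin_expQ_part exponent_expQ_part)

lemma annihilation_expQ_part: "valid_factors fs \<Longrightarrow> valid_factors gs \<Longrightarrow> expQ_part gs (annihilation fs k v) = annihilation fs k (expQ_part gs v)"
  by (rule annihilation_commute[where X = "expQ_part gs"]) (auto simp: lin_expQ_part exponent_expQ_part)

section \<open>The operators \<open>q\<^sub>1\<^sup>a\<close>\<close>

text \<open>
  The operator \<open>exp (t a\<^sub>0)\<close> is defined through the eigenvector decomposition of \<open>a\<^sub>0\<close>, which commuting
  operators preserve; with \<open>t\<close> a multiple of \<open>l1\<close> it is a power of \<open>q\<^sub>1\<^sup>a\<close>.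
\<close>

abbreviation "exp_a0 t \<equiv> exp_diag R t (azero R)"

lemma exp_a0_eq: "eigdecomp R (azero R) v g \<Longrightarrow> exp_a0 t v = Sum_any (\<lambda>x. smul R (exp (t * x)) (g x))"
  by (simp add: exp_diag_def eigcomp_eq[OF linear_a0])

lemma lin_eigcomp:
  assumes "lin X" "\<And>v. \<exists>g. eigdecomp R X v g"
  shows "lin (\<lambda>v. eigcomp R X v x)"
proof (rule linI)
  fix u v c
  obtain g h where g: "eigdecomp R X u g" and h: "eigdecomp R X v h" using assms(2) by metis
  have fin: "finite {x. g x \<noteq> 0}" "finite {x. h x \<noteq> 0}" using g h by (auto simp: eigdecomp_def)
  have "finite {x. g x + h x \<noteq> 0}" by (rule finite_subset[OF _ finite_UnI[OF fin]]) auto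
  then have "eigdecomp R X (u + v) (\<lambda>x. g x + h x)"
    using g h Sum_any.distrib[OF fin] by (simp add: eigdecomp_def lin_add[OF assms(1)] scale_right_distrib)
  then show "eigcomp R X (u + v) x = eigcomp R X u x + eigcomp R X v x"
    by (simp add: eigcomp_eq[OF assms(1)] eigcomp_eq[OF assms(1) g] eigcomp_eq[OF assms(1) h])
  have "finite {x. smul R c (g x) \<noteq> 0}" by (rule finite_subset[OF _ fin(1)]) auto
  then have "eigdecomp R X (smul R c u) (\<lambda>x. smul R c (g x))"
    using g lin_Sum_any[OF lin_smul[OF lin_id] fin(1)]
    by (simp add: eigdecomp_def lin_scale[OF assms(1)] mult.commute)
  then show "eigcomp R X (smul R c u) x = smul R c (eigcomp R X u x)"
    by (simp add: eigcomp_eq[OF assms(1)] eigcomp_eq[OF assms(1) g])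
qed

lemma lin_exp_a0: "lin (exp_a0 t)"
  unfolding exp_diag_def
  by (intro lin_Sum_any_fun lin_smul lin_eigcomp linear_a0 a0_diagonal exp_diag_finite_terms)

lemma commute_exp_a0:
  assumes "lin X" "\<And>v. azero R (X v) = X (azero R v)"
  shows "X (exp_a0 t v) = exp_a0 t (X v)"
proof -
  obtain g where g: "eigdecomp R (azero R) v g" using a0_diagonal by metis
  then have fin: "finite {x. g x \<noteq> 0}" by (auto simp: eigdecomp_def)
  have f: "finite {x. smul R (exp (t * x)) (g x) \<noteq> 0}" using fin by simp_all
  have "finite {x. X (g x) \<noteq> 0}" by (rule finite_subset[OF _ fin]) (auto simp: lin_zero[OF assms(1)])
  then have "eigdecomp R (azero R) (X v) (\<lambda>x. X (g x))"
    using g lin_Sum_any[OF assms(1) fin] by (simp add: eigdecomp_def assms(2) lin_scale[OF assms(1)])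
  then show ?thesis using g lin_Sum_any[OF assms(1) f] by (simp add: exp_a0_eq lin_scale[OF assms(1)])
qed

lemma exp_a0_exp_a0: "exp_a0 s (exp_a0 t v) = exp_a0 (s + t) v"
proof -
  obtain g where g: "eigdecomp R (azero R) v g" using a0_diagonal by metis
  then have fin: "finite {x. g x \<noteq> 0}" by (auto simp: eigdecomp_def)
  note Kt = exp_a0_eq[OF g, of t]
  have "eigdecomp R (azero R) (exp_a0 t v) (\<lambda>x. smul R (exp (t * x)) (g x))"
    using g fin Kt by (simp add: eigdecomp_def lin_scale[OF linear_a0] mult.commute)
  from exp_a0_eq[OF this, of s] show ?thesis
    by (simp add: exp_a0_eq[OF g] exp_add[symmetric] algebra_simps)
qed

lemma exp_a0_0: "exp_a0 0 v = v"
proof -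
  obtain g where "eigdecomp R (azero R) v g" using a0_diagonal by metis
  then show ?thesis by (simp add: exp_a0_eq) (simp add: eigdecomp_def)
qed

lemma a0_part_eq: "a0_part fs v = exp_a0 (of_int (\<Sum>(s, i, \<xi>)\<leftarrow>fs. s) * l1) v"
  by (induction fs) (auto simp: no_azero_def exp_a0_0 exp_a0_exp_a0 algebra_simps)

lemma lin_a0_part: "lin (a0_part fs)"
  using lin_exp_a0 by (simp add: a0_part_eq[abs_def])

lemma a0_part_a0_part: "a0_part fs (a0_part gs v) = a0_part gs (a0_part fs v)"
  by (simp add: a0_part_eq exp_a0_exp_a0 add.commute)

lemma a0_part_append: "a0_part (fs @ gs) v = a0_part fs (a0_part gs v)"
  by (simp add: no_azero_def)

lemma h_a0_part: "i \<in> {1, 2} \<Longrightarrow> a0_part gs (hmode R i n v) = hmode R i n (a0_part gs v)"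
  unfolding a0_part_eq by (rule commute_exp_a0[symmetric]) (use linear_h a0_h in auto)

lemma expQ_part_a0_part: "valid_factors fs \<Longrightarrow> a0_part gs (expQ_part fs v) = expQ_part fs (a0_part gs v)"
  by (rule commute_expQ_part) (auto simp: a0_part_eq intro!: commute_exp_a0[symmetric] linear_expQi a0_expQi)

lemma exponent_a0_part: "valid_factors fs \<Longrightarrow> a0_part gs (exponent fs n v) = exponent fs n (a0_part gs v)"
  by (rule commute_exponent[OF lin_a0_part h_a0_part])

lemma creation_a0_part: "valid_factors fs \<Longrightarrow> a0_part gs (creation fs k v) = creation fs k (a0_part gs v)"
  by (rule creation_commute[where X = "a0_part gs"]) (auto simp: lin_a0_part exponent_a0_part)

lemma annihilation_a0_part: "valid_factors fs \<Longrightarrow> a0_part gs (annihilation fs k v) = annihilation fs k (a0_part gs v)"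
  by (rule annihilation_commute[where X = "a0_part gs"]) (auto simp: lin_a0_part exponent_a0_part)

end

text \<open>
  The index of \<open>h\<^sub>1\<^sub>,\<^sub>n\<close> stays in the form in which the locale assumptions state it.
\<close>

declare One_nat_def [simp del]

section \<open>Charges and zero mode coefficients\<close>

definition nonzero_factors :: "factor list \<Rightarrow> bool" where
  "nonzero_factors fs \<longleftrightarrow> (\<forall>f \<in> set fs. snd (snd f) \<noteq> 0)"

lemma zmode_coeff_Nil: "zmode_coeff q [] \<mu> = 1"
  by (simp add: zmode_coeff_def)

lemma zmode_coeff_Cons: "zmode_coeff q ((s, i, \<xi>) # fs) \<mu> =
    (q powi (- s) * \<xi>) powi (s * index_sign i * \<mu>) * zmode_coeff q fs \<mu>"
  by (simp add: zmode_coeff_def)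

lemma zmode_coeff_append: "zmode_coeff q (fs @ gs) \<mu> = zmode_coeff q fs \<mu> * zmode_coeff q gs \<mu>"
  by (simp add: zmode_coeff_def)

lemma zmode_coeff_add:
  assumes "q \<noteq> 0"
  shows "nonzero_factors fs \<Longrightarrow> zmode_coeff q fs (\<mu> + \<nu>) = zmode_coeff q fs \<mu> * zmode_coeff q fs \<nu>"
proof (induction fs)
  case (Cons f fs)
  obtain s i \<xi> where f: "f = (s, i, \<xi>)" by (cases f)
  with Cons show ?case using assms
    by (simp add: zmode_coeff_Cons nonzero_factors_def distrib_left power_int_add)
qed (simp add: zmode_coeff_def)

lemma charge_Nil: "charge [] = 0" by (simp add: charge_def)

lemma charge_Cons: "charge ((s, i, \<xi>) # fs) = s * index_sign i + charge fs"
  by (simp add: charge_def)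

lemma zmode_coeff_rescale:
  assumes "c \<noteq> 0"
  shows "zmode_coeff q (rescale_factors c fs) \<mu> = c powi (charge fs * \<mu>) * zmode_coeff q fs \<mu>"
proof (induction fs)
  case (Cons f fs)
  obtain s i \<xi> where f: "f = (s, i, \<xi>)" by (cases f)
  have "zmode_coeff q (rescale_factors c (f # fs)) \<mu> =
    (q powi (- s) * (c * \<xi>)) powi (s * index_sign i * \<mu>) * zmode_coeff q (rescale_factors c fs) \<mu>"
    by (simp add: f rescale_factors_def zmode_coeff_Cons)
  then show ?case using assms
    by (simp add: Cons f zmode_coeff_Cons charge_Cons power_int_mult_distrib power_int_add distrib_right)
qed (simp add: zmode_coeff_Nil charge_Nil rescale_factors_def)

context heisenberg_module
begin

text \<open>
  For \<open>c \<noteq> 0\<close> both sums have the same support, so both are zero by convention if that is infinite.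
\<close>

lemma smul_Sum_any: "smul R c (Sum_any f) = Sum_any (\<lambda>x. smul R c (f x))"
proof (cases "c = 0 \<or> finite {x. f x \<noteq> 0}")
  case True
  then show ?thesis using lin_Sum_any[OF lin_smul[OF lin_id]] by auto
qed simp

section \<open>Weight spaces\<close>

definition weight :: "int \<Rightarrow> 'v \<Rightarrow> bool" where
  "weight \<mu> v \<longleftrightarrow> hmode R 1 0 v = smul R (of_int \<mu>) v"

lemma lin_h1: "lin (hmode R 1 n)"
  by (rule linear_h) simp

lemma weight_smul: "weight \<mu> v \<Longrightarrow> weight \<mu> (smul R c v)"
  by (simp add: weight_def lin_scale[OF lin_h1] mult.commute)

lemma weight_0: "weight \<mu> 0"
  by (simp add: weight_def lin_zero[OF lin_h1])

lemma weight_Sum_any: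
  assumes "\<And>x. weight \<mu> (f x)"
  shows "weight \<mu> (Sum_any f)"
proof (cases "finite {x. f x \<noteq> 0}")
  case True
  then show ?thesis using assms lin_Sum_any[OF lin_h1 True]
    by (simp add: weight_def smul_Sum_any)
qed (simp add: weight_0)

lemma h10_h: "i \<in> {1, 2} \<Longrightarrow> hmode R 1 0 (hmode R i n v) = hmode R i n (hmode R 1 0 v)"
  using h_h[of 1 i 0 n v] by (auto simp: hcomm_def)

lemma h10_exponent: "valid_factors fs \<Longrightarrow> hmode R 1 0 (exponent fs n v) = exponent fs n (hmode R 1 0 v)"
  by (rule commute_exponent[OF lin_h1 h10_h])

lemma weight_commute: "lin X \<Longrightarrow> hmode R 1 0 (X v) = X (hmode R 1 0 v) \<Longrightarrow> weight \<mu> v \<Longrightarrow> weight \<mu> (X v)"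
  by (simp add: weight_def lin_scale)

lemma weight_creation: "valid_factors fs \<Longrightarrow> weight \<mu> v \<Longrightarrow> weight \<mu> (creation fs k v)"
  by (rule weight_commute[OF lin_creation creation_commute[where X = "hmode R 1 0"]]) (auto simp: lin_h1 h10_exponent)

lemma weight_annihilation: "valid_factors fs \<Longrightarrow> weight \<mu> v \<Longrightarrow> weight \<mu> (annihilation fs k v)"
  by (rule weight_commute[OF lin_annihilation annihilation_commute[where X = "hmode R 1 0"]]) (auto simp: lin_h1 h10_exponent)

lemma weight_a0_part: "weight \<mu> v \<Longrightarrow> weight \<mu> (a0_part fs v)"
  by (rule weight_commute[OF lin_a0_part h_a0_part[symmetric]]) auto

lemma weight_expQs:
  assumes "i \<in> {1, 2}" "s \<in> {1, - 1}" "weight \<mu> v"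
  shows "weight (\<mu> + s * index_sign i) (expQs s i v)"
proof -
  have E: "hmode R 1 0 (expQi R i u) = expQi R i (hmode R 1 0 u) + smul R (of_int (index_sign i)) (expQi R i u)" for u
    using h_expQi[of 1 i 0 u] assms(1) by (simp add: index_sign_def)
  note linE = linear_expQi[OF assms(1)]
  show ?thesis
  proof (cases "s = 1")
    case True
    then show ?thesis using assms(3) by (simp add: weight_def E lin_scale[OF linE] scale_left_distrib)
  next
    case False
    let ?u = "inv (expQi R i) v"
    have "expQi R i (hmode R 1 0 ?u) = smul R (of_int (\<mu> - index_sign i)) v"
      using E[of ?u] inv_expQi(1)[OF assms(1), of v] assms(3)
      by (simp add: weight_def scale_left_diff_distrib algebra_simps)
    also have "\<dots> = expQi R i (smul R (of_int (\<mu> - index_sign i)) ?u)"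
      by (simp only: lin_scale[OF linE] inv_expQi(1)[OF assms(1)])
    finally have "hmode R 1 0 ?u = smul R (of_int (\<mu> - index_sign i)) ?u"
      using bij_expQi[OF assms(1)] by (simp add: bij_def inj_def)
    then show ?thesis using False assms(2) by (simp add: weight_def)
  qed
qed

lemma weight_expQ_part: "valid_factors fs \<Longrightarrow> weight \<mu> v \<Longrightarrow> weight (\<mu> + charge fs) (expQ_part fs v)"
proof (induction fs)
  case (Cons f fs)
  obtain s i \<xi> where f: "f = (s, i, \<xi>)" by (cases f)
  with Cons have "weight (\<mu> + charge fs + s * index_sign i) (expQs s i (expQ_part fs v))"
    by (intro weight_expQs) (auto simp: valid_Cons)
  then show ?case by (simp only: f expQ_part_Cons charge_Cons ac_simps)
qed (simp add: no_expQ_def charge_Nil)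

lemma hmode_0_weight: "i \<in> {1, 2} \<Longrightarrow> weight \<mu> v \<Longrightarrow> hmode R i 0 v = smul R (of_int (index_sign i * \<mu>)) v"
proof -
  assume "i \<in> {1, 2}" "weight \<mu> v"
  then show ?thesis
    using h10_h20[of v] by (auto simp: weight_def index_sign_def minus_equation_iff[of "hmode R 2 0 v"])
qed

lemma zpower_weight:
  assumes i: "i \<in> {1, 2}" and v: "weight \<mu> v"
  shows "zpower R c (\<lambda>v. smul R (of_int s) (hmode R i 0 v)) m v =
    (if m = s * index_sign i * \<mu> then smul R (c powi m) v else 0)"
proof -
  let ?g = "\<lambda>x. if x = of_int (s * index_sign i * \<mu>) then v else 0"
  have "smul R (of_int s) (hmode R i 0 (?g x)) = smul R x (?g x)" for x
    using hmode_0_weight[OF i v] hmode_0_weight[OF i weight_0] by (auto simp: mult.assoc)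
  moreover have "finite {x. ?g x \<noteq> 0}"
    by (rule finite_subset[of _ "{of_int (s * index_sign i * \<mu>)}"]) auto
  ultimately have "eigdecomp R (\<lambda>v. smul R (of_int s) (hmode R i 0 v)) v ?g"
    unfolding eigdecomp_def by (simp only: Sum_any.delta) blast
  then show ?thesis
    by (simp add: zpower_def eigcomp_eq[OF linear_h0[OF i]] flip: of_int_mult)
qed

lemma no_zmode_weight:
  assumes v: "weight \<mu> v"
  shows "valid_factors fs \<Longrightarrow> no_zmode R q fs m v = (if m = charge fs * \<mu> then smul R (zmode_coeff q fs \<mu>) v else 0)"
proof (induction fs arbitrary: m)
  case Nil
  then show ?case by (simp add: no_zmode_def opser_const_def charge_Nil zmode_coeff_Nil)
next
  case (Cons f fs)
  obtain s i \<xi> where f: "f = (s, i, \<xi>)" by (cases f)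
  from Cons.prems have i: "i \<in> {1, 2}" and fs: "valid_factors fs" by (auto simp: f valid_Cons)
  let ?z = "zpower R (q powi (- s) * \<xi>) (\<lambda>v. smul R (of_int s) (hmode R i 0 v))"
  have z0: "?z k 0 = 0" for k
    using zpower_weight[OF i weight_0[of 0]] by simp
  have "no_zmode R q (f # fs) m v = Sum_any (\<lambda>k. ?z (m - k) (no_zmode R q fs k v))"
    by (simp add: f no_zmode_def opser_mult_def)
  also have "\<dots> = Sum_any (\<lambda>k. if k = charge fs * \<mu> then ?z (m - k) (smul R (zmode_coeff q fs \<mu>) v) else 0)"
    by (intro Sum_any.cong) (simp add: Cons.IH[OF fs] z0)
  also have "\<dots> = ?z (m - charge fs * \<mu>) (smul R (zmode_coeff q fs \<mu>) v)"
    by (rule Sum_any.delta)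
  also have "\<dots> = (if m = charge (f # fs) * \<mu> then smul R (zmode_coeff q (f # fs) \<mu>) v else 0)"
  proof -
    have "m - charge fs * \<mu> = s * index_sign i * \<mu> \<longleftrightarrow> m = charge (f # fs) * \<mu>"
      by (auto simp: f charge_Cons algebra_simps)
    then show ?thesis
      unfolding zpower_weight[OF i weight_smul[OF v]] by (auto simp: f zmode_coeff_Cons)
  qed
  finally show ?case .
qed

lemma opser_mult_const:
  assumes "X 0 = 0"
  shows "opser_mult (opser_const X) B n v = X (B n v)"
proof -
  have "opser_mult (opser_const X) B n v = Sum_any (\<lambda>k. if k = n then X (B k v) else 0)"
    unfolding opser_mult_def opser_const_def by (intro Sum_any.cong) auto
  then show ?thesis by simp
qed

lemma Sum_any_shift: "Sum_any f = Sum_any (\<lambda>k::int. f (k + c))"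
proof (rule Sum_any.reindex_cong)
  show "bij (\<lambda>k. k + c)" by (rule bij_betw_byWitness[of _ "\<lambda>k. k - c"]) auto
qed (simp add: comp_def)

text \<open>
  On a weight vector the zero modes only multiply by a number and shift the degree, since the
  annihilation modes preserve the weight.
\<close>

lemma nord_weight:
  assumes fs: "valid_factors fs" and v: "weight \<mu> v"
  shows "nord R q l1 fs n v = smul R (zmode_coeff q fs \<mu>)
     (Sum_any (\<lambda>k. creation fs (n - charge fs * \<mu> - k) (expQ_part fs (a0_part fs (annihilation fs k v)))))"
proof -
  let ?c = "zmode_coeff q fs \<mu>"
  have z: "opser_mult (no_zmode R q fs) (opser_mult (opser_const (a0_part fs)) (annihilation fs)) n v =
      smul R ?c (a0_part fs (annihilation fs (n - charge fs * \<mu>) v))" for n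
  proof -
    have "opser_mult (no_zmode R q fs) (opser_mult (opser_const (a0_part fs)) (annihilation fs)) n v =
      Sum_any (\<lambda>k. no_zmode R q fs (n - k) (a0_part fs (annihilation fs k v)))"
      unfolding opser_mult_def[of "no_zmode R q fs"] by (simp add: opser_mult_const no_azero_zero)
    also have "\<dots> = Sum_any (\<lambda>k. if k = n - charge fs * \<mu> then smul R ?c (a0_part fs (annihilation fs k v)) else 0)"
      by (intro Sum_any.cong) (auto simp: no_zmode_weight[OF weight_a0_part[OF weight_annihilation[OF fs v]] fs])
    finally show ?thesis by simp
  qed
  have "nord R q l1 fs n v = Sum_any (\<lambda>k. creation fs (n - k) (expQ_part fs (smul R ?c (a0_part fs (annihilation fs (k - charge fs * \<mu>) v)))))"
    unfolding nord_def opser_mult_def[of "creation fs"]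
    by (simp add: opser_mult_const no_expQ_zero[OF fs] z)
  also have "\<dots> = Sum_any (\<lambda>k. smul R ?c (creation fs (n - charge fs * \<mu> - k) (expQ_part fs (a0_part fs (annihilation fs k v)))))"
    by (subst Sum_any_shift[of _ "charge fs * \<mu>"])
      (simp add: lin_scale[OF lin_creation[OF fs]] lin_scale[OF lin_expQ_part[OF fs]] algebra_simps)
  finally show ?thesis by (simp add: smul_Sum_any)
qed

section \<open>Products of two normally ordered products\<close>

lemma annihilation_finite: "valid_factors fs \<Longrightarrow> finite {k. annihilation fs k v \<noteq> 0}"
  using locally_finite_annihilation unfolding locally_finite_def by blast

text \<open>
  The source of all finiteness below: only finitely many pairs of annihilation degrees act nontrivially
  on a given vector.
\<close>

lemma annihilation_annihilation_finite:
  assumes "valid_factors fs" "valid_factors gs"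
  shows "finite {(k, l). annihilation fs k (annihilation gs l v) \<noteq> 0}"
proof (rule finite_subset)
  show "{(k, l). annihilation fs k (annihilation gs l v) \<noteq> 0} \<subseteq>
    (\<Union>l\<in>{l. annihilation gs l v \<noteq> 0}. (\<lambda>k. (k, l)) ` {k. annihilation fs k (annihilation gs l v) \<noteq> 0})"
    using lin_zero[OF lin_annihilation[OF assms(1)]] by force
qed (use annihilation_finite assms in auto)

text \<open>
  The coefficient of \<open>z\<^sup>m w\<^sup>n\<close> in \<open>:fs(z) gs(w): v\<close> for a vector \<open>v\<close> of weight \<open>\<mu>\<close> is
  \<open>nord_pair fs gs \<mu> m n v\<close>. The summand \<open>pair_core\<close> collects the terms in which the creation series
  contribute the degrees \<open>m\<close>, \<open>n\<close> and the annihilation series the degrees \<open>k\<close>, \<open>l\<close>.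
\<close>

definition pair_core :: "factor list \<Rightarrow> factor list \<Rightarrow> int \<Rightarrow> int \<Rightarrow> int \<Rightarrow> int \<Rightarrow> 'v \<Rightarrow> 'v" where
  "pair_core fs gs m n k l v = creation fs m (creation gs n (expQ_part fs (expQ_part gs (a0_part fs (a0_part gs (annihilation fs k (annihilation gs l v)))))))"

definition nord_pair :: "factor list \<Rightarrow> factor list \<Rightarrow> int \<Rightarrow> int \<Rightarrow> int \<Rightarrow> 'v \<Rightarrow> 'v" where
  "nord_pair fs gs \<mu> m n v = smul R (zmode_coeff q fs \<mu> * zmode_coeff q gs \<mu>)
     (Sum_any (\<lambda>(k, l). pair_core fs gs (m - charge fs * \<mu> - k) (n - charge gs * \<mu> - l) k l v))"

lemma pair_core_0:
  assumes "valid_factors fs" "valid_factors gs"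
  shows "annihilation fs k (annihilation gs l v) = 0 \<Longrightarrow> pair_core fs gs m n k l v = 0"
    and "m < 0 \<Longrightarrow> pair_core fs gs m n k l v = 0"
    and "n < 0 \<Longrightarrow> pair_core fs gs m n k l v = 0"
proof -
  note zero = lin_zero[OF lin_creation[OF assms(1)]] lin_zero[OF lin_creation[OF assms(2)]] lin_zero[OF lin_expQ_part[OF assms(1)]]
     lin_zero[OF lin_expQ_part[OF assms(2)]] lin_zero[OF lin_a0_part]
  show "annihilation fs k (annihilation gs l v) = 0 \<Longrightarrow> pair_core fs gs m n k l v = 0"
    by (simp add: pair_core_def zero)
  show "m < 0 \<Longrightarrow> pair_core fs gs m n k l v = 0"
    by (simp add: pair_core_def no_creation_def)
  show "n < 0 \<Longrightarrow> pair_core fs gs m n k l v = 0"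
    unfolding pair_core_def no_creation_def[of R q gs] by (simp add: zero)
qed

lemma pair_core_commute:
  assumes "valid_factors fs" "valid_factors gs"
  shows "pair_core fs gs m n k l v = pair_core gs fs n m l k v"
  unfolding pair_core_def annihilation_annihilation[OF assms, of k l v] a0_part_a0_part[of fs gs] expQ_part_expQ_part[OF assms] creation_creation[OF assms, of m n] ..

lemma nord_pair_commute:
  assumes "valid_factors fs" "valid_factors gs"
  shows "nord_pair fs gs \<mu> m n v = nord_pair gs fs \<mu> n m v"
proof -
  have "Sum_any (\<lambda>(k, l). pair_core fs gs (m - charge fs * \<mu> - k) (n - charge gs * \<mu> - l) k l v)
    = Sum_any (\<lambda>(l, k). pair_core gs fs (n - charge gs * \<mu> - l) (m - charge fs * \<mu> - k) l k v)"
    by (rule Sum_any.reindex_cong[of prod.swap]) (auto simp: pair_core_commute[OF assms] fun_eq_iff)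
  then show ?thesis by (simp add: nord_pair_def mult.commute)
qed

text \<open>
  Wick's theorem for two factors. The only reordering that produces a scalar is that of the annihilation
  series of \<open>fs\<close> with the creation series of \<open>gs\<close>, which gives the contraction; the zero modes of \<open>fs\<close> see
  the weight raised by the charge of \<open>gs\<close>, which gives the numerical factor and the shift of the degree
  of \<open>z\<close>.
\<close>

lemma nord_nord_weight:
  assumes fs: "valid_factors fs" and gs: "valid_factors gs" and nz: "nonzero_factors fs" and v: "weight \<mu> v"
  shows "nord R q l1 fs m (nord R q l1 gs n v) = smul R (zmode_coeff q fs (charge gs))
    (Sum_any (\<lambda>p. smul R (fps_Exp (contraction_fps fs gs) $ p)
       (nord_pair fs gs \<mu> (m - charge fs * charge gs + int p) (n - int p) v)))"
proof -
  let ?\<kappa> = "fps_Exp (contraction_fps fs gs)"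
  define M where "M = m - charge fs * (\<mu> + charge gs)"
  define N where "N = n - charge gs * \<mu>"
  define u where "u l = creation gs (N - l) (expQ_part gs (a0_part gs (annihilation gs l v)))" for l
  define T where "T k l j = smul R (?\<kappa> $ j) (pair_core fs gs (M - k) (N - l - int j) (k + int j) l v)" for k l j
  define S where "S = {(k, l). annihilation fs k (annihilation gs l v) \<noteq> 0}"
  have S: "finite S" unfolding S_def by (rule annihilation_annihilation_finite[OF fs gs])
  have Y: "creation fs (M - k) (expQ_part fs (a0_part fs (annihilation fs k (u l)))) = Sum_any (T k l)" for k l
  proof -
    \<comment> \<open>Move the annihilation series of \<open>fs\<close> through the creation series of \<open>gs\<close>; the charge and \<open>a\<^sub>0\<close> parts commute with both.\<close>
    let ?Y = "\<lambda>w. creation fs (M - k) (expQ_part fs (a0_part fs w))"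
    let ?w = "expQ_part gs (a0_part gs (annihilation gs l v))"
    let ?f = "\<lambda>j. smul R (?\<kappa> $ j) (creation gs (N - l - int j) (annihilation fs (k + int j) ?w))"
    have linY: "lin ?Y" using fs by (intro lin_compose[OF lin_creation] lin_compose[OF lin_expQ_part] lin_a0_part)
    have "finite {j. ?f j \<noteq> 0}"
    proof (rule finite_subset)
      have f0: "?f j = 0" if "j > nat (- k)" for j
      proof -
        have "\<not> k + int j \<le> 0" using that by linarith
        then show ?thesis using lin_zero[OF lin_creation[OF gs]] by (simp add: no_annihilation_def)
      qed
      show "{j. ?f j \<noteq> 0} \<subseteq> {..nat (- k)}"
      proof
        fix j assume "j \<in> {j. ?f j \<noteq> 0}"
        then show "j \<in> {..nat (- k)}" using f0[of j] by (auto simp only: mem_Collect_eq atMost_iff not_less[symmetric])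
      qed
    qed simp
    moreover have "?Y (?f j) = T k l j" for j
      unfolding T_def pair_core_def
      by (simp only: lin_scale[OF linY] annihilation_expQ_part[OF fs gs, symmetric] annihilation_a0_part[OF fs, symmetric] creation_a0_part[OF gs] creation_expQ_part[OF gs fs] expQ_part_a0_part[OF gs])
    moreover have "annihilation fs k (u l) = Sum_any ?f"
      unfolding u_def by (rule annihilation_creation[OF fs gs])
    ultimately show ?thesis using lin_Sum_any[OF linY, of ?f] by simp
  qed
  have T_fin: "finite {(k, l, j). T k l j \<noteq> 0}"
  proof (rule finite_subset)
    show "{(k, l, j). T k l j \<noteq> 0} \<subseteq> (\<Union>(k, l)\<in>S. (\<lambda>j. (k - int j, l, j)) ` {..nat (N - l)})"
    proof safe
      fix k l j assume "T k l j \<noteq> 0"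
      then have "(k + int j, l) \<in> S" "\<not> N - l - int j < 0"
        using pair_core_0[OF fs gs] by (auto simp: S_def T_def)
      then show "(k, l, j) \<in> (\<Union>(k, l)\<in>S. (\<lambda>j. (k - int j, l, j)) ` {..nat (N - l)})"
        by (intro UN_I[of "(k + int j, l)"]) auto
    qed
  qed (use S in auto)
  have u_fin: "finite {l. u l \<noteq> 0}"
    by (rule finite_subset[OF _ annihilation_finite[OF gs, of v]])
      (auto simp: u_def lin_zero[OF lin_creation[OF gs]] lin_zero[OF lin_expQ_part[OF gs]] lin_zero[OF lin_a0_part])
  have nord_gs: "nord R q l1 gs n v = smul R (zmode_coeff q gs \<mu>) (Sum_any u)"
    unfolding nord_weight[OF gs v] u_def N_def ..
  have w: "weight (\<mu> + charge gs) (nord R q l1 gs n v)"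
    unfolding nord_gs u_def
    by (intro weight_smul weight_Sum_any weight_creation[OF gs] weight_expQ_part[OF gs] weight_a0_part weight_annihilation[OF gs] v)
  have "nord R q l1 fs m (nord R q l1 gs n v) = smul R (zmode_coeff q fs (\<mu> + charge gs))
     (Sum_any (\<lambda>k. creation fs (M - k) (expQ_part fs (a0_part fs (annihilation fs k (nord R q l1 gs n v))))))"
    unfolding nord_weight[OF fs w] M_def ..
  also have "\<dots> = smul R (zmode_coeff q fs (\<mu> + charge gs) * zmode_coeff q gs \<mu>)
     (Sum_any (\<lambda>k. Sum_any (\<lambda>l. Sum_any (T k l))))"
  proof -
    have "creation fs (M - k) (expQ_part fs (a0_part fs (annihilation fs k (nord R q l1 gs n v)))) =
      smul R (zmode_coeff q gs \<mu>) (Sum_any (\<lambda>l. Sum_any (T k l)))" for k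
    proof -
      have lin: "lin (\<lambda>w. creation fs (M - k) (expQ_part fs (a0_part fs (annihilation fs k w))))"
        using fs by (intro lin_compose[OF lin_creation] lin_compose[OF lin_expQ_part] lin_compose[OF lin_a0_part] lin_annihilation)
      show ?thesis
        using lin_Sum_any[OF lin u_fin] unfolding nord_gs lin_scale[OF lin] Y by simp
    qed
    then show ?thesis by (simp add: smul_Sum_any[symmetric])
  qed
  also have "(Sum_any (\<lambda>k. Sum_any (\<lambda>l. Sum_any (T k l)))) = Sum_any (\<lambda>(k, l, j). T k l j)"
    by (rule Sum_any_nested3[OF T_fin])
  also have "\<dots> = Sum_any (\<lambda>(p, k, l). T (k - int p) l p)"
  proof (rule Sum_any.reindex_cong)
    \<comment> \<open>From here on \<open>k\<close> is the annihilation degree of \<open>fs\<close> that remains after the contraction of degree \<open>p\<close>.\<close>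
    show "bij (\<lambda>(p, k, l). (k - int p, l, p))"
      by (rule bij_betw_byWitness[of _ "\<lambda>(k, l, p). (p, k + int p, l)"]) auto
  qed (auto simp: fun_eq_iff)
  also have "\<dots> = Sum_any (\<lambda>p. Sum_any (\<lambda>(k, l). T (k - int p) l p))"
  proof -
    have "{(p, kl). (case kl of (k, l) \<Rightarrow> T (k - int p) l p) \<noteq> 0} =
      (\<lambda>(k, l, p). (p, k + int p, l)) ` {(k, l, j). T k l j \<noteq> 0}"
      by (force simp: image_iff)
    then have "finite {(p, kl). (case kl of (k, l) \<Rightarrow> T (k - int p) l p) \<noteq> 0}" using T_fin by simp
    from Sum_any_nested[OF this] show ?thesis by simp
  qed
  also have "smul R (zmode_coeff q fs (\<mu> + charge gs) * zmode_coeff q gs \<mu>) \<dots> =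
     smul R (zmode_coeff q fs (charge gs)) (Sum_any (\<lambda>p. smul R (?\<kappa> $ p)
       (nord_pair fs gs \<mu> (m - charge fs * charge gs + int p) (n - int p) v)))"
  proof -
    have "T (k - int p) l p = smul R (?\<kappa> $ p) (pair_core fs gs
      (m - charge fs * charge gs + int p - charge fs * \<mu> - k) (n - int p - charge gs * \<mu> - l) k l v)" for k l p
    proof -
      have "M - (k - int p) = m - charge fs * charge gs + int p - charge fs * \<mu> - k"
        "N - l - int p = n - int p - charge gs * \<mu> - l"
        by (simp_all add: M_def N_def algebra_simps)
      then show ?thesis by (simp only: T_def diff_add_cancel)
    qed
    then show ?thesis
      by (simp add: nord_pair_def zmode_coeff_add[OF q_nonzero nz] smul_Sum_any case_prod_beta' mult_ac)
  qed
  finally show ?thesis .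
qed

text \<open>
  For fixed total degree \<open>T\<close> the coefficients form a Laurent polynomial in \<open>w/z\<close>: the degree in each
  variable is bounded below, because both annihilation degrees are.
\<close>

lemma nord_pair_finite:
  assumes fs: "valid_factors fs" and gs: "valid_factors gs"
  shows "finite {p. nord_pair fs gs \<mu> (T - p) p v \<noteq> 0}"
proof -
  define S where "S = {(k, l). annihilation fs k (annihilation gs l v) \<noteq> 0}"
  have S: "finite S" unfolding S_def by (rule annihilation_annihilation_finite[OF fs gs])
  have "{p. nord_pair fs gs \<mu> (T - p) p v \<noteq> 0} \<subseteq>
      (\<Union>(k, l)\<in>S. {charge gs * \<mu> + l..T - charge fs * \<mu> - k})"
  proof
    fix p assume "p \<in> {p. nord_pair fs gs \<mu> (T - p) p v \<noteq> 0}"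
    then have "Sum_any (\<lambda>(k, l). pair_core fs gs (T - p - charge fs * \<mu> - k) (p - charge gs * \<mu> - l) k l v) \<noteq> 0"
      by (auto simp: nord_pair_def)
    then obtain k l where "pair_core fs gs (T - p - charge fs * \<mu> - k) (p - charge gs * \<mu> - l) k l v \<noteq> 0"
      by (metis (no_types, lifting) Sum_any.not_neutral_obtains_not_neutral case_prod_conv surj_pair)
    then have "(k, l) \<in> S" "\<not> T - p - charge fs * \<mu> - k < 0" "\<not> p - charge gs * \<mu> - l < 0"
      using pair_core_0[OF fs gs] by (auto simp: S_def)
    then show "p \<in> (\<Union>(k, l)\<in>S. {charge gs * \<mu> + l..T - charge fs * \<mu> - k})"
      by (intro UN_I[of "(k, l)"]) auto
  qed
  then show ?thesis by (rule finite_subset) (use S in auto)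
qed

lemma exponent_rescale: "exponent (rescale_factors c fs) n v = smul R (c powi (- n)) (exponent fs n v)"
  by (induction fs) (auto simp: rescale_factors_def exponent_Nil exponent_Cons fcoeff_def power_int_mult_distrib
      scale_right_distrib scale_right_diff_distrib mult_ac)

lemma op_pow_rescale:
  assumes "\<And>k. lin (A k)"
  shows "op_pow (\<lambda>k v. smul R (c ^ k) (A k v)) r m v = smul R (c ^ m) (op_pow A r m v)"
proof (induction r arbitrary: m)
  case (Suc r)
  have "c ^ k * c ^ (m - k) = c ^ m" if "k \<in> {1..m}" for k
    using that by (simp flip: power_add)
  then show ?case
    by (auto simp: Suc lin_scale[OF assms] scale_sum_right intro!: sum.cong)
qed simp

lemma op_exp_rescale:
  assumes "\<And>k. lin (A k)"
  shows "op_exp R (\<lambda>k v. smul R (c ^ k) (A k v)) m v = smul R (c ^ m) (op_exp R A m v)"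
  by (simp add: op_exp_def op_pow_rescale[OF assms] scale_sum_right mult.commute)

lemma creation_rescale:
  assumes "valid_factors fs"
  shows "creation (rescale_factors c fs) m v = smul R (c powi m) (creation fs m v)"
proof -
  have "exponent (rescale_factors c fs) (- int n) = (\<lambda>v. smul R (c ^ n) (exponent fs (- int n) v))" for n
    by (simp add: fun_eq_iff exponent_rescale)
  moreover have "c powi m = c ^ nat m" if "m \<ge> 0" using that by (simp add: power_int_def)
  ultimately show ?thesis
    using op_exp_rescale[OF lin_exponent[OF assms], of c "\<lambda>n. - int n"]
    by (simp add: no_creation_def)
qed

lemma annihilation_rescale:
  assumes "valid_factors fs"
  shows "annihilation (rescale_factors c fs) m v = smul R (c powi m) (annihilation fs m v)"
proof -
  have "exponent (rescale_factors c fs) (int n) = (\<lambda>v. smul R (inverse c ^ n) (exponent fs (int n) v))" for n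
    by (simp add: fun_eq_iff exponent_rescale power_int_minus power_inverse)
  moreover have "c powi m = inverse c ^ nat (- m)" if "m \<le> 0" using that by (auto simp: power_int_def)
  ultimately show ?thesis
    using op_exp_rescale[OF lin_exponent[OF assms], of "inverse c" "\<lambda>n. int n"]
    by (simp add: no_annihilation_def)
qed

lemma expQ_part_rescale: "expQ_part (rescale_factors c fs) v = expQ_part fs v"
  by (induction fs) (auto simp: rescale_factors_def no_expQ_def)

lemma a0_part_rescale: "a0_part (rescale_factors c fs) v = a0_part fs v"
  by (induction fs) (auto simp: rescale_factors_def no_azero_def)

text \<open>
  The specialization of \<open>:fs(z) gs(w):\<close> at \<open>z = c w\<close> is the normally ordered product of all factors, with
  the parameters of \<open>fs\<close> multiplied by \<open>c\<close>. Both sides are the same triple sum.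
\<close>

lemma nord_pair_fusion:
  assumes fs: "valid_factors fs" and gs: "valid_factors gs" and v: "weight \<mu> v" and c: "c \<noteq> 0"
  shows "Sum_any (\<lambda>p. smul R (c powi (T - p)) (nord_pair fs gs \<mu> (T - p) p v)) =
    nord R q l1 (rescale_factors c fs @ gs) T v"
proof -
  define zc where "zc = zmode_coeff q fs \<mu> * zmode_coeff q gs \<mu>"
  define S where "S = {(k, l). annihilation fs k (annihilation gs l v) \<noteq> 0}"
  have S: "finite S" unfolding S_def by (rule annihilation_annihilation_finite[OF fs gs])
  let ?cf = "charge fs * \<mu>" and ?cg = "charge gs * \<mu>"
  define F where "F p k l = smul R (c powi (T - p) * zc) (pair_core fs gs (T - p - ?cf - k) (p - ?cg - l) k l v)"
    for p k l
  have F_fin: "finite {(p, k, l). F p k l \<noteq> 0}"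
  proof (rule finite_subset)
    show "{(p, k, l). F p k l \<noteq> 0} \<subseteq> (\<Union>(k, l)\<in>S. (\<lambda>p. (p, k, l)) ` {?cg + l..T - ?cf - k})"
    proof safe
      fix p k l assume "F p k l \<noteq> 0"
      then have "(k, l) \<in> S" "\<not> T - p - ?cf - k < 0" "\<not> p - ?cg - l < 0"
        using pair_core_0[OF fs gs] by (auto simp: S_def F_def)
      then show "(p, k, l) \<in> (\<Union>(k, l)\<in>S. (\<lambda>p. (p, k, l)) ` {?cg + l..T - ?cf - k})"
        by (intro UN_I[of "(k, l)"]) auto
    qed
  qed (use S in auto)
  \<comment> \<open>Degrees on the right: \<open>j\<close> and \<open>k\<close> of the annihilation series of the joined list and of \<open>fs\<close>, \<open>e\<close> of the creation series of \<open>fs\<close>.\<close>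
  define G where "G j k e = F (T - ?cf - k - e) k (j - k)" for j k e
  have G_fin: "finite {(j, k, e). G j k e \<noteq> 0}"
  proof -
    have "{(j, k, e). G j k e \<noteq> 0} \<subseteq> (\<lambda>(p, k, l). (k + l, k, T - ?cf - k - p)) ` {(p, k, l). F p k l \<noteq> 0}"
    proof safe
      fix j k e assume "G j k e \<noteq> 0"
      then show "(j, k, e) \<in> (\<lambda>(p, k, l). (k + l, k, T - ?cf - k - p)) ` {(p, k, l). F p k l \<noteq> 0}"
        by (intro image_eqI[of _ _ "(T - ?cf - k - e, k, j - k)"]) (auto simp: G_def)
    qed
    then show ?thesis using F_fin finite_surj by blast
  qed
  have "Sum_any (\<lambda>p. smul R (c powi (T - p)) (nord_pair fs gs \<mu> (T - p) p v)) =
    Sum_any (\<lambda>p. Sum_any (\<lambda>(k, l). F p k l))"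
    by (simp add: nord_pair_def F_def zc_def smul_Sum_any case_prod_beta')
  also have "\<dots> = Sum_any (\<lambda>(p, k, l). F p k l)"
    using Sum_any_nested[of "\<lambda>p (k, l). F p k l"] F_fin by (simp add: case_prod_beta')
  also have "\<dots> = Sum_any (\<lambda>(j, k, e). G j k e)"
  proof (rule Sum_any.reindex_cong)
    show "bij (\<lambda>(j, k, e). (T - ?cf - k - e, k, j - k))"
      by (rule bij_betw_byWitness[of _ "\<lambda>(p, k, l). (k + l, k, T - ?cf - k - p)"]) auto
  qed (auto simp: fun_eq_iff G_def)
  also have "\<dots> = Sum_any (\<lambda>j. Sum_any (\<lambda>k. Sum_any (G j k)))"
    by (rule Sum_any_nested3[OF G_fin, symmetric])
  also have "\<dots> = nord R q l1 (rescale_factors c fs @ gs) T v"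
  proof -
    let ?fs = "rescale_factors c fs"
    have fs': "valid_factors ?fs" using fs by (simp add: valid_rescale)
    have z: "zmode_coeff q (?fs @ gs) \<mu> = c powi ?cf * zc"
      by (simp add: zmode_coeff_append zmode_coeff_rescale[OF c] zc_def)
    have "smul R (c powi ?cf * zc) (creation (?fs @ gs) (T - (?cf + ?cg) - j) (expQ_part fs (expQ_part gs (a0_part fs (a0_part gs (annihilation (?fs @ gs) j v)))))) =
      Sum_any (\<lambda>k. Sum_any (G j k))" for j
    proof -
      let ?Y = "\<lambda>w. creation (?fs @ gs) (T - (?cf + ?cg) - j) (expQ_part fs (expQ_part gs (a0_part fs (a0_part gs w))))"
      have linY: "lin ?Y"
        using fs gs fs' by (intro lin_compose[OF lin_creation] lin_compose[OF lin_expQ_part] lin_compose[OF lin_a0_part] lin_a0_part)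
          (auto simp: valid_append)
      have annihilation: "annihilation (?fs @ gs) j v = Sum_any (\<lambda>k. smul R (c powi k) (annihilation fs k (annihilation gs (j - k) v)))"
        by (simp add: annihilation_append[OF fs' gs] annihilation_rescale[OF fs])
      have "{k. smul R (c powi k) (annihilation fs k (annihilation gs (j - k) v)) \<noteq> 0} \<subseteq> fst ` S"
        by (force simp: S_def)
      then have fin: "finite {k. smul R (c powi k) (annihilation fs k (annihilation gs (j - k) v)) \<noteq> 0}"
        using S by (meson finite_imageI finite_subset)
      have "smul R (c powi ?cf * zc * c powi k) (?Y (annihilation fs k (annihilation gs (j - k) v))) = Sum_any (G j k)" for k
      proof -
        have "G j k e = smul R (c powi ?cf * zc * c powi k) (smul R (c powi e)
          (pair_core fs gs e (T - (?cf + ?cg) - j - e) k (j - k) v))" for e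
        proof -
          have "T - (T - ?cf - k - e) - ?cf - k = e"
            "T - ?cf - k - e - ?cg - (j - k) = T - (?cf + ?cg) - j - e"
            "T - (T - ?cf - k - e) = ?cf + k + e" by auto
          moreover have "c powi (?cf + k + e) * zc = c powi ?cf * zc * c powi k * c powi e"
            using c by (simp add: power_int_add)
          ultimately show ?thesis unfolding G_def F_def scale_scale by (simp only:)
        qed
        then show ?thesis
          by (simp add: smul_Sum_any[symmetric] creation_append[OF fs' gs] creation_rescale[OF fs] pair_core_def del: scale_scale)
      qed
      then show ?thesis
        unfolding annihilation lin_Sum_any[OF linY fin] by (simp add: lin_scale[OF linY] smul_Sum_any)
    qed
    moreover have "valid_factors (?fs @ gs)" using fs' gs by (simp add: valid_append)
    ultimately show ?thesis
      unfolding nord_weight[OF \<open>valid_factors (?fs @ gs)\<close> v] z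
      by (simp add: smul_Sum_any charge_append charge_rescale distrib_right expQ_part_append a0_part_append expQ_part_rescale a0_part_rescale)
  qed
  finally show ?thesis .
qed

section \<open>Linearity of the currents\<close>

lemma lin_opser_mult:
  assumes "\<And>n. lin (A n)" "\<And>n. lin (B n)" "locally_finite B"
  shows "lin (opser_mult A B n)"
  unfolding opser_mult_def
  by (intro lin_Sum_any_fun lin_compose[OF assms(1)] assms(2) opser_mult_finite_terms assms(3))
     (simp add: lin_zero[OF assms(1)])

lemma lin_opser_const: "lin X \<Longrightarrow> lin (opser_const X n)"
  unfolding opser_const_def by (cases "n = 0") (simp_all add: lin_0)

lemma lin_zmode: "valid_factors fs \<Longrightarrow> lin (no_zmode R q fs n)"
proof (induction fs arbitrary: n)
  case Nil
  then show ?case by (simp add: no_zmode_def lin_opser_const lin_id)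
next
  case (Cons f fs)
  obtain s i \<xi> where f: "f = (s, i, \<xi>)" by (cases f)
  from Cons.prems have s: "s \<in> {1, - 1}" and i: "i \<in> {1, 2}" and fs: "valid_factors fs"
    by (auto simp: f valid_Cons)
  have "\<exists>g. eigdecomp R (\<lambda>v. smul R (of_int s) (hmode R i 0 v)) v g" for v
    by (rule h0_eigdecomp[OF i s, of v]) blast
  then have "lin (zpower R c (\<lambda>v. smul R (of_int s) (hmode R i 0 v)) n)" for c n
    unfolding zpower_def by (intro lin_smul lin_eigcomp linear_h0[OF i])
  then have "lin (opser_mult (zpower R (q powi (- s) * \<xi>) (\<lambda>v. smul R (of_int s) (hmode R i 0 v))) (no_zmode R q fs) n)"
    by (intro lin_opser_mult Cons.IH[OF fs] locally_finite_zmode[OF fs])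
  then show ?case by (simp add: f no_zmode_def)
qed

lemma lin_nord: "valid_factors fs \<Longrightarrow> lin (nord R q l1 fs n)"
  unfolding nord_def
  by (intro lin_opser_mult lin_creation lin_opser_const lin_expQ_part lin_zmode lin_a0_part lin_annihilation
      nord_inner_locally_finite locally_finite_annihilation)

text \<open>
  Every vector is a finite sum of weight vectors because \<open>h\<^sub>1\<^sub>,\<^sub>0\<close> is diagonalizable with integral
  eigenvalues.
\<close>

lemma weight_ext:
  assumes "lin X" "lin Y" "\<And>\<mu> v. weight \<mu> v \<Longrightarrow> X v = Y v"
  shows "X v = Y v"
proof -
  obtain g where g: "eigdecomp R (hmode R 1 0) v g" "\<And>x. g x \<noteq> 0 \<Longrightarrow> x \<in> \<int>"
    using h10_integral by blast
  then have fin: "finite {x. g x \<noteq> 0}" and v: "v = Sum_any g" by (auto simp: eigdecomp_def)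
  have "X (g x) = Y (g x)" for x
  proof (cases "g x = 0")
    case False
    then obtain \<mu> where "x = of_int \<mu>" using g(2) Ints_cases by blast
    then have "weight \<mu> (g x)" using g(1) by (simp add: eigdecomp_def weight_def)
    then show ?thesis by (rule assms(3))
  qed (simp add: lin_zero assms)
  then show ?thesis
    by (simp add: v lin_Sum_any[OF assms(1) fin] lin_Sum_any[OF assms(2) fin])
qed

end

section \<open>Geometric series and their logarithms\<close>

definition fps_geometric :: "complex \<Rightarrow> complex fps" where
  "fps_geometric c = Abs_fps (\<lambda>n. c ^ n)"

text \<open>
  The series of \<open>- log (1 - c x)\<close>.
\<close>

definition fps_log :: "complex \<Rightarrow> complex fps" where
  "fps_log c = Abs_fps (\<lambda>n. c ^ n / of_nat n)"

lemma fps_geometric_nth [simp]: "fps_geometric c $ n = c ^ n"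
  by (simp add: fps_geometric_def)

lemma fps_log_nth [simp]: "fps_log c $ n = c ^ n / of_nat n"
  by (simp add: fps_log_def)

lemma one_minus_X_mult_nth:
  fixes c :: complex
  shows "((1 - fps_const c * fps_X) * F) $ n = F $ n - (if n = 0 then 0 else c * F $ (n - 1))"
proof -
  have "(1 - fps_const c * fps_X) * F = F - fps_const c * (fps_X * F)"
    by (simp add: algebra_simps)
  then show ?thesis by simp
qed

lemma fps_geometric_inverse: "(1 - fps_const c * fps_X) * fps_geometric c = 1"
proof (rule fps_ext)
  fix n
  show "((1 - fps_const c * fps_X) * fps_geometric c) $ n = 1 $ n"
    by (cases n) (simp_all add: one_minus_X_mult_nth)
qed

lemma fps_Exp_log: "fps_Exp (fps_log c) = fps_geometric c"
proof (rule fps_Exp_unique[symmetric])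
  have deriv: "fps_deriv (fps_log c) $ n = c ^ Suc n" for n
  proof -
    have "of_nat (n + 1) \<noteq> (0::complex)" by (metis of_nat_neq_0 Suc_eq_plus1)
    then show ?thesis
      by (simp only: fps_deriv_nth fps_log_nth times_divide_eq_right nonzero_mult_div_cancel_left Suc_eq_plus1
          not_False_eq_True)
  qed
  have d: "(1 - fps_const c * fps_X) * fps_deriv (fps_log c) = fps_const c"
  proof (rule fps_ext)
    fix n
    show "((1 - fps_const c * fps_X) * fps_deriv (fps_log c)) $ n = fps_const c $ n"
      unfolding one_minus_X_mult_nth deriv by (cases n) simp_all
  qed
  have "fps_deriv ((1 - fps_const c * fps_X) * fps_geometric c) = 0"
    by (simp add: fps_geometric_inverse)
  then have "(1 - fps_const c * fps_X) * fps_deriv (fps_geometric c) = fps_const c * fps_geometric c"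
    by (simp add: algebra_simps)
  also have "\<dots> = (1 - fps_const c * fps_X) * (fps_deriv (fps_log c) * fps_geometric c)"
    using d by (simp add: mult.assoc[symmetric])
  finally have "fps_geometric c * ((1 - fps_const c * fps_X) * fps_deriv (fps_geometric c)) =
     fps_geometric c * ((1 - fps_const c * fps_X) * (fps_deriv (fps_log c) * fps_geometric c))" by simp
  moreover have "fps_geometric c * ((1 - fps_const c * fps_X) * F) = F" for F
    using fps_geometric_inverse[of c] by (metis mult.assoc mult.commute mult_1)
  ultimately show "fps_deriv (fps_geometric c) = fps_deriv (fps_log c) * fps_geometric c" by simp
qed simp_all

lemma fps_Exp_minus_log: "fps_Exp (- fps_log c) = 1 - fps_const c * fps_X"
proof -
  have "fps_Exp (fps_log c + - fps_log c) = fps_Exp (fps_log c) * fps_Exp (- fps_log c)"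
    by (rule fps_Exp_add) simp_all
  then have 1: "fps_geometric c * fps_Exp (- fps_log c) = 1" by (simp add: fps_Exp_log)
  have "fps_Exp (- fps_log c) = ((1 - fps_const c * fps_X) * fps_geometric c) * fps_Exp (- fps_log c)"
    by (simp add: fps_geometric_inverse)
  also have "\<dots> = 1 - fps_const c * fps_X" using 1 by (simp add: mult.assoc)
  finally show ?thesis .
qed

text \<open>
  The expansion of \<open>(1 - w x) / (1 - u x)\<close> as a constant plus a simple pole.
\<close>

lemma fps_Exp_log_diff:
  assumes "u \<noteq> 0"
  shows "fps_Exp (fps_log u - fps_log w) = fps_const (w / u) + fps_const (1 - w / u) * fps_geometric u"
proof -
  have "fps_Exp (fps_log u - fps_log w) = fps_Exp (fps_log u) * fps_Exp (- fps_log w)"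
    using fps_Exp_add[of "fps_log u" "- fps_log w"] by simp
  also have "\<dots> = (1 - fps_const w * fps_X) * fps_geometric u"
    by (simp add: fps_Exp_log fps_Exp_minus_log)
  also have "\<dots> = fps_const (w / u) + fps_const (1 - w / u) * fps_geometric u"
  proof (rule fps_ext)
    fix n
    show "((1 - fps_const w * fps_X) * fps_geometric u) $ n =
        (fps_const (w / u) + fps_const (1 - w / u) * fps_geometric u) $ n"
      unfolding one_minus_X_mult_nth using assms by (cases n) (simp_all add: field_simps)
  qed
  finally show ?thesis .
qed

text \<open>
  Partial fractions of \<open>1 / ((1 - u x) (1 - t x))\<close>.
\<close>

lemma fps_Exp_log_log:
  assumes "u \<noteq> t"
  shows "fps_Exp (fps_log u + fps_log t) =
    fps_const (u / (u - t)) * fps_geometric u - fps_const (t / (u - t)) * fps_geometric t" (is "_ = ?R")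
proof -
  let ?u = "1 - fps_const u * fps_X" and ?t = "1 - fps_const t * fps_X"
  have expand: "x * (y * (A * g - B * h)) = A * y * (x * g) - B * x * (y * h)" for x y A B g h :: "complex fps"
    by (simp add: algebra_simps)
  have "?u * (?t * ?R) = fps_const (u / (u - t)) * ?t * (?u * fps_geometric u) - fps_const (t / (u - t)) * ?u * (?t * fps_geometric t)"
    using expand[of ?u ?t "fps_const (u / (u - t))" "fps_geometric u"] by blast
  also have "\<dots> = fps_const (u / (u - t)) * ?t - fps_const (t / (u - t)) * ?u"
    by (simp add: fps_geometric_inverse)
  also have "\<dots> = 1"
  proof (rule fps_ext)
    fix n
    show "(fps_const (u / (u - t)) * ?t - fps_const (t / (u - t)) * ?u) $ n = 1 $ n"
    proof -
      define a b where "a = u / (u - t)" and "b = t / (u - t)"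
      have "a - b = 1" using assms by (simp add: a_def b_def flip: diff_divide_distrib)
      moreover have "a * t = b * u" by (simp add: a_def b_def)
      moreover from this have "a * (t * x) = b * (u * x)" for x by (metis mult.assoc)
      ultimately show ?thesis unfolding a_def[symmetric] b_def[symmetric] by (cases n) simp_all
    qed
  qed
  finally have "?u * (?t * ?R) = 1" .
  then have "fps_geometric u * (fps_geometric t * (?u * (?t * ?R))) = fps_geometric u * fps_geometric t"
    by simp
  moreover have "fps_geometric u * (fps_geometric t * (?u * (?t * F))) =
    (?u * fps_geometric u) * ((?t * fps_geometric t) * F)" for F
    by (simp only: mult_ac)
  ultimately have "fps_geometric u * fps_geometric t = ?R" by (simp only: fps_geometric_inverse mult_1)
  then show ?thesis by (simp add: fps_Exp_add fps_Exp_log)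
qed

context heisenberg_module
begin

section \<open>Power series acting on sequences\<close>

text \<open>
  A formal series \<open>P(x) = \<Sum> P\<^sub>k x\<^sup>k\<close> of vectors that starts in some degree can be multiplied by a power
  series in \<open>x\<close>; \<open>act F P k\<close> is the coefficient of \<open>x\<^sup>k\<close> in \<open>F(x) P(x)\<close>. A power series in \<open>x\<^sup>-\<^sup>1\<close> acts in
  the same way on a reflected sequence \<open>k \<mapsto> P\<^sub>T\<^sub>-\<^sub>k\<close>.
\<close>

definition act :: "complex fps \<Rightarrow> (int \<Rightarrow> 'v) \<Rightarrow> int \<Rightarrow> 'v" where
  "act F P k = Sum_any (\<lambda>r. smul R (F $ r) (P (k - int r)))"

definition bounded_below :: "(int \<Rightarrow> 'v) \<Rightarrow> bool" where
  "bounded_below P \<longleftrightarrow> (\<exists>L. \<forall>k<L. P k = 0)"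

lemma act_eq_sum:
  assumes "\<forall>k<L. P k = 0" "k \<le> L + int N"
  shows "act F P k = (\<Sum>r=0..N. smul R (F $ r) (P (k - int r)))"
  unfolding act_def
proof (rule Sum_any.expand_superset)
  show "{r. smul R (F $ r) (P (k - int r)) \<noteq> 0} \<subseteq> {0..N}"
  proof
    fix r assume "r \<in> {r. smul R (F $ r) (P (k - int r)) \<noteq> 0}"
    then have "\<not> k - int r < L" using assms(1) by auto
    then show "r \<in> {0..N}" using assms(2) by simp
  qed
qed simp

lemma act_finite:
  assumes "bounded_below P"
  shows "finite {r. smul R (F $ r) (P (k - int r)) \<noteq> 0}"
proof -
  obtain L where L: "\<forall>k<L. P k = 0" using assms by (auto simp: bounded_below_def)
  have "{r. smul R (F $ r) (P (k - int r)) \<noteq> 0} \<subseteq> {0..nat (k - L)}"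
  proof
    fix r assume "r \<in> {r. smul R (F $ r) (P (k - int r)) \<noteq> 0}"
    then have "\<not> k - int r < L" using L by auto
    then show "r \<in> {0..nat (k - L)}" by simp
  qed
  then show ?thesis by (rule finite_subset) simp
qed

lemma act_act:
  assumes "bounded_below P"
  shows "act F (act G P) k = act (F * G) P k"
proof -
  obtain L where L: "\<forall>k<L. P k = 0" using assms by (auto simp: bounded_below_def)
  define N where "N = nat (k - L)"
  have L': "\<forall>k<L. act G P k = 0" using L by (simp add: act_def)
  have k: "k \<le> L + int N" by (simp add: N_def)
  have "act F (act G P) k = (\<Sum>r=0..N. smul R (F $ r) (act G P (k - int r)))"
    by (rule act_eq_sum[OF L' k])
  also have "\<dots> = (\<Sum>r=0..N. \<Sum>s=0..N-r. smul R (F $ r * G $ s) (P (k - int (r + s))))"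
  proof (intro sum.cong refl)
    fix r assume "r \<in> {0..N}"
    then have "k - int r \<le> L + int (N - r)" using k by auto
    from act_eq_sum[OF L this] show "smul R (F $ r) (act G P (k - int r)) =
      (\<Sum>s=0..N-r. smul R (F $ r * G $ s) (P (k - int (r + s))))"
      by (simp add: scale_sum_right algebra_simps)
  qed
  also have "\<dots> = (\<Sum>j=0..N. \<Sum>r=0..j. smul R (F $ r * G $ (j - r)) (P (k - int (r + (j - r)))))"
    using convolution_assoc[of "\<lambda>r s _. smul R (F $ r * G $ s) (P (k - int (r + s)))" N] by simp
  also have "\<dots> = (\<Sum>j=0..N. smul R ((F * G) $ j) (P (k - int j)))"
    by (simp add: fps_mult_nth scale_sum_left)
  also have "\<dots> = act (F * G) P k" by (rule act_eq_sum[OF L k, symmetric])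
  finally show ?thesis .
qed

lemma act_smul: "act F (\<lambda>k. smul R c (P k)) k = smul R c (act F P k)"
  by (simp add: act_def smul_Sum_any mult.commute)

lemma act_add: "bounded_below P \<Longrightarrow> act (F + G) P k = act F P k + act G P k"
  using Sum_any.distrib[OF act_finite act_finite, of P P F k G k]
  by (simp add: act_def scale_left_distrib)

lemma act_const_mult: "act (fps_const c * F) P k = smul R c (act F P k)"
  by (simp add: act_def smul_Sum_any)

lemma act_const: "act (fps_const c) P k = smul R c (P k)"
proof -
  have "act (fps_const c) P k = (\<Sum>r\<in>{0}. smul R (fps_const c $ r) (P (k - int r)))"
    unfolding act_def by (rule Sum_any.expand_superset) (auto split: if_splits)
  then show ?thesis by simp
qed

lemma act_diff:
  assumes "bounded_below P"
  shows "act (F - G) P k = act F P k - act G P k"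
  using act_add[OF assms, of "F - G" G k] by simp

lemma act_X_mult:
  assumes "bounded_below P"
  shows "act (fps_X * F) P k = act F P (k - 1)"
proof -
  have X: "act fps_X P k = P (k - 1)" for k
  proof -
    have "act fps_X P k = (\<Sum>r\<in>{1}. smul R (fps_X $ r) (P (k - int r)))"
      unfolding act_def by (rule Sum_any.expand_superset) (auto split: if_splits)
    then show ?thesis by simp
  qed
  have "act (fps_X * F) P k = act F (act fps_X P) k"
    by (simp add: act_act[OF assms] mult.commute)
  also have "\<dots> = act F P (k - 1)"
    unfolding X[abs_def] by (simp add: act_def algebra_simps)
  finally show ?thesis .
qed

lemma bounded_below_finite: "finite {k. P k \<noteq> 0} \<Longrightarrow> bounded_below P"
proof -
  assume "finite {k. P k \<noteq> 0}"
  then obtain L where "\<forall>k\<in>{k. P k \<noteq> 0}. L \<le> k"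
    by (meson bdd_below_finite bdd_below_def bdd_below.unfold)
  then show ?thesis unfolding bounded_below_def by (intro exI[of _ L]) force
qed

lemma Sum_any_int:
  fixes f :: "int \<Rightarrow> 'v"
  assumes "finite {n. f n \<noteq> 0}"
  shows "Sum_any f = Sum_any (\<lambda>r::nat. f (int r)) + Sum_any (\<lambda>r::nat. f (- int r)) - f 0"
proof -
  have "finite (insert 0 (abs ` {n. f n \<noteq> 0}))" using assms by simp
  then obtain N where N: "\<forall>n\<in>insert 0 (abs ` {n. f n \<noteq> 0}). n \<le> N"
    by (meson bdd_above_finite bdd_above_def bdd_above.unfold)
  have out: "f n = 0" if "\<bar>n\<bar> > N" for n using that N by force
  have N0: "N \<ge> 0" using N by simp
  have "Sum_any f = (\<Sum>n\<in>{- N..N}. f n)"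
    by (rule Sum_any.expand_superset) (use out in \<open>force+\<close>)
  also have "\<dots> = (\<Sum>n\<in>{0..N}. f n) + (\<Sum>n\<in>{- N..0}. f n) - f 0"
  proof -
    have "{0..N} \<union> {- N..0} = {- N..N}" "{0..N} \<inter> {- N..0} = {0}" using N0 by auto
    then show ?thesis using sum.union_inter[of "{0..N}" "{- N..0}" f] by (simp add: algebra_simps)
  qed
  also have "(\<Sum>n\<in>{0..N}. f n) = (\<Sum>r=0..nat N. f (int r))"
    by (rule sum.reindex_bij_witness[of _ int nat]) (use N0 in auto)
  also have "\<dots> = Sum_any (\<lambda>r::nat. f (int r))"
    by (rule Sum_any.expand_superset[symmetric]) (use out in \<open>force+\<close>)
  also have "(\<Sum>n\<in>{- N..0}. f n) = (\<Sum>r=0..nat N. f (- int r))"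
    by (rule sum.reindex_bij_witness[of _ "\<lambda>r. - int r" "\<lambda>n. nat (- n)"]) (use N0 in auto)
  also have "\<dots> = Sum_any (\<lambda>r::nat. f (- int r))"
    by (rule Sum_any.expand_superset[symmetric]) (use out in \<open>force+\<close>)
  finally show ?thesis .
qed

text \<open>
  The geometric series in \<open>t x\<close> and in \<open>(t x)\<^sup>-\<^sup>1\<close> share the constant term and together give
  \<open>\<delta>(t x)\<close>, so on a Laurent polynomial their action is evaluation at \<open>x = t\<^sup>-\<^sup>1\<close>, up to the factor \<open>t\<^sup>k\<close>.
\<close>

lemma act_delta:
  assumes P: "finite {k. P k \<noteq> 0}" and t: "t \<noteq> 0"
  shows "act (fps_geometric t) P k + act (fps_geometric (inverse t)) (\<lambda>l. P (T - l)) (T - k) - P k =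
    Sum_any (\<lambda>p. smul R (t powi (k - p)) (P p))"
proof -
  define f where "f n = smul R (t powi n) (P (k - n))" for n
  have "{n. f n \<noteq> 0} \<subseteq> (\<lambda>p. k - p) ` {p. P p \<noteq> 0}"
    by (auto simp: f_def intro: image_eqI[of _ _ "k - _"])
  then have "finite {n. f n \<noteq> 0}" using P finite_surj by blast
  from Sum_any_int[OF this]
  have "Sum_any f = act (fps_geometric t) P k + act (fps_geometric (inverse t)) (\<lambda>l. P (T - l)) (T - k) - P k"
    by (simp add: f_def act_def power_int_minus power_inverse algebra_simps)
  moreover have "Sum_any f = Sum_any (\<lambda>p. smul R (t powi (k - p)) (P p))"
  proof (rule Sum_any.reindex_cong)
    show "bij (\<lambda>p. k - p)" by (rule bij_betw_byWitness[of _ "\<lambda>p. k - p"]) auto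
  qed (auto simp: f_def fun_eq_iff)
  ultimately show ?thesis by simp
qed

section \<open>Products of two currents\<close>

lemma zw_eq_act: "zw_product R F A B a b v = act F (\<lambda>k. A (a + b - k) (B k v)) b"
  by (simp add: zw_product_def act_def)

text \<open>
  The two kinds of products differ only by the names of the variables.
\<close>

lemma wz_eq_zw: "wz_product R F B A a b v = zw_product R F B A b a v"
  by (simp add: zw_product_def wz_product_def)

text \<open>
  By \<open>nord_nord_weight\<close> the structure function is multiplied with the exponential of the contraction.
\<close>

lemma zw_nord:
  assumes fs: "valid_factors fs" and gs: "valid_factors gs" and nz: "nonzero_factors fs" and v: "weight \<mu> v"
  shows "zw_product R F (nord R q l1 fs) (nord R q l1 gs) a b v = smul R (zmode_coeff q fs (charge gs))
    (act (F * fps_Exp (contraction_fps fs gs))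
      (\<lambda>k. nord_pair fs gs \<mu> (a + b - charge fs * charge gs - k) k v) b)"
proof -
  let ?P = "\<lambda>k. nord_pair fs gs \<mu> (a + b - charge fs * charge gs - k) k v"
  let ?\<kappa> = "fps_Exp (contraction_fps fs gs)"
  have "nord R q l1 fs (a + b - k) (nord R q l1 gs k v) = smul R (zmode_coeff q fs (charge gs)) (act ?\<kappa> ?P k)" for k
    unfolding nord_nord_weight[OF fs gs nz v] act_def by (simp add: algebra_simps)
  then show ?thesis
    by (simp add: zw_eq_act act_smul act_act[OF bounded_below_finite[OF nord_pair_finite[OF fs gs]]])
qed

lemma wz_nord:
  assumes fs: "valid_factors fs" and gs: "valid_factors gs" and nz: "nonzero_factors gs" and v: "weight \<mu> v"
  shows "wz_product R F (nord R q l1 gs) (nord R q l1 fs) a b v = smul R (zmode_coeff q gs (charge fs))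
    (act (F * fps_Exp (contraction_fps gs fs))
      (\<lambda>k. nord_pair fs gs \<mu> k (a + b - charge fs * charge gs - k) v) a)"
  unfolding wz_eq_zw zw_nord[OF gs fs nz v] nord_pair_commute[OF gs fs]
  by (simp add: algebra_simps)

lemma zw_finite:
  assumes "lower_truncated B" "\<And>n. lin (A n)"
  shows "finite {r::nat. smul R (F $ r) (A (a + int r) (B (b - int r) v)) \<noteq> 0}"
proof -
  obtain L where "\<forall>n<L. B n v = 0" using assms(1) unfolding lower_truncated_def by blast
  then have "bounded_below (\<lambda>k. A (a + b - k) (B k v))"
    unfolding bounded_below_def using lin_zero[OF assms(2)] by (intro exI[of _ L]) auto
  from act_finite[OF this, of F b] show ?thesis by (simp add: algebra_simps)
qed

lemma zw_add_left:
  assumes "lower_truncated B" "\<And>n. lin (A1 n)" "\<And>n. lin (A2 n)"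
  shows "zw_product R F (\<lambda>n v. A1 n v + A2 n v) B a b v = zw_product R F A1 B a b v + zw_product R F A2 B a b v"
  using Sum_any.distrib[OF zw_finite zw_finite, OF assms(1,2) assms(1,3)]
  by (simp add: zw_product_def scale_right_distrib)

lemma zw_add_right:
  assumes "lower_truncated B1" "lower_truncated B2" "\<And>n. lin (A n)"
  shows "zw_product R F A (\<lambda>n v. B1 n v + B2 n v) a b v = zw_product R F A B1 a b v + zw_product R F A B2 a b v"
  using Sum_any.distrib[OF zw_finite zw_finite, OF assms(1,3) assms(2,3)]
  by (simp add: zw_product_def scale_right_distrib lin_add[OF assms(3)])

lemma zw_smul_right:
  "(\<And>n. lin (A n)) \<Longrightarrow> zw_product R F A (\<lambda>n v. smul R c (B n v)) a b v = smul R c (zw_product R F A B a b v)"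
  by (simp add: zw_product_def smul_Sum_any lin_scale mult.commute)

lemma zw_smul_left:
  "zw_product R F (\<lambda>n v. smul R c (A n v)) B a b v = smul R c (zw_product R F A B a b v)"
  by (simp add: zw_product_def smul_Sum_any mult.commute)

lemma zw_shift_right: "zw_product R F A (\<lambda>n. B (n - m)) a b v = zw_product R F A B a (b - m) v"
  by (simp add: zw_product_def algebra_simps)

lemma zw_shift_left: "zw_product R F (\<lambda>n. A (n - m)) B a b v = zw_product R F A B (a - m) b v"
  by (simp add: zw_product_def algebra_simps)

lemma lin_zw:
  assumes "lower_truncated B" "\<And>n. lin (A n)" "\<And>n. lin (B n)"
  shows "lin (zw_product R F A B a b)"
  unfolding zw_product_def
  by (intro lin_Sum_any_fun lin_smul lin_compose[OF assms(2)] assms(3) zw_finite[OF assms(1,2)])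

lemma delta_product_eq: "delta_product R c B a b v = smul R (c powi (- a)) (B (a + b) v)"
proof -
  have "delta_product R c B a b v = Sum_any (\<lambda>n. if n = - a then smul R (c powi n) (B (b - n) v) else 0)"
    unfolding delta_product_def by (intro Sum_any.cong) auto
  then show ?thesis by (simp add: algebra_simps)
qed

section \<open>Relations between normally ordered products\<close>

lemma nord_cong:
  assumes fs: "valid_factors fs" and gs: "valid_factors gs"
    and exponent: "\<And>n v. exponent fs n v = exponent gs n v"
    and Q: "\<And>v. expQ_part fs v = expQ_part gs v" and K: "\<And>v. a0_part fs v = a0_part gs v"
    and c: "charge fs = charge gs" and z: "\<And>\<mu>. zmode_coeff q fs \<mu> = zmode_coeff q gs \<mu>"
  shows "nord R q l1 fs n v = nord R q l1 gs n v"
proof (rule weight_ext[OF lin_nord[OF fs] lin_nord[OF gs]])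
  fix \<mu> v assume v: "weight \<mu> v"
  have "exponent fs = exponent gs" using exponent by blast
  then have "creation fs = creation gs" "annihilation fs = annihilation gs"
    unfolding no_creation_def no_annihilation_def by (simp_all only:)
  then show "nord R q l1 fs n v = nord R q l1 gs n v"
    unfolding nord_weight[OF fs v] nord_weight[OF gs v] by (simp add: Q K c z)
qed

lemma nord_swap:
  assumes "valid_factors (f # g # hs)"
  shows "nord R q l1 (f # g # hs) n v = nord R q l1 (g # f # hs) n v"
proof (rule nord_cong)
  show "valid_factors (g # f # hs)" using assms by (simp only: valid_Cons' simp_thms conj_left_commute)
  have "valid_factors [f]" "valid_factors [g]" using assms by (simp_all add: valid_factors_def)
  from expQ_part_expQ_part[OF this] show "expQ_part (f # g # hs) v = expQ_part (g # f # hs) v" for v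
    using expQ_part_append[of "[f]" "g # hs" v] expQ_part_append[of "[g]" "f # hs" v]
      expQ_part_append[of "[f]" hs v] expQ_part_append[of "[g]" hs v] by simp
  show "a0_part (f # g # hs) v = a0_part (g # f # hs) v" for v
    by (simp add: a0_part_eq case_prod_beta algebra_simps)
qed (use assms in \<open>simp_all add: exponent_Cons charge_def zmode_coeff_def case_prod_beta algebra_simps\<close>)

text \<open>
  The factors \<open>\<Lambda>\<^sup>+(q\<^sup>2 y z)\<close> and \<open>\<Lambda>\<^sup>-(y z)\<close> of one index are inverse to each other, likewise with
  all signs and the power of \<open>q\<close> inverted.
\<close>

lemma nord_cancel:
  assumes hs: "valid_factors hs" and s: "s \<in> {1, - 1}" and i: "i \<in> {1, 2}"
    and x: "x = q powi (2 * s) * y" and y: "y \<noteq> 0"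
  shows "nord R q l1 ((s, i, x) # (- s, i, y) # hs) n v = nord R q l1 hs n v"
proof (rule nord_cong)
  show "valid_factors ((s, i, x) # (- s, i, y) # hs)" using assms by (auto simp: valid_Cons)
  have q: "q \<noteq> 0" by (rule q_nonzero)
  have "fcoeff (s, i, x) n + fcoeff (- s, i, y) n = 0" for n
  proof -
    have "q powi (s * n) * x powi (- n) = q powi (s * n) * (q powi (2 * s * - n) * y powi (- n))"
      unfolding x by (simp only: power_int_mult_distrib power_int_mult)
    also have "\<dots> = q powi (- s * n) * y powi (- n)"
    proof -
      have "s * n + 2 * s * - n = - s * n" by (simp add: algebra_simps)
      then show ?thesis using power_int_add[of q "s * n" "2 * s * - n"] q by (simp only: mult.assoc simp_thms)
    qed
    finally show ?thesis by (simp add: fcoeff_def)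
  qed
  then show "exponent ((s, i, x) # (- s, i, y) # hs) n v = exponent hs n v" for n v
    by (simp add: exponent_Cons flip: add.assoc scale_left_distrib)
  show "expQ_part ((s, i, x) # (- s, i, y) # hs) v = expQ_part hs v" for v
    using s inv_expQi[OF i] by (auto simp: expQ_part_Cons)
  show "a0_part ((s, i, x) # (- s, i, y) # hs) v = a0_part hs v" for v
    by (simp add: a0_part_eq)
  show "charge ((s, i, x) # (- s, i, y) # hs) = charge hs"
    by (simp add: charge_Cons)
  have xy: "q powi (- s) * x = q powi s * y"
    unfolding x using q by (simp flip: power_int_add mult.assoc)
  show "zmode_coeff q ((s, i, x) # (- s, i, y) # hs) \<mu> = zmode_coeff q hs \<mu>" for \<mu>
  proof -
    have "q powi s * y \<noteq> 0" using q y by simp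
    then have "(q powi s * y) powi (s * index_sign i * \<mu>) * (q powi s * y) powi (- s * index_sign i * \<mu>) = 1"
      by (simp flip: power_int_add)
    then show ?thesis unfolding zmode_coeff_Cons xy by (simp flip: mult.assoc)
  qed
qed (rule hs)

lemma nord_rescale:
  assumes fs: "valid_factors fs" and c: "c \<noteq> 0"
  shows "nord R q l1 (rescale_factors c fs) n v = smul R (c powi n) (nord R q l1 fs n v)"
proof (rule weight_ext[where X = "nord R q l1 (rescale_factors c fs) n"])
  have fs': "valid_factors (rescale_factors c fs)" using fs by (simp add: valid_rescale)
  show "lin (nord R q l1 (rescale_factors c fs) n)" by (rule lin_nord[OF fs'])
  show "lin (\<lambda>v. smul R (c powi n) (nord R q l1 fs n v))" by (rule lin_smul[OF lin_nord[OF fs]])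
  fix \<mu> v assume v: "weight \<mu> v"
  have "smul R (c powi (charge fs * \<mu>)) (creation (rescale_factors c fs) (n - charge fs * \<mu> - k)
       (expQ_part fs (a0_part fs (annihilation (rescale_factors c fs) k v)))) =
     smul R (c powi n) (creation fs (n - charge fs * \<mu> - k) (expQ_part fs (a0_part fs (annihilation fs k v))))" for k
  proof -
    have "c powi n = c powi (charge fs * \<mu>) * (c powi (n - charge fs * \<mu> - k) * c powi k)"
      using c by (simp flip: power_int_add)
    then show ?thesis
      by (simp add: creation_rescale[OF fs] annihilation_rescale[OF fs] lin_scale[OF lin_a0_part] lin_scale[OF lin_expQ_part[OF fs]]
         lin_scale[OF lin_creation[OF fs]])
  qed
  then show "nord R q l1 (rescale_factors c fs) n v = smul R (c powi n) (nord R q l1 fs n v)"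
    unfolding nord_weight[OF fs' v] nord_weight[OF fs v]
    by (simp add: charge_rescale expQ_part_rescale a0_part_rescale zmode_coeff_rescale[OF c] smul_Sum_any mult.commute
        scale_left_commute flip: scale_scale)
qed

end

section \<open>Action of rational functions on sequences\<close>

lemma fps_Exp_minus_log_log:
  "fps_Exp (- fps_log a - fps_log b) = 1 - fps_const (a + b) * fps_X + fps_const (a * b) * (fps_X * fps_X)"
proof -
  have "fps_Exp (- fps_log a - fps_log b) = fps_Exp (- fps_log a) * fps_Exp (- fps_log b)"
    using fps_Exp_add[of "- fps_log a" "- fps_log b"] by simp
  also have "\<dots> = 1 - (fps_const a + fps_const b) * fps_X + (fps_const a * fps_const b) * (fps_X * fps_X)"
    unfolding fps_Exp_minus_log by (simp only: algebra_simps mult_1_left mult_1_right)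
  finally show ?thesis by simp
qed

context heisenberg_module
begin

lemma act_minus_log_log:
  assumes P: "bounded_below P"
  shows "act (fps_Exp (- fps_log a - fps_log b)) P k =
    P k - smul R (a + b) (P (k - 1)) + smul R (a * b) (P (k - 2))"
proof -
  have 1: "act 1 P k = P k" for k using act_const[of 1 P k] by simp
  have X: "act fps_X P k = P (k - 1)" for k using act_X_mult[OF P, of 1 k] 1 by simp
  show ?thesis
    unfolding fps_Exp_minus_log_log
    by (simp add: act_add[OF P] act_diff[OF P] act_const_mult act_X_mult[OF P] 1 X del: fps_const_add fps_const_mult)
qed

text \<open>
  From \<open>1 / (1 - u x) = 1 + u x / (1 - u x)\<close>.
\<close>

lemma act_geometric_step:
  assumes P: "bounded_below P"
  shows "act (fps_geometric u) P k = P k + smul R u (act (fps_geometric u) P (k - 1))"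
proof -
  have "fps_geometric u = 1 + fps_const u * (fps_X * fps_geometric u)"
    using fps_geometric_inverse[of u] by (simp add: algebra_simps)
  then have "act (fps_geometric u) P k = act (1 + fps_const u * (fps_X * fps_geometric u)) P k" by simp
  also have "\<dots> = P k + smul R u (act (fps_geometric u) P (k - 1))"
    using act_const[of 1 P k] by (simp add: act_add[OF P] act_const_mult act_X_mult[OF P])
  finally show ?thesis .
qed

lemma act_log_diff:
  assumes P: "bounded_below P" and u: "u \<noteq> 0"
  shows "act (fps_Exp (fps_log u - fps_log w)) P k =
     smul R (w / u) (P k) + smul R (1 - w / u) (act (fps_geometric u) P k)"
  unfolding fps_Exp_log_diff[OF u] act_add[OF P] act_const_mult act_const ..

lemma act_log_log:
  assumes P: "bounded_below P" and u: "u \<noteq> t"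
  shows "act (fps_Exp (fps_log u + fps_log t)) P k =
     smul R (u / (u - t)) (act (fps_geometric u) P k) - smul R (t / (u - t)) (act (fps_geometric t) P k)"
  unfolding fps_Exp_log_log[OF u] act_diff[OF P] act_const_mult ..

text \<open>
  Partial fractions of \<open>x\<^sup>2 / ((1 - u x) (1 - t x))\<close>; the factor \<open>x\<^sup>2\<close> adds the constant term
  \<open>1 / (u t)\<close>.
\<close>

lemma act_log_log_shift:
  assumes P: "bounded_below P" and u: "u \<noteq> t" "u \<noteq> 0" "t \<noteq> 0"
  shows "act (fps_Exp (fps_log u + fps_log t)) P (k - 2) = smul R (1 / (u * t)) (P k)
     + smul R (1 / (u * (u - t))) (act (fps_geometric u) P k) - smul R (1 / (t * (u - t))) (act (fps_geometric t) P k)"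
proof -
  have G: "smul R (w * w) (act (fps_geometric w) P (k - 2)) = act (fps_geometric w) P k - P k - smul R w (P (k - 1))" for w
    using act_geometric_step[OF P, of w k] act_geometric_step[OF P, of w "k - 1"]
    by (simp add: scale_right_distrib)
  have "smul R (w / (u - t)) (act (fps_geometric w) P (k - 2)) =
     smul R (1 / (w * (u - t))) (act (fps_geometric w) P k - P k - smul R w (P (k - 1)))" if "w \<noteq> 0" for w
    unfolding G[symmetric] using that by simp
  from this[OF u(2)] this[OF u(3)]
  have "act (fps_Exp (fps_log u + fps_log t)) P (k - 2) =
     smul R (1 / (u * (u - t))) (act (fps_geometric u) P k - P k - smul R u (P (k - 1))) -
     smul R (1 / (t * (u - t))) (act (fps_geometric t) P k - P k - smul R t (P (k - 1)))"
    by (simp only: act_log_log[OF P u(1)])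
  also have "\<dots> = smul R (1 / (t * (u - t)) - 1 / (u * (u - t))) (P k)
     + smul R (1 / (u * (u - t))) (act (fps_geometric u) P k) - smul R (1 / (t * (u - t))) (act (fps_geometric t) P k)"
    using u by (simp add: scale_right_diff_distrib scale_left_diff_distrib)
  also have "1 / (t * (u - t)) - 1 / (u * (u - t)) = 1 / (u * t)"
    using u by (simp add: divide_simps)
  finally show ?thesis .
qed

lemma lower_truncated_smul: "lower_truncated A \<Longrightarrow> lower_truncated (\<lambda>n v. smul R c (A n v))"
  unfolding lower_truncated_def by (metis scale_zero_right)

lemma lower_truncated_shift: "lower_truncated A \<Longrightarrow> lower_truncated (\<lambda>n. A (n - m))"
  unfolding lower_truncated_def by (metis diff_less_eq)

lemma lower_truncated_add: "lower_truncated A \<Longrightarrow> lower_truncated B \<Longrightarrow> lower_truncated (\<lambda>n v. A n v + B n v)"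
  unfolding lower_truncated_def by (metis add_0 min_less_iff_conj)

end

section \<open>The contractions of the two currents\<close>

text \<open>
  The two relations of the theorem, with two choices of sign each, are instances of one relation. Here
  \<open>i\<close> is the index of the current that is multiplied with \<open>\<T>\<close> and \<open>j\<close> the other index, \<open>\<sigma>\<close> is the sign,
  \<open>\<xi>\<close> is the parameter of \<open>\<T>\<close> and \<open>\<eta>\<close> the one of \<open>q\<^sub>1\<^sup>\<sigma>\<close>, \<open>q\<^sub>3\<^sup>\<sigma>\<close> that \<open>\<xi>\<close> is not. All signs of
  factors are written relative to \<open>\<sigma>\<close>, and \<open>p = q\<^sup>\<sigma>\<close>; then \<open>\<sigma>\<close> disappears from the scalar
  computations.
\<close>

locale current_pair = heisenberg_module R q d l1 l3
  for R :: "('v::ab_group_add) heis" and q d l1 l3 :: complex +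
  fixes \<sigma> :: int and i j :: nat and \<xi> \<eta> :: complex
  assumes sigma: "\<sigma> \<in> {1, - 1}"
    and i: "i \<in> {1, 2}" and j: "j \<in> {1, 2}" and i_neq_j: "i \<noteq> j"
    and parameters: "{\<xi>, \<eta>} = {q1 q d powi \<sigma>, q3 q d powi \<sigma>}"
begin

definition p :: complex where "p = q powi \<sigma>"

text \<open>
  The coefficients of the commutators of \<open>h\<^sub>1\<close> and \<open>h\<^sub>2\<close>, up to the factor \<open>- n\<close>. The denominator is nonzero
  since \<open>q\<close> is not a root of unity.
\<close>

definition cross :: "nat \<Rightarrow> complex" where
  "cross n = (q1 q d ^ n + q3 q d ^ n) / (1 + q2 q powi (- int n))"

lemma d_nonzero: "d \<noteq> 0"
  using generic by (simp add: generic_def)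

lemma p_nonzero: "p \<noteq> 0"
  using q_nonzero by (simp add: p_def)

lemma power_set_sum: "{\<xi>, \<eta>} = {a, b} \<Longrightarrow> \<xi> ^ n + \<eta> ^ n = a ^ n + b ^ n"
  by (auto simp: doubleton_eq_iff)

lemma power_set_prod: "{\<xi>, \<eta>} = {a, b} \<Longrightarrow> \<xi> * \<eta> = a * b"
  by (auto simp: doubleton_eq_iff)

lemma xi_nonzero: "\<xi> \<noteq> 0" and eta_nonzero: "\<eta> \<noteq> 0"
  using parameters q_nonzero d_nonzero by (auto simp: doubleton_eq_iff q1_def q3_def)

lemma q1_q3: "q1 q d * q3 q d * q\<^sup>2 = 1"
  using q_nonzero d_nonzero by (simp add: q1_def q3_def power2_eq_square field_simps)

lemma xi_eta: "\<xi> * \<eta> * p\<^sup>2 = 1"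
proof -
  have "\<xi> * \<eta> * p\<^sup>2 = (q1 q d * q3 q d * q\<^sup>2) powi \<sigma>"
    unfolding power_set_prod[OF parameters] p_def
    by (simp add: power_int_mult_distrib power2_eq_square)
  then show ?thesis by (simp add: q1_q3)
qed

lemma p2_neq_1: "p\<^sup>2 \<noteq> 1"
proof -
  have "(\<sigma> * 2, 0) \<noteq> (0, 0 :: int)" using sigma by auto
  then have "q powi (\<sigma> * 2) * d powi 0 \<noteq> 1" using generic unfolding generic_def by blast
  moreover have "q powi (\<sigma> * 2) = p\<^sup>2" by (simp add: p_def power_int_mult)
  ultimately show ?thesis by simp
qed

lemma cross_denominator: "1 + q2 q powi (- int n) \<noteq> 0"
proof
  assume *: "1 + q2 q powi (- int n) = 0"
  then have "n \<noteq> 0" by (intro notI) simp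
  have "q powi (2 * (- int n) * 2) = ((q powi 2) powi (- int n)) powi 2"
    by (simp only: power_int_mult)
  also have "\<dots> = (q2 q powi (- int n)) ^ 2" by (simp add: q2_def)
  also have "\<dots> = (- 1) ^ 2" using * by (simp add: add_eq_0_iff)
  finally have "q powi (2 * (- int n) * 2) * d powi 0 = 1" by simp
  moreover have "(2 * (- int n) * 2, 0 :: int) \<noteq> (0, 0)" using \<open>n \<noteq> 0\<close> by simp
  ultimately show False using generic unfolding generic_def by blast
qed

text \<open>
  The relation that makes all products rational. For both signs \<open>\<sigma>\<close> it has the form
  \<open>c\<^sub>n (1 + p\<^sup>-\<^sup>2\<^sup>n) = \<xi>\<^sup>n + \<eta>\<^sup>n\<close>, for \<open>\<sigma> = - 1\<close> because \<open>q\<^sub>1 q\<^sub>3 = q\<^sup>-\<^sup>2\<close>; the second form follows from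
  \<open>\<xi> \<eta> p\<^sup>2 = 1\<close>.
\<close>

lemma cross_inverse: "cross n * inverse (p ^ (2 * n)) = \<xi> ^ n + \<eta> ^ n - cross n"
  and cross_power: "cross n * p ^ (2 * n) = inverse \<xi> ^ n + inverse \<eta> ^ n - cross n"
proof -
  have c: "cross n * (1 + q2 q powi (- int n)) = q1 q d ^ n + q3 q d ^ n"
    using cross_denominator[of n] by (simp add: cross_def)
  have Q: "q2 q powi (- int n) = inverse (q ^ (2 * n))"
    by (simp add: q2_def power_int_minus power_mult)
  have prod: "q1 q d ^ n * q3 q d ^ n * q ^ (2 * n) = 1"
  proof -
    have "(q1 q d * q3 q d * q\<^sup>2) ^ n = 1" by (simp add: q1_q3)
    then show ?thesis by (simp add: power_mult_distrib power_mult)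
  qed
  have nz: "q1 q d \<noteq> 0" "q3 q d \<noteq> 0" using q_nonzero d_nonzero by (auto simp: q1_def q3_def)
  have pe: "\<xi> ^ n * \<eta> ^ n * p ^ (2 * n) = 1"
    using xi_eta by (metis power_mult power_mult_distrib power_one)
  have main: "cross n * (1 + inverse (p ^ (2 * n))) = \<xi> ^ n + \<eta> ^ n"
  proof (cases "\<sigma> = 1")
    case True
    then have "p = q" unfolding p_def by simp
    moreover have "\<xi> ^ n + \<eta> ^ n = q1 q d ^ n + q3 q d ^ n"
      using power_set_sum[OF parameters, of n] True by simp
    ultimately show ?thesis using c Q by simp
  next
    case False
    then have s: "\<sigma> = - 1" using sigma by simp
    then have p: "p = inverse q" unfolding p_def by simp
    have "\<xi> ^ n + \<eta> ^ n = inverse (q1 q d ^ n) + inverse (q3 q d ^ n)"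
      using power_set_sum[OF parameters, of n] by (simp add: s power_int_minus power_inverse)
    also have "\<dots> = (q1 q d ^ n + q3 q d ^ n) * q ^ (2 * n)"
      using prod nz by (simp add: field_simps)
    also have "\<dots> = cross n * (1 + inverse (p ^ (2 * n)))"
      unfolding c[symmetric] Q p using q_nonzero by (simp add: power_inverse field_simps)
    finally show ?thesis ..
  qed
  then show "cross n * inverse (p ^ (2 * n)) = \<xi> ^ n + \<eta> ^ n - cross n" by (simp add: algebra_simps)
  have "cross n * (1 + p ^ (2 * n)) = (\<xi> ^ n + \<eta> ^ n) * p ^ (2 * n)"
    unfolding main[symmetric] using p_nonzero by (simp add: field_simps)
  also have "\<dots> = inverse \<xi> ^ n + inverse \<eta> ^ n"
    using pe xi_nonzero eta_nonzero by (simp add: power_inverse field_simps)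
  finally show "cross n * p ^ (2 * n) = inverse \<xi> ^ n + inverse \<eta> ^ n - cross n" by (simp add: algebra_simps)
qed

text \<open>
  The factor lists of a summand of \<open>W\<^sub>i\<close> and of a summand of \<open>\<T>\<close>.
\<close>

definition W_factors :: "int \<Rightarrow> factor list" where
  "W_factors s = [(\<sigma> * s, i, 1)]"

definition T_factors :: "int \<Rightarrow> int \<Rightarrow> factor list" where
  "T_factors a b = [(\<sigma> * a, i, \<xi>), (\<sigma> * b, j, 1)]"

lemma valid_W_factors: "s \<in> {1, - 1} \<Longrightarrow> valid_factors (W_factors s)"
  using sigma i by (auto simp: W_factors_def valid_factors_def)

lemma valid_T_factors: "a \<in> {1, - 1} \<Longrightarrow> b \<in> {1, - 1} \<Longrightarrow> valid_factors (T_factors a b)"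
  using sigma i j by (auto simp: T_factors_def valid_factors_def)

lemma nonzero_W_factors: "nonzero_factors (W_factors s)" and nonzero_T_factors: "nonzero_factors (T_factors a b)"
  using xi_nonzero by (simp_all add: W_factors_def T_factors_def nonzero_factors_def)

lemma sigma_sigma: "\<sigma> * (\<sigma> * m) = m" "of_int \<sigma> * (of_int \<sigma> * x) = (x::complex)"
  using sigma by auto

lemma index_sign_i_j: "index_sign j = - index_sign i" "index_sign i * (index_sign i * m) = m"
  using i j i_neq_j by (auto simp: index_sign_def)

lemma charge_W_factors: "charge (W_factors s) = \<sigma> * (s * index_sign i)"
  by (simp add: W_factors_def charge_Cons charge_Nil)

lemma charge_T_factors: "charge (T_factors a b) = \<sigma> * (index_sign i * (a - b))"
  by (simp add: T_factors_def charge_Cons charge_Nil index_sign_i_j algebra_simps)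

lemma charge_W_factors_T_factors: "charge (W_factors s) * charge (T_factors a b) = s * (a - b)"
proof -
  have "charge (W_factors s) * charge (T_factors a b) = (\<sigma> * (\<sigma> * 1)) * (index_sign i * (index_sign i * 1)) * (s * (a - b))"
    by (simp only: charge_W_factors charge_T_factors mult_ac mult_1)
  then show ?thesis by (simp only: sigma_sigma index_sign_i_j mult_1)
qed

lemma q_powi: "q powi (\<sigma> * m) = p powi m"
  by (simp add: p_def power_int_mult)

text \<open>
  Together with \<open>charge_W_factors_T_factors\<close> this says that moving the zero modes of the first factor to the
  right gives \<open>(p\<^sup>-\<^sup>s z)\<^sup>s\<^sup>(\<^sup>a\<^sup>-\<^sup>b\<^sup>)\<close>; in the opposite order it is \<open>(\<xi> w)\<^sup>a\<^sup>s w\<^sup>-\<^sup>b\<^sup>s\<close>.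
\<close>

lemma zmode_coeff_W_factors:
  assumes "s \<in> {1, - 1}"
  shows "zmode_coeff q (W_factors s) (charge (T_factors a b)) = p powi (b - a)"
proof -
  have "\<sigma> * s * index_sign i * charge (T_factors a b) = s * (a - b)"
    using charge_W_factors_T_factors[of s a b] by (simp add: charge_W_factors mult.assoc)
  then have "zmode_coeff q (W_factors s) (charge (T_factors a b)) = (q powi (\<sigma> * - s)) powi (s * (a - b))"
    by (simp only: W_factors_def zmode_coeff_Cons zmode_coeff_Nil mult_1_right mult_minus_right)
  also have "\<dots> = p powi (- s * (s * (a - b)))"
    by (simp only: q_powi power_int_mult[symmetric])
  also have "- s * (s * (a - b)) = b - a" using assms by auto
  finally show ?thesis .
qed

lemma zmode_coeff_T_factors:
  assumes "s \<in> {1, - 1}" "a \<in> {1, - 1}" "b \<in> {1, - 1}"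
  shows "zmode_coeff q (T_factors a b) (charge (W_factors s)) = \<xi> powi (a * s)"
proof -
  have 1: "\<sigma> * a * index_sign i * charge (W_factors s) = a * s"
    using index_sign_i_j(2)[of "a * s"] sigma by (auto simp: charge_W_factors algebra_simps)
  have 2: "\<sigma> * b * index_sign j * charge (W_factors s) = - (b * s)"
    using index_sign_i_j(2)[of "b * s"] sigma by (auto simp: charge_W_factors index_sign_i_j algebra_simps)
  have "zmode_coeff q (T_factors a b) (charge (W_factors s)) = (q powi (\<sigma> * - a) * \<xi>) powi (a * s) * (q powi (\<sigma> * - b)) powi (- (b * s))"
    unfolding T_factors_def zmode_coeff_Cons zmode_coeff_Nil 1 2 mult_1_right mult_minus_right ..
  also have "\<dots> = p powi (- a * (a * s)) * p powi (- b * - (b * s)) * \<xi> powi (a * s)"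
    by (simp only: q_powi power_int_mult_distrib power_int_mult[symmetric]) (simp only: mult_ac)
  also have "\<dots> = \<xi> powi (a * s)"
    using assms p_nonzero by (auto simp flip: power_int_add)
  finally show ?thesis .
qed

lemma fcoeff_sigma: "fcoeff (\<sigma> * s, k, x) m = - of_int (\<sigma> * s) * (p powi (s * m) / of_int m) * x powi (- m)"
  by (simp add: fcoeff_def mult.assoc q_powi flip: power_int_mult)

lemma contraction_W_factors_T_factors:
  assumes "n > 0"
  shows "contraction (W_factors s) (T_factors a b) (int n) = (of_int (s * b) * p powi ((s - b) * int n) * cross n
     - of_int (s * a) * p powi ((s - a) * int n) * \<xi> ^ n) / of_nat n"
proof -
  have P: "p powi ((s - a) * int n) = p powi (s * int n) * p powi (a * - int n)" for s a
    using p_nonzero by (simp add: algebra_simps flip: power_int_add)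
  have h: "hcomm i i (int n) = of_nat n" "hcomm i j (int n) = - of_nat n * cross n"
    using i_neq_j by (simp_all add: hcomm_def cross_def)
  show ?thesis
    unfolding contraction_def W_factors_def T_factors_def P using assms
    by (simp add: fcoeff_sigma h) (simp add: field_simps sigma_sigma)
qed

lemma contraction_T_factors_W_factors:
  assumes "n > 0"
  shows "contraction (T_factors a b) (W_factors s) (int n) = (of_int (b * s) * p powi ((b - s) * int n) * cross n
     - of_int (a * s) * p powi ((a - s) * int n) * inverse \<xi> ^ n) / of_nat n"
proof -
  have P: "p powi ((s - a) * int n) = p powi (s * int n) * p powi (a * - int n)" for s a
    using p_nonzero by (simp add: algebra_simps flip: power_int_add)
  have h: "hcomm i i (int n) = of_nat n" "hcomm j i (int n) = - of_nat n * cross n"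
    using i_neq_j by (simp_all add: hcomm_def cross_def)
  show ?thesis
    unfolding contraction_def W_factors_def T_factors_def P using assms
    by (simp add: fcoeff_sigma h power_int_minus power_inverse) (simp add: field_simps sigma_sigma)
qed

text \<open>
  Logarithms of the products of the structure function and the contraction: \<open>zw_exponent\<close> is a series in
  \<open>w/z\<close> for \<open>f(\<xi>; w/z)\<close>, and \<open>wz_exponent\<close> a series in \<open>z/w\<close> for \<open>f(\<xi>\<^sup>-\<^sup>1; z/w)\<close>.
\<close>

definition zw_exponent :: "int \<Rightarrow> int \<Rightarrow> int \<Rightarrow> complex fps" where
  "zw_exponent s a b = Abs_fps (\<lambda>n. (\<xi> ^ n - cross n + of_int (s * b) * p powi ((s - b) * int n) * cross n
     - of_int (s * a) * p powi ((s - a) * int n) * \<xi> ^ n) / of_nat n)"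

definition wz_exponent :: "int \<Rightarrow> int \<Rightarrow> int \<Rightarrow> complex fps" where
  "wz_exponent s a b = Abs_fps (\<lambda>n. (inverse \<xi> ^ n - cross n + of_int (b * s) * p powi ((b - s) * int n) * cross n
     - of_int (a * s) * p powi ((a - s) * int n) * inverse \<xi> ^ n) / of_nat n)"

lemma struct_fun_Exp: "struct_fun q d x = fps_Exp (Abs_fps (\<lambda>n. (x ^ n - cross n) / of_nat n))"
proof -
  have "(if n = 0 then 0 else (x ^ n - (q1 q d ^ n + q3 q d ^ n) / (1 + q2 q powi (- int n))) / of_nat n) =
    (x ^ n - cross n) / of_nat n" for n
    by (simp add: cross_def)
  then show ?thesis by (simp add: struct_fun_def)
qed

lemma struct_fun_contraction_zw:
  "struct_fun q d \<xi> * fps_Exp (contraction_fps (W_factors s) (T_factors a b)) = fps_Exp (zw_exponent s a b)"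
proof -
  have "zw_exponent s a b = Abs_fps (\<lambda>n. (\<xi> ^ n - cross n) / of_nat n) + contraction_fps (W_factors s) (T_factors a b)"
  proof (rule fps_ext)
    fix n
    show "zw_exponent s a b $ n = (Abs_fps (\<lambda>n. (\<xi> ^ n - cross n) / of_nat n) + contraction_fps (W_factors s) (T_factors a b)) $ n"
      using contraction_W_factors_T_factors[of n s a b] contraction_fps_0[of "W_factors s" "T_factors a b"]
      by (cases "n = 0") (simp_all add: zw_exponent_def contraction_fps_def add_divide_distrib diff_divide_distrib)
  qed
  then show ?thesis by (simp add: struct_fun_Exp fps_Exp_add contraction_fps_0)
qed

lemma struct_fun_contraction_wz:
  "struct_fun q d (inverse \<xi>) * fps_Exp (contraction_fps (T_factors a b) (W_factors s)) = fps_Exp (wz_exponent s a b)"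
proof -
  have "wz_exponent s a b = Abs_fps (\<lambda>n. (inverse \<xi> ^ n - cross n) / of_nat n) + contraction_fps (T_factors a b) (W_factors s)"
  proof (rule fps_ext)
    fix n
    show "wz_exponent s a b $ n = (Abs_fps (\<lambda>n. (inverse \<xi> ^ n - cross n) / of_nat n) + contraction_fps (T_factors a b) (W_factors s)) $ n"
      using contraction_T_factors_W_factors[of n a b s] contraction_fps_0[of "T_factors a b" "W_factors s"]
      by (cases "n = 0") (simp_all add: wz_exponent_def contraction_fps_def add_divide_distrib diff_divide_distrib)
  qed
  then show ?thesis by (simp add: struct_fun_Exp fps_Exp_add contraction_fps_0)
qed

text \<open>
  The value of \<open>z/w\<close> at which a factor of sign \<open>- \<sigma>\<close> in \<open>z\<close> cancels the factor of sign \<open>\<sigma>\<close> in \<open>\<xi> w\<close>.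
\<close>

abbreviation t :: complex where "t \<equiv> \<xi> * inverse (p\<^sup>2)"

lemma t_nonzero: "t \<noteq> 0"
  using xi_nonzero p_nonzero by simp

lemma t_power: "t ^ n = \<xi> ^ n * inverse (p ^ (2 * n))"
  by (simp add: power_mult_distrib power_mult power_inverse)

lemma p_powi_2: "p powi (2 * int n) = p ^ (2 * n)" "p powi (- (2 * int n)) = inverse (p ^ (2 * n))"
  by (simp_all add: power_int_minus power_int_def nat_mult_distrib power_inverse)

lemma power_relations:
  "\<xi> ^ n * p ^ (2 * n) = inverse \<eta> ^ n"
  "inverse \<xi> ^ n * inverse (p ^ (2 * n)) = \<eta> ^ n"
  "inverse \<xi> ^ n * p ^ (2 * n) = inverse t ^ n"
proof -
  have pe: "\<xi> ^ n * \<eta> ^ n * p ^ (2 * n) = 1"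
    using xi_eta by (metis power_mult power_mult_distrib power_one)
  then show "\<xi> ^ n * p ^ (2 * n) = inverse \<eta> ^ n" "inverse \<xi> ^ n * inverse (p ^ (2 * n)) = \<eta> ^ n"
    using xi_nonzero eta_nonzero p_nonzero by (simp_all add: power_inverse field_simps)
  show "inverse \<xi> ^ n * p ^ (2 * n) = inverse t ^ n"
    using p_nonzero by (simp add: power_mult_distrib power_mult power_inverse)
qed

lemma numerator_simps:
  "inverse (p ^ (2 * n)) * cross n = \<xi> ^ n + \<eta> ^ n - cross n"
  "p ^ (2 * n) * cross n = inverse \<xi> ^ n + inverse \<eta> ^ n - cross n"
  "p ^ (2 * n) * \<xi> ^ n = inverse \<eta> ^ n"
  "inverse (p ^ (2 * n)) * inverse \<xi> ^ n = \<eta> ^ n"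
  "p ^ (2 * n) * inverse \<xi> ^ n = inverse t ^ n"
  "inverse (p ^ (2 * n)) * \<xi> ^ n = t ^ n"
  using cross_inverse[of n] cross_power[of n] power_relations[of n] t_power[of n]
  by (simp_all only: mult.commute)

text \<open>
  The rational functions of \<open>x = w/z\<close> for the six products, as logarithms: \<open>1\<close>, \<open>1\<close>,
  \<open>(1 - \<xi>\<^sup>-\<^sup>1 x) (1 - \<eta>\<^sup>-\<^sup>1 x)\<close>, \<open>(1 - \<eta> x) / (1 - t x)\<close>, \<open>(1 - \<xi>\<^sup>-\<^sup>1 x) / (1 - \<xi> x)\<close> and
  \<open>1 / ((1 - \<xi> x) (1 - t x))\<close>.
\<close>

lemma zw_exponent_eqs:
  "zw_exponent 1 1 1 = 0" "zw_exponent (- 1) (- 1) (- 1) = 0"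
  "zw_exponent 1 1 (- 1) = - fps_log (inverse \<xi>) - fps_log (inverse \<eta>)"
  "zw_exponent (- 1) 1 1 = fps_log t - fps_log \<eta>"
  "zw_exponent 1 (- 1) (- 1) = fps_log \<xi> - fps_log (inverse \<xi>)"
  "zw_exponent (- 1) 1 (- 1) = fps_log \<xi> + fps_log t"
  by (rule fps_ext, simp add: zw_exponent_def p_powi_2 numerator_simps del: inverse_mult_distrib
      add: add_divide_distrib diff_divide_distrib)+

text \<open>
  The same functions in terms of \<open>z/w\<close>, up to a constant and a power of \<open>w/z\<close>, which are accounted for by
  the zero modes.
\<close>

lemma wz_exponent_eqs:
  "wz_exponent 1 1 1 = 0" "wz_exponent (- 1) (- 1) (- 1) = 0"
  "wz_exponent 1 1 (- 1) = - fps_log \<xi> - fps_log \<eta>"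
  "wz_exponent (- 1) 1 1 = fps_log (inverse t) - fps_log (inverse \<eta>)"
  "wz_exponent 1 (- 1) (- 1) = fps_log (inverse \<xi>) - fps_log \<xi>"
  "wz_exponent (- 1) 1 (- 1) = fps_log (inverse \<xi>) + fps_log (inverse t)"
  by (rule fps_ext, simp add: wz_exponent_def p_powi_2 numerator_simps del: inverse_mult_distrib
      add: add_divide_distrib diff_divide_distrib)+

end

section \<open>The poles of the six products\<close>

context current_pair
begin

text \<open>
  The contribution of one summand of \<open>W\<^sub>i\<close> and one summand of \<open>\<T>\<close> to the left side of the relation.
\<close>

definition term_difference :: "int \<Rightarrow> int \<Rightarrow> int \<Rightarrow> int \<Rightarrow> int \<Rightarrow> 'v \<Rightarrow> 'v" where
  "term_difference s a b m n v =
     smul R \<xi> (zw_product R (struct_fun q d \<xi>) (nord R q l1 (W_factors s)) (nord R q l1 (T_factors a b)) m n v)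
     - wz_product R (struct_fun q d (inverse \<xi>)) (nord R q l1 (T_factors a b)) (nord R q l1 (W_factors s)) m n v"

definition pair_coeff :: "int \<Rightarrow> int \<Rightarrow> int \<Rightarrow> int \<Rightarrow> int \<Rightarrow> 'v \<Rightarrow> int \<Rightarrow> 'v" where
  "pair_coeff s a b \<mu> T v k = nord_pair (W_factors s) (T_factors a b) \<mu> (T - k) k v"

context
  fixes s a b \<mu> :: int and v
  assumes s: "s \<in> {1, - 1}" and a: "a \<in> {1, - 1}" and b: "b \<in> {1, - 1}" and v: "weight \<mu> v"
begin

lemma pair_coeff_finite: "finite {k. pair_coeff s a b \<mu> T v k \<noteq> 0}"
  unfolding pair_coeff_def by (rule nord_pair_finite[OF valid_W_factors[OF s] valid_T_factors[OF a b]])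

lemma pair_coeff_bounded_below: "bounded_below (pair_coeff s a b \<mu> T v)"
  by (rule bounded_below_finite[OF pair_coeff_finite])

lemma pair_coeff_reflected_bounded_below: "bounded_below (\<lambda>k. pair_coeff s a b \<mu> T v (T - k))"
proof (rule bounded_below_finite)
  have "{k. pair_coeff s a b \<mu> T v (T - k) \<noteq> 0} \<subseteq> (\<lambda>k. T - k) ` {k. pair_coeff s a b \<mu> T v k \<noteq> 0}"
    by (auto intro: image_eqI[of _ _ "T - _"])
  then show "finite {k. pair_coeff s a b \<mu> T v (T - k) \<noteq> 0}" using pair_coeff_finite finite_surj by blast
qed

text \<open>
  Both orders act on the same Laurent polynomial \<open>pair_coeff\<close> of total degree \<open>T\<close>, one by a series in \<open>w/z\<close>
  and the other by a series in \<open>z/w\<close>.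
\<close>

lemma term_difference_eq:
  assumes T: "T = m + n - s * (a - b)"
  shows "term_difference s a b m n v =
    smul R (\<xi> * p powi (b - a)) (act (fps_Exp (zw_exponent s a b)) (pair_coeff s a b \<mu> T v) n)
    - smul R (\<xi> powi (a * s)) (act (fps_Exp (wz_exponent s a b)) (\<lambda>k. pair_coeff s a b \<mu> T v (T - k)) m)"
  unfolding term_difference_def zw_nord[OF valid_W_factors[OF s] valid_T_factors[OF a b] nonzero_W_factors v]
    wz_nord[OF valid_W_factors[OF s] valid_T_factors[OF a b] nonzero_T_factors v]
    struct_fun_contraction_zw struct_fun_contraction_wz charge_W_factors_T_factors zmode_coeff_W_factors[OF s] zmode_coeff_T_factors[OF s a b]
  by (simp add: T pair_coeff_def[abs_def])

lemma delta_term: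
  assumes c: "c \<noteq> 0"
  shows "act (fps_geometric c) (pair_coeff s a b \<mu> T v) n
     + act (fps_geometric (inverse c)) (\<lambda>k. pair_coeff s a b \<mu> T v (T - k)) (T - n) - pair_coeff s a b \<mu> T v n =
    smul R (c powi (n - T)) (nord R q l1 (rescale_factors c (W_factors s) @ T_factors a b) T v)"
proof -
  \<comment> \<open>The delta function evaluates in degree \<open>n\<close>, the fusion of the factors in degree \<open>T\<close>.\<close>
  have e: "c powi (n - k) = c powi (n - T) * c powi (T - k)" for k
    using c by (simp flip: power_int_add)
  have "Sum_any (\<lambda>k. smul R (c powi (n - k)) (pair_coeff s a b \<mu> T v k)) =
    smul R (c powi (n - T)) (nord R q l1 (rescale_factors c (W_factors s) @ T_factors a b) T v)"
    unfolding nord_pair_fusion[OF valid_W_factors[OF s] valid_T_factors[OF a b] v c, symmetric] smul_Sum_any scale_scale e[symmetric]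
    by (simp add: pair_coeff_def)
  then show ?thesis by (simp only: act_delta[OF pair_coeff_finite c])
qed

end

lemma rescale_W_factors: "rescale_factors c (W_factors s) @ T_factors a b = [(\<sigma> * s, i, c), (\<sigma> * a, i, \<xi>), (\<sigma> * b, j, 1)]"
  by (simp add: rescale_factors_def W_factors_def T_factors_def)

text \<open>
  The contraction cancels the structure function in both orders, and the factor \<open>\<xi>\<close> of the first order
  arises from the zero modes in the second.
\<close>

lemma regular_terms:
  assumes v: "weight \<mu> v" and s: "s \<in> {1, - 1}"
  shows "term_difference s s s m n v = 0"
proof -
  have D: "zw_exponent s s s = 0" "wz_exponent s s s = 0" using s zw_exponent_eqs wz_exponent_eqs by auto
  have "act 1 P k = P k" for P k using act_const[of 1 P k] by simp
  moreover have "\<xi> powi (s * s) = \<xi>" using s by auto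
  ultimately show ?thesis
    unfolding term_difference_eq[OF s s s v refl] D by simp
qed

text \<open>
  For both products with exactly one pole, \<open>\<xi>\<close> times the function of \<open>w/z\<close> is
  \<open>\<xi>\<^sup>-\<^sup>1 + (\<xi> - \<xi>\<^sup>-\<^sup>1) / (1 - c w/z)\<close>, and \<open>\<xi>\<^sup>-\<^sup>1\<close> times the function of
  \<open>z/w\<close> is \<open>\<xi> - (\<xi> - \<xi>\<^sup>-\<^sup>1) / (1 - c\<^sup>-\<^sup>1 z/w)\<close>. The difference of the constants is what completes the two geometric
  series to a delta function.
\<close>

lemma simple_pole:
  assumes P: "bounded_below P" "bounded_below (\<lambda>k. P (T - k))" and c: "c \<noteq> 0"
    and zw: "fps_Exp (zw_exponent s a b) = fps_Exp (fps_log c - fps_log (c * (inverse \<xi>)\<^sup>2))"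
    and wz: "fps_Exp (wz_exponent s a b) = fps_Exp (fps_log (inverse c) - fps_log (inverse c * \<xi>\<^sup>2))"
  shows "smul R \<xi> (act (fps_Exp (zw_exponent s a b)) P n)
      - smul R (inverse \<xi>) (act (fps_Exp (wz_exponent s a b)) (\<lambda>k. P (T - k)) (T - n)) =
    smul R (\<xi> - inverse \<xi>) (act (fps_geometric c) P n
      + act (fps_geometric (inverse c)) (\<lambda>k. P (T - k)) (T - n) - P n)"
proof -
  define Z where "Z = act (fps_geometric c) P n"
  define W where "W = act (fps_geometric (inverse c)) (\<lambda>k. P (T - k)) (T - n)"
  have "smul R \<xi> (act (fps_Exp (zw_exponent s a b)) P n) = smul R (inverse \<xi>) (P n) + smul R (\<xi> - inverse \<xi>) Z"
    unfolding zw act_log_diff[OF P(1) c] Z_def[symmetric] using c xi_nonzero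
    by (simp add: scale_right_distrib right_diff_distrib power2_eq_square field_simps)
  moreover have "smul R (inverse \<xi>) (act (fps_Exp (wz_exponent s a b)) (\<lambda>k. P (T - k)) (T - n)) =
      smul R \<xi> (P n) + smul R (inverse \<xi> - \<xi>) W"
  proof -
    have c': "inverse c \<noteq> 0" using c by simp
    have "inverse c * \<xi>\<^sup>2 / inverse c = \<xi>\<^sup>2" using c by simp
    moreover have "inverse \<xi> * \<xi>\<^sup>2 = \<xi>" "inverse \<xi> * (1 - \<xi>\<^sup>2) = inverse \<xi> - \<xi>"
      using xi_nonzero by (simp_all add: power2_eq_square field_simps)
    ultimately show ?thesis
      unfolding wz act_log_diff[OF P(2) c'] W_def[symmetric]
      by (simp only: scale_right_distrib scale_scale) simp
  qed
  ultimately show ?thesis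
    unfolding Z_def[symmetric] W_def[symmetric]
    by (simp add: scale_left_diff_distrib scale_right_diff_distrib scale_right_distrib)
qed

lemma eta_eq: "\<eta> = inverse \<xi> * inverse (p\<^sup>2)"
  using xi_eta xi_nonzero p_nonzero by (simp add: field_simps)

text \<open>
  At \<open>z = t w\<close> the factors of index \<open>i\<close> cancel, which leaves one summand of \<open>W\<^sub>j\<close>.
\<close>

lemma pole_t_plus:
  assumes v: "weight \<mu> v"
  shows "term_difference (- 1) 1 1 m n v = smul R ((\<xi> - inverse \<xi>) * t powi (- m)) (nord R q l1 [(\<sigma>, j, 1)] (m + n) v)"
proof -
  let ?P = "pair_coeff (- 1) 1 1 \<mu> (m + n) v"
  have sg: "- 1 \<in> {1, - 1::int}" "1 \<in> {1, - 1::int}" by auto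
  note P = pair_coeff_bounded_below[OF sg(1,2,2) v] pair_coeff_reflected_bounded_below[OF sg(1,2,2) v]
  have e: "t * (inverse \<xi>)\<^sup>2 = \<eta>" "inverse t * \<xi>\<^sup>2 = inverse \<eta>"
    using xi_nonzero p_nonzero by (simp_all add: eta_eq power2_eq_square)
  have "term_difference (- 1) 1 1 m n v = smul R (\<xi> - inverse \<xi>)
    (smul R (t powi (n - (m + n))) (nord R q l1 (rescale_factors t (W_factors (- 1)) @ T_factors 1 1) (m + n) v))"
    unfolding delta_term[OF sg(1,2,2) v t_nonzero, symmetric]
    using term_difference_eq[OF sg(1,2,2) v, of "m + n" m n]
      simple_pole[of ?P "m + n" t "- 1" 1 1 n, OF P t_nonzero]
    by (simp add: zw_exponent_eqs wz_exponent_eqs e power_int_minus del: inverse_mult_distrib)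
  also have "nord R q l1 (rescale_factors t (W_factors (- 1)) @ T_factors 1 1) (m + n) v = nord R q l1 [(\<sigma>, j, 1)] (m + n) v"
    unfolding rescale_W_factors
    using nord_cancel[of "[(\<sigma>, j, 1)]" "- \<sigma>" i t \<xi> "m + n" v] sigma i j xi_nonzero
    by (auto simp: valid_factors_def p_def power_int_minus power2_eq_square power_int_mult_distrib mult.commute
        power_int_add_1)
  finally show ?thesis by simp
qed

text \<open>
  This residue is cancelled by one of the residues in \<open>double_pole\<close>.
\<close>

lemma pole_xi:
  assumes v: "weight \<mu> v"
  shows "term_difference 1 (- 1) (- 1) m n v = smul R ((\<xi> - inverse \<xi>) * \<xi> powi (- m))
    (nord R q l1 [(\<sigma>, i, \<xi>), (- \<sigma>, i, \<xi>), (- \<sigma>, j, 1)] (m + n) v)"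
proof -
  let ?P = "pair_coeff 1 (- 1) (- 1) \<mu> (m + n) v"
  have sg: "- 1 \<in> {1, - 1::int}" "1 \<in> {1, - 1::int}" by auto
  note P = pair_coeff_bounded_below[OF sg(2,1,1) v] pair_coeff_reflected_bounded_below[OF sg(2,1,1) v]
  have e: "\<xi> * (inverse \<xi>)\<^sup>2 = inverse \<xi>" "inverse \<xi> * \<xi>\<^sup>2 = \<xi>"
    using xi_nonzero by (simp_all add: power2_eq_square)
  have "term_difference 1 (- 1) (- 1) m n v = smul R (\<xi> - inverse \<xi>)
    (smul R (\<xi> powi (n - (m + n))) (nord R q l1 (rescale_factors \<xi> (W_factors 1) @ T_factors (- 1) (- 1)) (m + n) v))"
    unfolding delta_term[OF sg(2,1,1) v xi_nonzero, symmetric]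
    using term_difference_eq[OF sg(2,1,1) v, of "m + n" m n]
      simple_pole[of ?P "m + n" \<xi> 1 "- 1" "- 1" n, OF P xi_nonzero]
    by (simp add: zw_exponent_eqs wz_exponent_eqs e power_int_minus del: inverse_mult_distrib)
  then show ?thesis by (simp add: rescale_W_factors)
qed

text \<open>
  Both orders give the same Laurent polynomial,
  \<open>(z - \<xi>\<^sup>-\<^sup>1 w) (z - \<eta>\<^sup>-\<^sup>1 w)\<close> up to a constant and powers of the variables.
\<close>

lemma mixed_regular:
  assumes v: "weight \<mu> v"
  shows "term_difference 1 1 (- 1) m n v = 0"
proof -
  have sg: "- 1 \<in> {1, - 1::int}" "1 \<in> {1, - 1::int}" by auto
  define T where "T = m + n - 2"
  define P where "P = pair_coeff 1 1 (- 1) \<mu> T v"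
  have P: "bounded_below P" "bounded_below (\<lambda>k. P (T - k))"
    unfolding P_def by (rule pair_coeff_bounded_below[OF sg(2,2,1) v] pair_coeff_reflected_bounded_below[OF sg(2,2,1) v])+
  have idx: "T - m = n - 2" "T - (m - 1) = n - 1" "T - (m - 2) = n" by (simp_all add: T_def)
  have coeffs: "\<xi> * (\<xi> * \<eta>) * (inverse \<xi> + inverse \<eta>) = \<xi> * (\<xi> + \<eta>)"
    "\<xi> * (\<xi> * \<eta>) * (inverse \<xi> * inverse \<eta>) = \<xi>"
    using xi_nonzero eta_nonzero by (simp_all add: field_simps)
  have "term_difference 1 1 (- 1) m n v = smul R (\<xi> * p powi (- 2)) (act (fps_Exp (zw_exponent 1 1 (- 1))) P n)
    - smul R \<xi> (act (fps_Exp (wz_exponent 1 1 (- 1))) (\<lambda>k. P (T - k)) m)"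
    using term_difference_eq[OF sg(2,2,1) v, of T m n] by (simp add: T_def P_def)
  also have "p powi (- 2) = \<xi> * \<eta>"
    using xi_eta p_nonzero by (simp add: power_int_minus field_simps)
  finally show ?thesis
    unfolding zw_exponent_eqs wz_exponent_eqs act_minus_log_log[OF P(1)] act_minus_log_log[OF P(2)] idx
    by (simp only: scale_right_distrib scale_right_diff_distrib scale_scale coeffs) simp
qed

text \<open>
  The function is \<open>x\<^sup>2 / ((1 - \<xi> x) (1 - t x))\<close>. The factor \<open>C\<close> of the mixed term of \<open>\<T>\<close> cancels the
  denominators \<open>\<xi> - t\<close> of the partial fractions, and at both poles the residues become \<open>\<plusminus>(\<xi> - \<xi>\<^sup>-\<^sup>1)\<close>
  up to a power of \<open>p\<close>. The shift of \<open>n\<close> by \<open>2\<close> is the factor \<open>w\<^sup>2\<close> of the mixed term.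
\<close>

lemma double_pole:
  assumes v: "weight \<mu> v" and C: "C = (1 - \<xi>\<^sup>2) * (1 - inverse (p\<^sup>2))"
  shows "smul R (p * C) (term_difference (- 1) 1 (- 1) m (n - 2) v) =
     smul R (p * (\<xi> - inverse \<xi>) * t powi (- m)) (nord R q l1 [(- \<sigma>, j, 1)] (m + n) v)
   - smul R (inverse p * (\<xi> - inverse \<xi>) * \<xi> powi (- m))
      (nord R q l1 [(- \<sigma>, i, \<xi>), (\<sigma>, i, \<xi>), (- \<sigma>, j, 1)] (m + n) v)"
proof -
  have sg: "- 1 \<in> {1, - 1::int}" "1 \<in> {1, - 1::int}" by auto
  define T where "T = m + n"
  define P where "P = pair_coeff (- 1) 1 (- 1) \<mu> T v"
  define Zx where "Zx = act (fps_geometric \<xi>) P n"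
  define Zt where "Zt = act (fps_geometric t) P n"
  define Wx where "Wx = act (fps_geometric (inverse \<xi>)) (\<lambda>k. P (T - k)) m"
  define Wt where "Wt = act (fps_geometric (inverse t)) (\<lambda>k. P (T - k)) m"
  have P: "bounded_below P" "bounded_below (\<lambda>k. P (T - k))"
    unfolding P_def by (rule pair_coeff_bounded_below[OF sg(1,2,1) v] pair_coeff_reflected_bounded_below[OF sg(1,2,1) v])+
  have p2: "p\<^sup>2 - 1 \<noteq> 0" using p2_neq_1 by simp
  have neq: "\<xi> \<noteq> t" "inverse \<xi> \<noteq> inverse t"
    using xi_nonzero p_nonzero p2 by (auto simp: field_simps)
  let ?A = "p * (\<xi> - inverse \<xi>)" and ?B = "- (inverse p * (\<xi> - inverse \<xi>))"
  have d: "\<xi> - t = \<xi> * (p\<^sup>2 - 1) * inverse (p\<^sup>2)" "inverse \<xi> - inverse t = - inverse \<xi> * (p\<^sup>2 - 1)"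
  proof -
    show "\<xi> - t = \<xi> * (p\<^sup>2 - 1) * inverse (p\<^sup>2)" using p_nonzero by (simp add: field_simps)
    have "inverse t = inverse \<xi> * p\<^sup>2" by simp
    then show "inverse \<xi> - inverse t = - inverse \<xi> * (p\<^sup>2 - 1)" by (simp only: algebra_simps mult_1_right) simp
  qed
  have C': "C = (1 - \<xi>\<^sup>2) * (p\<^sup>2 - 1) * inverse (p\<^sup>2)"
    using p_nonzero by (simp add: C field_simps)
  have coeffs:
    "p * C * (\<xi> * inverse (p\<^sup>2)) * (1 / (\<xi> * t)) = - (?A + ?B)"
    "p * C * (\<xi> * inverse (p\<^sup>2)) * (1 / (\<xi> * (\<xi> - t))) = ?B"
    "p * C * (\<xi> * inverse (p\<^sup>2)) * (1 / (t * (\<xi> - t))) = - ?A"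
    "p * C * inverse \<xi> * (inverse \<xi> / (inverse \<xi> - inverse t)) = - ?B"
    "p * C * inverse \<xi> * (inverse t / (inverse \<xi> - inverse t)) = ?A"
    unfolding d C' using xi_nonzero p_nonzero p2
    by (simp_all add: divide_simps) (simp_all add: power2_eq_square power4_eq_xxxx algebra_simps)
  have "term_difference (- 1) 1 (- 1) m (n - 2) v =
    smul R (\<xi> * p powi (- 2)) (act (fps_Exp (fps_log \<xi> + fps_log t)) P (n - 2))
    - smul R (inverse \<xi>) (act (fps_Exp (fps_log (inverse \<xi>) + fps_log (inverse t))) (\<lambda>k. P (T - k)) m)"
    using term_difference_eq[OF sg(1,2,1) v, of T m "n - 2"]
    by (simp add: T_def P_def zw_exponent_eqs wz_exponent_eqs power_int_minus del: inverse_mult_distrib)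
  also have "p powi (- 2) = inverse (p\<^sup>2)" by (simp add: power_int_minus)
  finally have "smul R (p * C) (term_difference (- 1) 1 (- 1) m (n - 2) v) =
      smul R (p * C * (\<xi> * inverse (p\<^sup>2)) * (1 / (\<xi> * t))) (P n)
    + smul R (p * C * (\<xi> * inverse (p\<^sup>2)) * (1 / (\<xi> * (\<xi> - t)))) Zx
    - smul R (p * C * (\<xi> * inverse (p\<^sup>2)) * (1 / (t * (\<xi> - t)))) Zt
    - (smul R (p * C * inverse \<xi> * (inverse \<xi> / (inverse \<xi> - inverse t))) Wx
       - smul R (p * C * inverse \<xi> * (inverse t / (inverse \<xi> - inverse t))) Wt)"
    unfolding act_log_log_shift[OF P(1) neq(1) xi_nonzero t_nonzero] act_log_log[OF P(2) neq(2)]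
      Zx_def[symmetric] Zt_def[symmetric] Wx_def[symmetric] Wt_def[symmetric]
    by (simp only: scale_right_distrib scale_right_diff_distrib scale_scale mult.assoc)
  also have "\<dots> = smul R ?A (Zt + Wt - P n) + smul R ?B (Zx + Wx - P n)"
  proof -
    have "smul R (- (A + B)) (P n) + smul R B Zx - smul R (- A) Zt - (smul R (- B) Wx - smul R A Wt) =
        smul R A (Zt + Wt - P n) + smul R B (Zx + Wx - P n)" for A B
      by (simp add: scale_right_distrib scale_right_diff_distrib scale_left_distrib scale_left_diff_distrib)
    then show ?thesis unfolding coeffs .
  qed
  also have "Zt + Wt - P n = smul R (t powi (- m)) (nord R q l1 [(- \<sigma>, i, t), (\<sigma>, i, \<xi>), (- \<sigma>, j, 1)] T v)"
    using delta_term[OF sg(1,2,1) v t_nonzero, of T n]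
    by (simp add: T_def P_def Zt_def Wt_def rescale_W_factors)
  also have "Zx + Wx - P n = smul R (\<xi> powi (- m)) (nord R q l1 [(- \<sigma>, i, \<xi>), (\<sigma>, i, \<xi>), (- \<sigma>, j, 1)] T v)"
    using delta_term[OF sg(1,2,1) v xi_nonzero, of T n]
    by (simp add: T_def P_def Zx_def Wx_def rescale_W_factors)
  also have "nord R q l1 [(- \<sigma>, i, t), (\<sigma>, i, \<xi>), (- \<sigma>, j, 1)] T v = nord R q l1 [(- \<sigma>, j, 1)] T v"
    using nord_cancel[of "[(- \<sigma>, j, 1)]" "- \<sigma>" i t \<xi> T v] sigma i j xi_nonzero
    by (auto simp: valid_factors_def p_def power_int_minus power2_eq_square power_int_mult_distrib mult.commute)
  finally show ?thesis by (simp add: T_def)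
qed

text \<open>
  The current \<open>\<T>(\<xi>; w)\<close> in relative signs, for the indices \<open>i\<close>, \<open>j\<close> and without the mixed term whose
  coefficient vanishes at this \<open>\<xi>\<close>.
\<close>

definition T_pair :: "'v opser" where
  "T_pair n v = smul R p (nord R q l1 (T_factors 1 1) n v) + smul R (inverse p) (nord R q l1 (T_factors (- 1) (- 1)) n v)
     + smul R (p * ((1 - \<xi>\<^sup>2) * (1 - inverse (p\<^sup>2)))) (nord R q l1 (T_factors 1 (- 1)) (n - 2) v)"

lemma W_current_eq: "W_current R q l1 i n v = nord R q l1 (W_factors 1) n v + nord R q l1 (W_factors (- 1)) n v"
  using sigma by (auto simp: W_current_def Lambda_plus_def Lambda_minus_def W_factors_def)

lemma W_current_j_eq: "W_current R q l1 j n v = nord R q l1 [(\<sigma>, j, 1)] n v + nord R q l1 [(- \<sigma>, j, 1)] n v"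
  using sigma by (auto simp: W_current_def Lambda_plus_def Lambda_minus_def)

lemma lin_W: "k \<in> {1, 2} \<Longrightarrow> lin (W_current R q l1 k n)"
  unfolding W_current_def Lambda_plus_def Lambda_minus_def
  by (intro lin_plus lin_nord) (simp_all add: valid_factors_def)

lemma lin_T_pair: "lin (T_pair n)"
  unfolding T_pair_def by (intro lin_plus lin_smul lin_nord valid_T_factors) simp_all

lemma lower_truncated_T_pair: "lower_truncated T_pair"
  unfolding T_pair_def[abs_def]
  by (intro lower_truncated_add lower_truncated_smul nord_lower_truncated valid_T_factors
      lower_truncated_shift[of "nord R q l1 (T_factors 1 (- 1))"]) simp_all

lemma difference_expansion:
  shows "smul R \<xi> (zw_product R (struct_fun q d \<xi>) (W_current R q l1 i) T_pair m n v)
     - wz_product R (struct_fun q d (inverse \<xi>)) T_pair (W_current R q l1 i) m n v =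
    smul R p (term_difference 1 1 1 m n v + term_difference (- 1) 1 1 m n v)
    + smul R (inverse p) (term_difference 1 (- 1) (- 1) m n v + term_difference (- 1) (- 1) (- 1) m n v)
    + smul R (p * ((1 - \<xi>\<^sup>2) * (1 - inverse (p\<^sup>2))))
        (term_difference 1 1 (- 1) m (n - 2) v + term_difference (- 1) 1 (- 1) m (n - 2) v)"
proof -
  let ?C = "p * ((1 - \<xi>\<^sup>2) * (1 - inverse (p\<^sup>2)))"
  let ?T = "\<lambda>a b. nord R q l1 (T_factors a b)" and ?W = "\<lambda>s. nord R q l1 (W_factors s)"
  have sg: "- 1 \<in> {1, - 1::int}" "1 \<in> {1, - 1::int}" by auto
  note vT = valid_T_factors[OF sg(2) sg(2)] valid_T_factors[OF sg(1) sg(1)] valid_T_factors[OF sg(2) sg(1)]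
  note vW = valid_W_factors[OF sg(2)] valid_W_factors[OF sg(1)]
  note lt = nord_lower_truncated[OF vT(1)] nord_lower_truncated[OF vT(2)] nord_lower_truncated[OF vT(3)]
    nord_lower_truncated[OF vW(1)] nord_lower_truncated[OF vW(2)]
  note li = lin_nord[OF vT(1)] lin_nord[OF vT(2)] lin_nord[OF vT(3)] lin_nord[OF vW(1)] lin_nord[OF vW(2)]
  have zT: "zw_product R F A T_pair m n v = smul R p (zw_product R F A (?T 1 1) m n v)
      + smul R (inverse p) (zw_product R F A (?T (- 1) (- 1)) m n v)
      + smul R ?C (zw_product R F A (?T 1 (- 1)) m (n - 2) v)" if A: "\<And>n. lin (A n)" for F A m n
  proof -
    have "zw_product R F A T_pair m n v = zw_product R F A (\<lambda>n v. smul R p (?T 1 1 n v)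
        + smul R (inverse p) (?T (- 1) (- 1) n v)) m n v + zw_product R F A (\<lambda>n v. smul R ?C (?T 1 (- 1) (n - 2) v)) m n v"
      unfolding T_pair_def[abs_def]
      by (intro zw_add_right lower_truncated_add lower_truncated_smul lt
          lower_truncated_shift[of "?T 1 (- 1)"] A)
    also have "zw_product R F A (\<lambda>n v. smul R p (?T 1 1 n v) + smul R (inverse p) (?T (- 1) (- 1) n v)) m n v =
      zw_product R F A (\<lambda>n v. smul R p (?T 1 1 n v)) m n v + zw_product R F A (\<lambda>n v. smul R (inverse p) (?T (- 1) (- 1) n v)) m n v"
      by (intro zw_add_right lower_truncated_smul lt A)
    finally show ?thesis
      by (simp only: zw_smul_right[OF A] zw_shift_right[where B = "?T 1 (- 1)"]
          zw_smul_right[OF A, where c = ?C and B = "\<lambda>n. ?T 1 (- 1) (n - 2)"])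
  qed
  have Tz: "zw_product R F T_pair A m n v = smul R p (zw_product R F (?T 1 1) A m n v)
      + smul R (inverse p) (zw_product R F (?T (- 1) (- 1)) A m n v)
      + smul R ?C (zw_product R F (?T 1 (- 1)) A (m - 2) n v)" if A: "lower_truncated A" for F A m n
  proof -
    have "zw_product R F T_pair A m n v = zw_product R F (\<lambda>n v. smul R p (?T 1 1 n v)
        + smul R (inverse p) (?T (- 1) (- 1) n v)) A m n v + zw_product R F (\<lambda>n v. smul R ?C (?T 1 (- 1) (n - 2) v)) A m n v"
      unfolding T_pair_def[abs_def]
      by (intro zw_add_left lin_plus lin_smul li A)
    also have "zw_product R F (\<lambda>n v. smul R p (?T 1 1 n v) + smul R (inverse p) (?T (- 1) (- 1) n v)) A m n v =
      zw_product R F (\<lambda>n v. smul R p (?T 1 1 n v)) A m n v + zw_product R F (\<lambda>n v. smul R (inverse p) (?T (- 1) (- 1) n v)) A m n v"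
      by (intro zw_add_left lin_smul li A)
    finally show ?thesis
      by (simp only: zw_smul_left zw_shift_left[where A = "?T 1 (- 1)"]
          zw_smul_left[where c = ?C and A = "\<lambda>n. ?T 1 (- 1) (n - 2)"])
  qed
  have W: "W_current R q l1 i = (\<lambda>n v. ?W 1 n v + ?W (- 1) n v)"
    using W_current_eq by blast
  have zW: "zw_product R F (W_current R q l1 i) B m n v = zw_product R F (?W 1) B m n v + zw_product R F (?W (- 1)) B m n v"
    if "lower_truncated B" for F B m n
    unfolding W by (intro zw_add_left li that)
  have Wz: "zw_product R F B (W_current R q l1 i) m n v = zw_product R F B (?W 1) m n v + zw_product R F B (?W (- 1)) m n v"
    if "\<And>n. lin (B n)" for F B m n
    unfolding W by (intro zw_add_right lt that)
  show ?thesis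
    unfolding term_difference_def wz_eq_zw zW[OF lower_truncated_T_pair] Wz[OF lin_T_pair]
      zT[OF li(4)] zT[OF li(5)] Tz[OF lt(4)] Tz[OF lt(5)]
    by (simp add: scale_right_distrib scale_right_diff_distrib mult_ac)
qed

text \<open>
  The residues at \<open>z = \<xi> w\<close> of \<open>pole_xi\<close> and \<open>double_pole\<close> cancel because the factors of index \<open>i\<close> at the
  same point can be exchanged; the residues at \<open>z = t w\<close> add up to \<open>W\<^sub>j\<close>.
\<close>

theorem W_T_relation:
  "smul R \<xi> (zw_product R (struct_fun q d \<xi>) (W_current R q l1 i) T_pair m n v)
     - wz_product R (struct_fun q d (inverse \<xi>)) T_pair (W_current R q l1 i) m n v =
   smul R (p * (\<xi> - inverse \<xi>)) (delta_product R t (W_current R q l1 j) m n v)" (is "?L v = ?R v")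
proof (rule weight_ext[where X = ?L and Y = ?R])
  have "lin (zw_product R F (W_current R q l1 i) T_pair m n)" "lin (zw_product R F T_pair (W_current R q l1 i) n m)" for F
    by (intro lin_zw lower_truncated_T_pair lin_T_pair lin_W i W_current_lower_truncated)+
  then show "lin ?L"
    unfolding wz_eq_zw
    by (intro lin_minus lin_smul) simp_all
  show "lin ?R"
    unfolding delta_product_eq by (intro lin_smul lin_W j)
  fix \<mu> v assume v: "weight \<mu> v"
  have swap: "nord R q l1 [(- \<sigma>, i, \<xi>), (\<sigma>, i, \<xi>), (- \<sigma>, j, 1)] (m + n) v =
      nord R q l1 [(\<sigma>, i, \<xi>), (- \<sigma>, i, \<xi>), (- \<sigma>, j, 1)] (m + n) v"
    using sigma i j by (intro nord_swap) (auto simp: valid_factors_def)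
  show "?L v = ?R v"
    unfolding difference_expansion delta_product_eq W_current_j_eq
      pole_t_plus[OF v] pole_xi[OF v] mixed_regular[OF v]
    using regular_terms[OF v, of 1 m n] regular_terms[OF v, of "- 1" m n] double_pole[OF v refl, of m n]
    by (simp add: swap scale_right_distrib mult.assoc)
qed

end

section \<open>The commutation relations\<close>

context heisenberg_module
begin

lemma q1_q3_inverse: "q1 q d * q3 q d = inverse (q\<^sup>2)"
  using generic by (simp add: generic_def q1_def q3_def power2_eq_square field_simps)

text \<open>
  Exactly one of \<open>q\<^sub>1\<^sup>s\<close>, \<open>q\<^sub>3\<^sup>s\<close> is \<open>\<xi>\<close>, so one mixed coefficient contains the factor \<open>1 - \<xi>\<^sup>-\<^sup>1 \<xi> = 0\<close>, and
  in the other one \<open>q\<^sub>1 q\<^sub>3 = q\<^sup>-\<^sup>2\<close> removes the dependence on the second parameter.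
\<close>

lemma T_current_nord:
  assumes s: "s \<in> {1, - 1}" and parameters: "{\<xi>, \<eta>} = {q1 q d powi s, q3 q d powi s}"
  shows "T_current R q d l1 \<xi> n v = smul R (q powi s) (nord R q l1 [(s, 1, \<xi>), (s, 2, 1)] n v)
    + smul R (inverse (q powi s)) (nord R q l1 [(- s, 1, \<xi>), (- s, 2, 1)] n v)
    + smul R (q powi s * ((1 - \<xi>\<^sup>2) * (1 - inverse ((q powi s)\<^sup>2)))) (nord R q l1 [(s, 1, \<xi>), (- s, 2, 1)] (n - 2) v)"
proof -
  have nz: "q \<noteq> 0" "q1 q d \<noteq> 0" "q3 q d \<noteq> 0" using generic by (auto simp: generic_def q1_def q3_def)
  show ?thesis
  proof (cases "s = 1")
    case True
    then have p: "{\<xi>, \<eta>} = {q1 q d, q3 q d}" using parameters by simp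
    then have "\<xi> = q1 q d \<or> \<xi> = q3 q d" by auto
    then have "(1 - q1 q d * \<xi>) * (1 - q3 q d * \<xi>) = (1 - \<xi>\<^sup>2) * (1 - inverse (q\<^sup>2))"
      "(1 - inverse (q1 q d) * \<xi>) * (1 - inverse (q3 q d) * \<xi>) = 0"
      using nz unfolding q1_q3_inverse[symmetric] by (auto simp: power2_eq_square mult_ac)
    then show ?thesis unfolding T_current_def True by (simp add: mult.assoc)
  next
    case False
    then have s': "s = - 1" using s by simp
    then have "\<xi> = inverse (q1 q d) \<or> \<xi> = inverse (q3 q d)" using parameters by (auto simp: power_int_minus)
    moreover have "q\<^sup>2 = inverse (q1 q d) * inverse (q3 q d)"
      using q1_q3_inverse by (metis inverse_inverse_eq inverse_mult_distrib)
    ultimately have "(1 - inverse (q1 q d) * \<xi>) * (1 - inverse (q3 q d) * \<xi>) = (1 - \<xi>\<^sup>2) * (1 - q\<^sup>2)"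
      "(1 - q1 q d * \<xi>) * (1 - q3 q d * \<xi>) = 0"
      using nz by (auto simp: power2_eq_square mult_ac)
    then show ?thesis unfolding T_current_def s'
      by (simp add: mult.assoc power_int_minus power_inverse add.commute)
  qed
qed

lemma fps_rescale_nth: "fps_rescale c F $ n = c ^ n * F $ n"
  by (simp add: fps_rescale_def fps_compose_linear)

lemma zw_rescale:
  assumes "c \<noteq> 0" "\<And>n. lin (A n)"
  shows "zw_product R (fps_rescale c F) A (opser_rescale R c B) a b v = smul R (c powi b) (zw_product R F A B a b v)"
proof -
  have "c ^ n * c powi (b - int n) = c powi b" for n
    using assms(1) by (simp flip: power_int_of_nat power_int_add)
  then have e: "c ^ n * F $ n * c powi (b - int n) = c powi b * F $ n" for n
    by (metis mult.assoc mult.commute)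
  show ?thesis
    by (simp add: zw_product_def fps_rescale_nth opser_rescale_def lin_scale[OF assms(2)] smul_Sum_any e)
qed

lemma wz_rescale:
  assumes "c \<noteq> 0"
  shows "wz_product R (fps_rescale (inverse c) F) (opser_rescale R c B) A a b v = smul R (c powi b) (wz_product R F B A a b v)"
proof -
  have "inverse c ^ n * c powi (b + int n) = c powi b" for n
    using assms(1) by (simp add: power_int_add power_inverse)
  then have e: "inverse c ^ n * F $ n * c powi (b + int n) = c powi b * F $ n" for n
    by (metis mult.assoc mult.commute)
  show ?thesis
    by (simp add: wz_product_def fps_rescale_nth opser_rescale_def smul_Sum_any e)
qed

lemma delta_rescale:
  assumes "c \<noteq> 0"
  shows "delta_product R e (opser_rescale R c B) a b v = smul R (c powi b) (delta_product R (e / c) B a b v)"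
  using assms by (simp add: delta_product_eq opser_rescale_def power_int_divide_distrib power_int_minus power_int_add field_simps)

text \<open>
  In terms of \<open>w' = \<xi> w\<close> the current \<open>\<T>(\<xi>; w)\<close> is the current for the exchanged indices, the parameter
  \<open>\<xi>\<^sup>-\<^sup>1\<close> and the opposite sign.
\<close>

lemma T_current_exchange:
  assumes s: "s \<in> {1, - 1}" and parameters: "{\<xi>, \<eta>} = {q1 q d powi s, q3 q d powi s}"
    and \<xi>: "\<xi> \<noteq> 0"
  shows "T_current R q d l1 \<xi> n v = smul R (\<xi> powi n) (
     smul R (q powi (- s)) (nord R q l1 [(- s, 2, inverse \<xi>), (- s, 1, 1)] n v)
    + smul R (q powi s) (nord R q l1 [(s, 2, inverse \<xi>), (s, 1, 1)] n v)
    + smul R (q powi (- s) * ((1 - (inverse \<xi>)\<^sup>2) * (1 - (q powi s)\<^sup>2))) (nord R q l1 [(- s, 2, inverse \<xi>), (s, 1, 1)] (n - 2) v))"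
proof -
  have ex: "nord R q l1 [(a, 1, \<xi>), (b, 2, 1)] m v = smul R (\<xi> powi m) (nord R q l1 [(b, 2, inverse \<xi>), (a, 1, 1)] m v)"
    if "a \<in> {1, - 1}" "b \<in> {1, - 1}" for a b m
  proof -
    have "valid_factors [(b, 2, inverse \<xi>), (a, 1, 1)]" using that by (auto simp: valid_factors_def)
    from nord_rescale[OF this \<xi>, of m v] show ?thesis
      using nord_swap[of "(a, 1, \<xi>)" "(b, 2, 1)" "[]" m v] that \<xi>
      by (auto simp: rescale_factors_def valid_factors_def)
  qed
  have nz: "q powi s \<noteq> 0" using q_nonzero by simp
  have sg: "s \<in> {1, - 1}" "- s \<in> {1, - 1}" using s by auto
  have "q powi s * ((1 - \<xi>\<^sup>2) * (1 - inverse ((q powi s)\<^sup>2))) * \<xi> powi (n - 2) =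
    \<xi> powi n * (q powi (- s) * ((1 - (inverse \<xi>)\<^sup>2) * (1 - (q powi s)\<^sup>2)))"
  proof -
    define u where "u = q powi s"
    have "\<xi> powi (n - 2) = \<xi> powi n / \<xi>\<^sup>2" using \<xi> by (simp add: power_int_diff)
    moreover have "u * ((1 - \<xi>\<^sup>2) * (1 - inverse (u\<^sup>2))) * (x / \<xi>\<^sup>2) = x * (inverse u * ((1 - (inverse \<xi>)\<^sup>2) * (1 - u\<^sup>2)))" for x
      using \<xi> nz by (simp add: u_def[symmetric] divide_simps) (simp add: power2_eq_square algebra_simps)
    ultimately show ?thesis by (simp add: u_def power_int_minus)
  qed
  then show ?thesis
    unfolding T_current_nord[OF s parameters] ex[OF sg(1,1)] ex[OF sg(2,2)] ex[OF sg]
    by (simp add: scale_right_distrib power_int_minus mult_ac add.left_commute)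
qed

end

theorem theorem5p6:
  fixes R :: "('v::ab_group_add) heis"
    and q d l1 l3 qk :: complex and s :: int
  assumes "heisenberg_module R q d l1 l3"
    and "qk \<in> {q1 q d, q3 q d}"
    and "s \<in> {1, -1}"
  shows
    "(\<forall>a b v.
       smul R (qk powi s)
         (zw_product R (struct_fun q d (qk powi s))
            (W_current R q l1 1) (T_current R q d l1 (qk powi s)) a b v)
     - wz_product R (struct_fun q d (qk powi (- s)))
         (T_current R q d l1 (qk powi s)) (W_current R q l1 1) a b v
     = smul R (of_int s * q powi s * (qk - inverse qk))
         (delta_product R (qk powi s / q2 q powi s) (W_current R q l1 2) a b v))
   \<and> (\<forall>a b v.
       smul R (qk powi (- s))
         (zw_product R (fps_rescale (qk powi s) (struct_fun q d (qk powi (- s))))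
            (W_current R q l1 2) (T_current R q d l1 (qk powi s)) a b v)
     - wz_product R (fps_rescale (inverse (qk powi s)) (struct_fun q d (qk powi s)))
         (T_current R q d l1 (qk powi s)) (W_current R q l1 2) a b v
     = smul R (- of_int s * q powi (- s) * (qk - inverse qk))
         (delta_product R (q2 q powi s)
            (opser_rescale R (qk powi s) (W_current R q l1 1)) a b v))"
proof -
  interpret H: heisenberg_module R q d l1 l3 by fact
  obtain ql where ql: "{qk, ql} = {q1 q d, q3 q d}" using assms(2) by auto
  define \<xi> where "\<xi> = qk powi s"
  define \<eta> where "\<eta> = ql powi s"
  have parameters: "{\<xi>, \<eta>} = {q1 q d powi s, q3 q d powi s}"
    using ql by (auto simp: \<xi>_def \<eta>_def doubleton_eq_iff)
  then have parameters': "{inverse \<xi>, inverse \<eta>} = {q1 q d powi (- s), q3 q d powi (- s)}"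
    by (auto simp: doubleton_eq_iff power_int_minus)
  have \<xi>: "\<xi> \<noteq> 0"
    using H.q_nonzero assms(2) H.generic by (auto simp: \<xi>_def q1_def q3_def generic_def)
  have \<xi>_inverse: "qk powi (- s) = inverse \<xi>" by (simp add: \<xi>_def power_int_minus)
  have qk: "\<xi> - inverse \<xi> = of_int s * (qk - inverse qk)"
    using assms(3) by (auto simp: \<xi>_def power_int_minus)
  have q2: "q2 q powi s = (q powi s)\<^sup>2"
    by (simp add: q2_def power2_eq_square power_int_mult_distrib)
  interpret P: current_pair R q d l1 l3 s 1 2 \<xi> \<eta>
    by unfold_locales (use assms(3) parameters in auto)
  \<comment> \<open>The second relation is the first one for exchanged indices, opposite sign and inverse parameters.\<close>
  interpret P': current_pair R q d l1 l3 "- s" 2 1 "inverse \<xi>" "inverse \<eta>"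
    by unfold_locales (use assms(3) parameters' in auto)
  have T: "T_current R q d l1 \<xi> = P.T_pair"
    by (intro ext) (simp add: H.T_current_nord[OF assms(3) parameters] P.T_pair_def P.T_factors_def P.p_def)
  have T': "T_current R q d l1 \<xi> = opser_rescale R \<xi> P'.T_pair"
    by (intro ext) (simp add: H.T_current_exchange[OF assms(3) parameters \<xi>] opser_rescale_def P'.T_pair_def P'.T_factors_def P'.p_def
        power_int_minus power_inverse)
  have "smul R \<xi> (zw_product R (struct_fun q d \<xi>) (W_current R q l1 1) (T_current R q d l1 \<xi>) a b v)
     - wz_product R (struct_fun q d (inverse \<xi>)) (T_current R q d l1 \<xi>) (W_current R q l1 1) a b v
     = smul R (of_int s * q powi s * (qk - inverse qk))
         (delta_product R (\<xi> / q2 q powi s) (W_current R q l1 2) a b v)" for a b v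
  proof -
    have "q powi s * (\<xi> - inverse \<xi>) = of_int s * q powi s * (qk - inverse qk)" by (simp add: qk)
    then show ?thesis
      using P.W_T_relation[of a b v] by (simp only: T P.p_def q2 divide_inverse)
  qed
  moreover have "smul R (inverse \<xi>) (zw_product R (fps_rescale \<xi> (struct_fun q d (inverse \<xi>)))
            (W_current R q l1 2) (T_current R q d l1 \<xi>) a b v)
     - wz_product R (fps_rescale (inverse \<xi>) (struct_fun q d \<xi>)) (T_current R q d l1 \<xi>) (W_current R q l1 2) a b v
     = smul R (- of_int s * q powi (- s) * (qk - inverse qk))
         (delta_product R (q2 q powi s) (opser_rescale R \<xi> (W_current R q l1 1)) a b v)" for a b v
  proof -
    have c: "q powi (- s) * (inverse \<xi> - inverse (inverse \<xi>)) = - of_int s * q powi (- s) * (qk - inverse qk)"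
    proof -
      have "q powi (- s) * (inverse \<xi> - inverse (inverse \<xi>)) = - (q powi (- s) * (\<xi> - inverse \<xi>))"
        by (simp add: algebra_simps)
      then show ?thesis unfolding qk by simp
    qed
    have t: "inverse \<xi> * inverse ((q powi (- s))\<^sup>2) = q2 q powi s / \<xi>"
      by (simp add: q2 power_int_minus power_inverse divide_inverse)
    have "smul R (\<xi> powi b) (smul R (inverse \<xi>) (zw_product R (struct_fun q d (inverse \<xi>)) (W_current R q l1 2) P'.T_pair a b v)
      - wz_product R (struct_fun q d (inverse (inverse \<xi>))) P'.T_pair (W_current R q l1 2) a b v) =
      smul R (\<xi> powi b) (smul R (- of_int s * q powi (- s) * (qk - inverse qk))
         (delta_product R (q2 q powi s / \<xi>) (W_current R q l1 1) a b v))"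
      unfolding P'.W_T_relation P'.p_def c t ..
    then show ?thesis
      unfolding T' H.zw_rescale[OF \<xi> P'.lin_W[OF P'.i]] H.wz_rescale[OF \<xi>] H.delta_rescale[OF \<xi>]
      by (simp add: H.scale_right_diff_distrib mult.commute)
  qed
  ultimately show ?thesis
    unfolding \<xi>_def[symmetric] \<xi>_inverse by blast
qed

end
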